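(* Let $p$ be an odd prime, let $K/\mathbb{F}_p(t)$ be a finite separable extension, and let $S=\{\phi_1,\phi_2,\dots,\phi_s\}$ be a finite set of polynomials in $K[x]$ of degree at least $3$ satisfying: (1) $\deg(\phi)\deg(\psi)\,\delta_\phi\,\delta_\psi\,(b_\phi-f_\psi)\neq0$ in $K$ for all $\phi,\psi\in S$; (2) $0\not\in\operatorname{PrePer}(\Phi_S)$. Then the Zsigmondy set $\mathcal{Z}(\gamma,P)$ is finite for all $(\gamma,P)\in G_S$.
   Context: Derivation: the derivative $\frac{d}{dt}$ on $\mathbb{F}_p(t)$ extends uniquely to $K$; $\beta'$ denotes the derivative of $\beta\in K$. For $\phi(x)=A_0x^d+A_1x^{d-1}+\dots+A_{d-1}x+A_d\in K[x]$ of degree $d\ge3$ define $$\delta_\phi:=2dA_0A_{2}-(d-1)A_{1}^2,$$ $$b_\phi:=\big(dA_0^2A_2' - (d-1)A_0A_1A_1' - dA_0A_2A_0' + (d-1)A_1^2A_0'\big)/\delta_\phi,$$ $$f_\phi:=\big(d^2A_0^2A_2' - d(d-1)A_0A_1A_1' - d(d-2)A_0A_2A_0' + (d(d-2)+1)A_1^2A_0'\big)/\delta_\phi.$$ (Condition (1) means in particular that each $\deg(\phi)$ and $\delta_\phi$ is nonzero in $K$, so that $b_\phi,f_\phi$ are defined.) Sequences: $\Phi_S=\prod_{i=1}^\infty S$. For $\gamma=(\theta_n)_{n\ge1}\in\Phi_S$ and $m\ge1$, $\gamma_m\cdot P=(\theta_m\circ\cdots\circ\theta_1)(P)$, $\deg(\gamma_m)=\prod_{i=1}^m\deg(\theta_i)$,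 $\operatorname{Orb}_\gamma(P)=\{\gamma_m\cdot P:m\ge1\}$. With $h$ the Weil height on $\mathbb{P}^1(\overline K)$ (for $\alpha\in K^*$, $h(\alpha)=-\sum_v\min\{v(\alpha),0\}N_v$, $v$ ranging over the valuations of $K$ and $N_v$ the local degree of $v$), $\hat h_\gamma(P):=\lim_{n\to\infty}h(\gamma_n\cdot P)/\deg(\gamma_n)$ (the limit exists). $\operatorname{PrePer}(\Phi_S):=\{Q\in\mathbb{P}^1(\overline{K}):\hat{h}_\psi(Q)=0\text{ for some }\psi\in\Phi_S\}$. $G_S:=\{(\gamma,P)\in\Phi_S\times\mathbb{P}^1(K): \hat{h}_\gamma(P)>0\text{ and }0,\infty\not\in\operatorname{Orb}_{\gamma}(P)\cup\operatorname{Orb}_\gamma(0)\}$. A valuation $v$ of $K$ is a primitive prime divisor of $\gamma_n\cdot P$ if $v(\gamma_n\cdot P)>0$ and $v(\gamma_m\cdot P)\leq0$ for all $1\leq m\leq n-1$. The Zsigmondy set is $\mathcal{Z}(\gamma,P):=\{n\ge 1:\gamma_n\cdot P\text{ has no primitive prime divisor}\}$. *)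

theory Defs
  imports
    "Berlekamp_Zassenhaus.Finite_Field"
    "HOL-Algebra.Algebraic_Closure_Type"
    "HOL-Algebra.Generated_Fields"
    "HOL-Computational_Algebra.Fraction_Field"
    "HOL-Analysis.Infinite_Sum"
begin

text \<open>
  The ground field \<open>F\<^sub>p(t)\<close> is \<^typ>\<open>'p::prime_card mod_ring poly fract\<close> with \<open>p = CARD('p)\<close>.
  An extension field is a type \<open>'k\<close> of class \<^class>\<open>field\<close> together with a field homomorphism
  \<open>\<iota>\<close> from the ground field. The algebraic closure of \<open>'k\<close> is \<open>'k alg_closure\<close>, with embedding
  \<^const>\<open>to_ac\<close>.
\<close>

section \<open>Finite separable extensions and the derivation\<close>

definition separable_poly :: "'a::field poly \<Rightarrow> bool" where
  "separable_poly q \<longleftrightarrow> coprime q (pderiv q)"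

definition finite_separable_extension :: "('f::field \<Rightarrow> 'k::field) \<Rightarrow> bool" where
  "finite_separable_extension \<iota> \<longleftrightarrow>
     field_hom \<iota> \<and>
     ring.finite_dimension (ring_of_type_algebra :: 'k ring) (range \<iota>) UNIV \<and>
     (\<forall>x. \<exists>q. Factorial_Ring.irreducible q \<and> poly (map_poly \<iota> q) x = 0 \<and> separable_poly q)"

definition is_derivation :: "('k::field \<Rightarrow> 'k) \<Rightarrow> bool" where
  "is_derivation D \<longleftrightarrow>
     (\<forall>x y. D (x + y) = D x + D y) \<and> (\<forall>x y. D (x * y) = D x * y + x * D y)"

text \<open>The unique derivation of \<open>'k\<close> extending \<open>d/dt\<close>, the latter given by the quotient rule.\<close>

definition deriv_ext :: "('p::prime_card mod_ring poly fract \<Rightarrow> 'k::field) \<Rightarrow> 'k \<Rightarrow> 'k" where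
  "deriv_ext \<iota> = (THE D. is_derivation D \<and>
     (\<forall>a b. b \<noteq> 0 \<longrightarrow> D (\<iota> (Fract a b)) = \<iota> (Fract (pderiv a * b - a * pderiv b) (b ^ 2))))"

section \<open>The quantities attached to a polynomial\<close>

text \<open>Coefficients are numbered from the top: \<open>\<phi>(x) = A\<^sub>0 x\<^sup>d + A\<^sub>1 x\<^sup>d\<^sup>-\<^sup>1 + \<dots> + A\<^sub>d\<close>.\<close>

definition top_coeff :: "'k::field poly \<Rightarrow> nat \<Rightarrow> 'k" where
  "top_coeff \<phi> i = Polynomial.coeff \<phi> (Polynomial.degree \<phi> - i)"

definition delta_poly :: "'k::field poly \<Rightarrow> 'k" where
  "delta_poly \<phi> =
     (let d = of_nat (Polynomial.degree \<phi>); A = top_coeff \<phi> in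
      2 * d * A 0 * A 2 - (d - 1) * A 1 ^ 2)"

definition b_poly :: "('k::field \<Rightarrow> 'k) \<Rightarrow> 'k poly \<Rightarrow> 'k" where
  "b_poly D \<phi> =
     (let d = of_nat (Polynomial.degree \<phi>); A = top_coeff \<phi> in
      (d * A 0 ^ 2 * D (A 2) - (d - 1) * A 0 * A 1 * D (A 1)
         - d * A 0 * A 2 * D (A 0) + (d - 1) * A 1 ^ 2 * D (A 0)) / delta_poly \<phi>)"

definition f_poly :: "('k::field \<Rightarrow> 'k) \<Rightarrow> 'k poly \<Rightarrow> 'k" where
  "f_poly D \<phi> =
     (let d = of_nat (Polynomial.degree \<phi>); A = top_coeff \<phi> in
      (d ^ 2 * A 0 ^ 2 * D (A 2) - d * (d - 1) * A 0 * A 1 * D (A 1)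
         - d * (d - 2) * A 0 * A 2 * D (A 0)
         + (d * (d - 2) + 1) * A 1 ^ 2 * D (A 0)) / delta_poly \<phi>)"

section \<open>Valuations and heights\<close>

text \<open>
  The normalized discrete valuations of a subfield \<open>L\<close> of an ambient field: surjective onto the
  integers on \<open>L - {0}\<close>. The values at \<open>0\<close> and outside \<open>L\<close> are fixed to the dummy value \<open>0\<close>, so
  that each valuation is represented by exactly one function; the convention \<open>v(0) = \<infinity>\<close> is
  restored in \<open>val_pt\<close> below.
\<close>

definition valuations :: "'a::field set \<Rightarrow> ('a \<Rightarrow> int) set" where
  "valuations L = {v.
     v ` (L - {0}) = UNIV \<and>
     (\<forall>x\<in>L - {0}. \<forall>y\<in>L - {0}. v (x * y) = v x + v y) \<and>
     (\<forall>x\<in>L - {0}. \<forall>y\<in>L - {0}. x + y \<noteq> 0 \<longrightarrow> min (v x) (v y) \<le> v (x + y)) \<and>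
     (\<forall>x. x \<notin> L - {0} \<longrightarrow> v x = 0)}"

definition val_ring :: "'a::field set \<Rightarrow> ('a \<Rightarrow> int) \<Rightarrow> 'a ring" where
  "val_ring L v = ring_of_type_algebra\<lparr>carrier := {x \<in> L. x = 0 \<or> v x \<ge> 0}\<rparr>"

definition residue_field :: "'a::field set \<Rightarrow> ('a \<Rightarrow> int) \<Rightarrow> 'a set ring" where
  "residue_field L v = val_ring L v Quot {x \<in> L. x = 0 \<or> v x > 0}"

text \<open>
  The local degree \<open>N\<^sub>v\<close> is the degree of the residue field over \<open>F\<^sub>p\<close>, which is its prime field,
  i.e. the subfield generated by the empty set.
\<close>

definition local_degree :: "'a::field set \<Rightarrow> ('a \<Rightarrow> int) \<Rightarrow> nat" where
  "local_degree L v =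
     (let k = residue_field L v in ring.dim k (generate_field k {}) (carrier k))"

definition field_height :: "'a::field set \<Rightarrow> 'a \<Rightarrow> real" where
  "field_height L \<alpha> =
     (if \<alpha> = 0 then 0
      else - (\<Sum>\<^sub>\<infinity>v\<in>valuations L. real_of_int (min (v \<alpha>) 0) * real (local_degree L v)))"

definition adjoin_ac :: "'k::field alg_closure \<Rightarrow> 'k alg_closure set" where
  "adjoin_ac \<alpha> = generate_field ring_of_type_algebra (insert \<alpha> (range to_ac))"

datatype 'a proj_line = Aff 'a | Infty

text \<open>
  The Weil height on \<open>P\<^sup>1\<close> of the algebraic closure, normalized relative to \<open>K = 'k\<close>: the height of
  \<open>\<alpha>\<close> is computed in \<open>K(\<alpha>)\<close> and divided by \<open>[K(\<alpha>) : K]\<close>.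
\<close>

definition weil_height :: "'k::field alg_closure proj_line \<Rightarrow> real" where
  "weil_height Q = (case Q of
       Infty \<Rightarrow> 0
     | Aff \<alpha> \<Rightarrow> field_height (adjoin_ac \<alpha>) \<alpha>
                / real (ring.dim (ring_of_type_algebra :: 'k alg_closure ring)
                          (range to_ac) (adjoin_ac \<alpha>)))"

section \<open>Dynamics\<close>

text \<open>The action of a polynomial on the projective line; only used for nonconstant polynomials.\<close>

definition poly_act :: "'a::field poly \<Rightarrow> 'a proj_line \<Rightarrow> 'a proj_line" where
  "poly_act \<phi> Q = (case Q of Infty \<Rightarrow> Infty | Aff x \<Rightarrow> Aff (poly \<phi> x))"

text \<open>A sequence \<open>(\<theta>\<^sub>n)\<^sub>n\<^sub>\<ge>\<^sub>1\<close> is represented by \<open>\<gamma>\<close> with \<open>\<gamma> n = \<theta>\<^sub>n\<^sub>+\<^sub>1\<close>.\<close>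

definition sequences :: "'a set \<Rightarrow> (nat \<Rightarrow> 'a) set" where
  "sequences S = {\<gamma>. \<forall>n. \<gamma> n \<in> S}"

primrec seq_act :: "(nat \<Rightarrow> 'a::field poly) \<Rightarrow> nat \<Rightarrow> 'a proj_line \<Rightarrow> 'a proj_line" where
  "seq_act \<gamma> 0 Q = Q"
| "seq_act \<gamma> (Suc m) Q = poly_act (\<gamma> m) (seq_act \<gamma> m Q)"

definition seq_degree :: "(nat \<Rightarrow> 'a::field poly) \<Rightarrow> nat \<Rightarrow> nat" where
  "seq_degree \<gamma> m = (\<Prod>i<m. Polynomial.degree (\<gamma> i))"

definition seq_orbit :: "(nat \<Rightarrow> 'a::field poly) \<Rightarrow> 'a proj_line \<Rightarrow> 'a proj_line set" where
  "seq_orbit \<gamma> Q = {seq_act \<gamma> m Q | m. m \<ge> 1}"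

definition canonical_height ::
    "(nat \<Rightarrow> 'k::field poly) \<Rightarrow> 'k alg_closure proj_line \<Rightarrow> real" where
  "canonical_height \<gamma> Q =
     lim (\<lambda>n. weil_height (seq_act (\<lambda>i. map_poly to_ac (\<gamma> i)) n Q) / real (seq_degree \<gamma> n))"

definition PrePer :: "'k::field poly set \<Rightarrow> 'k alg_closure proj_line set" where
  "PrePer S = {Q. \<exists>\<psi>\<in>sequences S. canonical_height \<psi> Q = 0}"

definition good_pairs ::
    "'k::field poly set \<Rightarrow> ((nat \<Rightarrow> 'k poly) \<times> 'k proj_line) set" where
  "good_pairs S = {(\<gamma>, P). \<gamma> \<in> sequences S \<and>
     canonical_height \<gamma> (map_proj_line to_ac P) > 0 \<and>
     Aff 0 \<notin> seq_orbit \<gamma> P \<union> seq_orbit \<gamma> (Aff 0) \<and>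
     Infty \<notin> seq_orbit \<gamma> P \<union> seq_orbit \<gamma> (Aff 0)}"

text \<open>The value of a valuation of \<open>K\<close> at a point, with \<open>v(0) = \<infinity>\<close> and \<open>v(\<infinity>) = -\<infinity>\<close>.\<close>

definition val_pt :: "('k::field \<Rightarrow> int) \<Rightarrow> 'k proj_line \<Rightarrow> ereal" where
  "val_pt v Q = (case Q of Infty \<Rightarrow> -\<infinity>
     | Aff x \<Rightarrow> if x = 0 then \<infinity> else ereal (real_of_int (v x)))"

definition primitive_prime_divisor ::
    "(nat \<Rightarrow> 'k::field poly) \<Rightarrow> 'k proj_line \<Rightarrow> nat \<Rightarrow> ('k \<Rightarrow> int) \<Rightarrow> bool" where
  "primitive_prime_divisor \<gamma> P n v \<longleftrightarrow>
     v \<in> valuations UNIV \<and> val_pt v (seq_act \<gamma> n P) > 0 \<and>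
     (\<forall>m. 1 \<le> m \<and> m \<le> n - 1 \<longrightarrow> val_pt v (seq_act \<gamma> m P) \<le> 0)"

definition zsigmondy_set ::
    "(nat \<Rightarrow> 'k::field poly) \<Rightarrow> 'k proj_line \<Rightarrow> nat set" where
  "zsigmondy_set \<gamma> P = {n. n \<ge> 1 \<and> \<not> (\<exists>v. primitive_prime_divisor \<gamma> P n v)}"

end

theory Submission
  imports Defs
begin

text \<open>
  Suppose that infinitely many \<open>n\<close> have no primitive prime divisor. A place dividing both \<open>\<gamma>\<^sub>n \<cdot> P\<close> and an
  earlier \<open>\<gamma>\<^sub>m \<cdot> P\<close> divides the value at \<open>0\<close> of the composition leading from time \<open>m\<close> to time \<open>n\<close>, which is
  nonzero because \<open>0\<close> is not preperiodic. Using the first alternative for \<open>m \<le> n/2\<close> and the second for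
  \<open>m > n/2\<close>, the support of \<open>\<gamma>\<^sub>n \<cdot> P\<close> has degree negligible against its height, so \<open>y' = u y\<close> for
  \<open>y = \<gamma>\<^sub>n \<cdot> P\<close> with \<open>u\<close> of small height. Let \<open>y = f(z)\<close> with \<open>f\<close> translated such that its second
  coefficient vanishes. Eliminating by \<open>f'(z)\<close> and applying the product formula shows that this is only
  possible if \<open>z' = \<alpha> z\<close> where \<open>\<alpha>\<close> depends on \<open>f\<close> alone (here \<open>\<delta>\<^sub>f \<noteq> 0\<close> enters) and if \<open>f\<close> maps all
  solutions of this equation to solutions of \<open>y' = u y\<close>. Now \<open>z' = \<alpha> z\<close> has bounded coefficients, so the
  argument repeats backwards along the whole orbit, down to a fixed time. Up to a factor which depends on
  the polynomials alone, the orbit and the polynomials therefore consist of \<open>p\<close>-th powers. Extracting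
  \<open>p\<close>-th roots gives a situation of the same kind, and this descent contradicts the discreteness of a
  place at which the orbit has a pole.
\<close>

text \<open>All facts on function fields come from one counting property. Digit sums in powers of an
  element \<open>x\<close> are counted; comparing their number with a finite set containing them
  gives finite residue fields, finitely many zeros, discreteness of valuation rings, the product
  formula and the fact that K has degree p over \<open>p\<close>-th powers. For a uniformizer
  \<open>u\<close> this degree provides a derivation with kernel exactly the \<open>p\<close>-th
  powers, so that roots can be extracted. The descent needs a quantity that survives root
  extraction. For a centred polynomial with top coefficients A0, 0, A2 put B = A2 / A0. If its
  coefficients are compatible with z' = \<alpha> z, then B' = 2 \<alpha> B. Hence \<alpha> is read
  off from the polynomial, z^2 / B is a constant, and e = B^((p+1)/2) solves e' = \<alpha> e,
  because twice the exponent is 1 in K. Dividing z by e and taking the root turns z^2 / B into its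
  p-th root, again of the same shape, so the order of a pole is divided by p each time. A centred
  polynomial depends on the original one and on its successor. Hence the bookkeeping by pairs of
  consecutive polynomials that recur infinitely often.\<close>

text \<open>\<open>vge v k x\<close> is \<open>v(x) \<ge> k\<close> with the convention \<open>v(0) = \<infinity>\<close>; the junk value of a place at \<open>0\<close> is \<open>0\<close>.\<close>

definition vge :: "('a::field \<Rightarrow> int) \<Rightarrow> int \<Rightarrow> 'a \<Rightarrow> bool" where
  "vge v k x \<longleftrightarrow> x = 0 \<or> k \<le> v x"

abbreviation places :: "('a::field \<Rightarrow> int) set" where
  "places \<equiv> valuations UNIV"

section \<open>Elementary calculus of places\<close>

lemma val_mult: "v \<in> places \<Longrightarrow> x \<noteq> 0 \<Longrightarrow> y \<noteq> 0 \<Longrightarrow> v (x * y) = v x + v y"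
  by (auto simp: valuations_def)

lemma val_zero: "v \<in> places \<Longrightarrow> v 0 = 0"
  by (auto simp: valuations_def)

lemma val_one: "v \<in> places \<Longrightarrow> v 1 = 0"
  using val_mult[of v 1 1] by simp

lemma val_uminus:
  assumes v: "v \<in> places" shows "v (- x) = v x"
proof (cases "x = 0")
  case False
  have "v (-1) + v (-1) = 0"
    using val_mult[OF v, of "-1" "-1"] val_one[OF v] by simp
  then have "v (-1) = 0" by simp
  then show ?thesis using val_mult[OF v, of "-1" x] False by simp
qed simp

lemma val_inverse: "v \<in> places \<Longrightarrow> v (inverse x) = - v x"
  using val_mult[of v x "inverse x"] val_one[of v] val_zero[of v] by (cases "x = 0") auto

lemma val_divide: "v \<in> places \<Longrightarrow> x \<noteq> 0 \<Longrightarrow> y \<noteq> 0 \<Longrightarrow> v (x / y) = v x - v y"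
  using val_mult[of v x "inverse y"] val_inverse[of v y] by (simp add: divide_inverse)

lemma val_power:
  assumes v: "v \<in> places" shows "v (x ^ n) = int n * v x"
proof (cases "x = 0")
  case True
  then show ?thesis using val_zero[OF v] val_one[OF v] by (cases "n = 0") (auto simp: power_0_left)
next
  case False
  then show ?thesis
    by (induction n) (simp_all add: val_one[OF v] val_mult[OF v] algebra_simps)
qed

lemma vge_zero [simp]: "vge v k 0"
  by (simp add: vge_def)

lemma vge_mono: "vge v k x \<Longrightarrow> l \<le> k \<Longrightarrow> vge v l x"
  by (auto simp: vge_def)

lemma vge_add:
  assumes v: "v \<in> places" and "vge v k x" "vge v k y"
  shows "vge v k (x + y)"
proof -
  have "min (v x) (v y) \<le> v (x + y)" if "x \<noteq> 0" "y \<noteq> 0" "x + y \<noteq> 0"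
    using v that by (auto simp: valuations_def)
  then show ?thesis using assms(2,3) by (fastforce simp: vge_def min_def split: if_splits)
qed

lemma vge_uminus: "v \<in> places \<Longrightarrow> vge v k (- x) \<longleftrightarrow> vge v k x"
  by (simp add: vge_def val_uminus)

lemma vge_diff: "v \<in> places \<Longrightarrow> vge v k x \<Longrightarrow> vge v k y \<Longrightarrow> vge v k (x - y)"
  using vge_add[of v k x "- y"] by (simp add: vge_uminus)

lemma vge_diff_commute: "v \<in> places \<Longrightarrow> vge v k (x - y) \<longleftrightarrow> vge v k (y - x)"
  using vge_uminus[of v k "x - y"] by simp

lemma vge_mult: "v \<in> places \<Longrightarrow> vge v k x \<Longrightarrow> vge v l y \<Longrightarrow> vge v (k + l) (x * y)"
  by (cases "x = 0"; cases "y = 0") (auto simp: vge_def val_mult)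

lemma vge_mult0: "v \<in> places \<Longrightarrow> vge v k x \<Longrightarrow> vge v 0 y \<Longrightarrow> vge v k (x * y)"
  using vge_mult[of v k x 0 y] by simp

lemma vge_power: "v \<in> places \<Longrightarrow> vge v k x \<Longrightarrow> vge v (int n * k) (x ^ n)"
  by (cases "n = 0") (auto simp: vge_def mult_left_mono val_power val_one)

lemma vge_power0: "v \<in> places \<Longrightarrow> vge v 0 x \<Longrightarrow> vge v 0 (x ^ n)"
  using vge_power[of v 0 x n] by simp

lemma vge_sum:
  "v \<in> places \<Longrightarrow> (\<And>i. i \<in> I \<Longrightarrow> vge v k (f i)) \<Longrightarrow> vge v k (sum f I)"
  by (induction I rule: infinite_finite_induct) (auto intro: vge_add)

lemma vge_one: "v \<in> places \<Longrightarrow> vge v 0 1"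
  by (simp add: vge_def val_one)

lemma vge_of_nat: "v \<in> places \<Longrightarrow> vge v 0 (of_nat n)"
  by (induction n) (auto intro: vge_add vge_one)

lemma vge_cancel_mult:
  "v \<in> places \<Longrightarrow> a \<noteq> 0 \<Longrightarrow> vge v (v a + k) (a * x) \<longleftrightarrow> vge v k x"
  by (cases "x = 0") (auto simp: vge_def val_mult)

lemma vge_divide_iff:
  "v \<in> places \<Longrightarrow> a \<noteq> 0 \<Longrightarrow> vge v k (x / a) \<longleftrightarrow> vge v (k + v a) x"
  by (cases "x = 0") (auto simp: vge_def val_divide)

lemma vge_trans_diff:
  "v \<in> places \<Longrightarrow> vge v k (x - y) \<Longrightarrow> vge v k (y - z) \<Longrightarrow> vge v k (x - z)"
  using vge_add[of v k "x - y" "y - z"] by simp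

text \<open>If the value went up, \<open>x\<close> as the difference of \<open>x + y\<close> and
  \<open>y\<close> would have value at least \<open>v x + 1\<close>. This is the tool for every
  later argument with a dominant term.\<close>

lemma val_add_eq:
  assumes v: "v \<in> places" and x: "x \<noteq> 0" and y: "vge v (v x + 1) y"
  shows "x + y \<noteq> 0" "v (x + y) = v x"
proof -
  have 1: "\<not> vge v (v x + 1) (x + y)"
    using vge_diff[OF v _ y, of "x + y"] x by (auto simp: vge_def)
  then show "x + y \<noteq> 0" by auto
  have "vge v (v x) (x + y)"
    by (intro vge_add v vge_mono[OF y]) (auto simp: vge_def)
  with 1 show "v (x + y) = v x" by (auto simp: vge_def)
qed

lemma uniformizer_exists:
  assumes v: "v \<in> places" obtains u where "u \<noteq> 0" "v u = k"
proof -
  have "k \<in> v ` (UNIV - {0})" using v by (auto simp: valuations_def)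
  then show ?thesis using that by auto
qed

text \<open>Units for \<open>v\<close> are units for \<open>w\<close>, so \<open>w\<close> is the
  multiple \<open>w u\<close> of \<open>v\<close>, where \<open>u\<close> is a uniformizer of
  \<open>v\<close>. Surjectivity of \<open>w\<close> onto the integers leaves only the factor
  1.\<close>

lemma places_eqI:
  assumes v: "v \<in> places" and w: "w \<in> places"
    and sub: "\<And>x. vge v 0 x \<Longrightarrow> vge w 0 x"
  shows "v = w"
proof
  fix x :: 'a
  obtain u where u: "u \<noteq> 0" "v u = 1" using uniformizer_exists[OF v] by blast
  have unit: "w y = 0" if "v y = 0" "y \<noteq> 0" for y
    using sub[of y] sub[of "inverse y"] that val_inverse[OF v, of y] val_inverse[OF w, of y]
    by (simp add: vge_def)
  have eq: "w y = w u * v y" if y: "y \<noteq> 0" for y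
  proof (cases "v y \<ge> 0")
    case True
    have un: "u ^ nat (v y) \<noteq> 0" using u by simp
    have "w (y / u ^ nat (v y)) = 0"
      using y u True by (intro unit) (simp_all add: val_divide[OF v y un] val_power[OF v])
    then show ?thesis using True by (simp add: val_divide[OF w y un] val_power[OF w] mult.commute)
  next
    case False
    have un: "u ^ nat (- v y) \<noteq> 0" using u by simp
    have "w (y * u ^ nat (- v y)) = 0"
      using y u False by (intro unit) (simp_all add: val_mult[OF v y un] val_power[OF v])
    then show ?thesis using False by (simp add: val_mult[OF w y un] val_power[OF w] mult.commute)
  qed
  obtain y where "y \<noteq> 0" "w y = 1" using uniformizer_exists[OF w] by blast
  with eq[of y] have "w u * v y = 1" by simp
  moreover have "w u \<ge> 0" using sub[of u] u by (auto simp: vge_def)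
  ultimately have "w u = 1" by (simp add: zmult_eq_1_iff)
  then show "v x = w x"
    using eq[of x] val_zero[OF v] val_zero[OF w] by (cases "x = 0") simp_all
qed

subsection \<open>Weak approximation\<close>

lemma separating_element:
  assumes v: "v \<in> places" and w: "w \<in> places" and "v \<noteq> w"
  obtains a where "a \<noteq> 0" "v a > 0" "w a < 0"
proof -
  have "\<not> (\<forall>x. vge v 0 x \<longrightarrow> vge w 0 x)"
    using assms(3) places_eqI[OF v w] by (intro notI) simp
  then obtain x where x: "vge v 0 x" "\<not> vge w 0 x" by blast
  have "\<not> (\<forall>y. vge w 0 y \<longrightarrow> vge v 0 y)"
    using assms(3) places_eqI[OF w v] by (intro notI) simp
  then obtain y where y: "vge w 0 y" "\<not> vge v 0 y" by blast
  have "x \<noteq> 0" "y \<noteq> 0" using x y by auto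
  then show ?thesis
    using x y by (intro that[of "x / y"]) (auto simp: vge_def val_divide v w)
qed

text \<open>Induction over \<open>T\<close>: a \<open>z\<close> that fails at the new place is
  corrected by adding a high power of an element that separates this place from
  \<open>v\<close>.\<close>

lemma isolating_element:
  assumes v: "v \<in> places" and "finite T" "T \<subseteq> places" "v \<notin> T"
  shows "\<exists>z. z \<noteq> 0 \<and> v z > 0 \<and> (\<forall>w\<in>T. w z < 0)"
  using assms(2-)
proof (induction T rule: finite_induct)
  case empty
  obtain u where "u \<noteq> 0" "v u = 1" using uniformizer_exists[OF v] by blast
  then show ?case by auto
next
  case (insert w T)
  obtain z where z: "z \<noteq> 0" "v z > 0" "\<forall>w\<in>T. w z < 0" using insert by auto
  have w: "w \<in> places" "v \<noteq> w" using insert by auto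
  obtain a where a: "a \<noteq> 0" "v a > 0" "w a < 0" using separating_element[OF v w] by blast
  show ?case
  proof (cases "w z < 0")
    case True
    with z show ?thesis by auto
  next
    case False
    \<comment> \<open>The exponent exceeds the absolute value of \<open>u z\<close> for every
      \<open>u\<close> in \<open>insert v T\<close>. Hence \<open>z\<close> and \<open>a ^ r\<close>
      never tie, neither there nor at \<open>w\<close>, and \<open>val_add_eq\<close> decides the
      value of the sum.\<close>
    define r where "r = Suc (nat (\<Sum>u\<in>insert v T. \<bar>u z\<bar>))"
    have rpos: "r > 0" by (simp add: r_def)
    have r: "int r > \<bar>u z\<bar>" if "u \<in> insert v T" for u
      using member_le_sum[of u "insert v T" "\<lambda>u. \<bar>u z\<bar>"] that insert(1) by (auto simp: r_def)
    have "int r * 1 \<le> int r * v a" using a by (intro mult_left_mono) auto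
    then have "v z + 1 \<le> int r * v a" using r[of v] by auto
    then have "vge v (v z + 1) (a ^ r)" by (simp add: vge_def val_power[OF v])
    from val_add_eq[OF v z(1) this] z have 1: "z + a ^ r \<noteq> 0" "v (z + a ^ r) > 0" by auto
    have 2: "w (z + a ^ r) < 0"
    proof -
      have neg: "w (a ^ r) < 0" using a rpos unfolding val_power[OF w(1)] by (simp add: mult_less_0_iff)
      then have "vge w (w (a ^ r) + 1) z" using False by (auto simp: vge_def)
      from val_add_eq(2)[OF w(1) _ this] a neg show ?thesis by (auto simp: add.commute)
    qed
    have 3: "u (z + a ^ r) < 0" if u: "u \<in> T" for u
    proof -
      have up: "u \<in> places" using insert u by auto
      have ur: "int r > \<bar>u z\<bar>" using r u by auto
      show ?thesis
      proof (cases "u a \<ge> 0")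
        case True
        have "u z < 0" using z u by auto
        moreover have "0 \<le> int r * u a" using True by simp
        ultimately have "vge u (u z + 1) (a ^ r)" unfolding vge_def val_power[OF up] by linarith
        from val_add_eq(2)[OF up z(1) this] z u show ?thesis by auto
      next
        case False
        then have "int r * u a \<le> int r * (-1)" by (intro mult_left_mono) auto
        then have l: "u (a ^ r) < u z" "u (a ^ r) < 0" using ur by (simp_all add: val_power[OF up])
        then have "vge u (u (a ^ r) + 1) z" by (auto simp: vge_def)
        from val_add_eq(2)[OF up _ this] a l show ?thesis by (auto simp: add.commute)
      qed
    qed
    show ?thesis using 1 2 3 by auto
  qed
qed

text \<open>With \<open>z\<close> from \<open>isolating_element\<close>,
  \<open>1 / (1 + z ^ s)\<close> is close to 1 where \<open>z\<close> vanishes and close to 0 where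
  it has a pole.\<close>

lemma near_idempotent:
  assumes v: "v \<in> places" and "finite T" "T \<subseteq> places" "v \<notin> T"
  shows "\<exists>y. vge v (int r) (y - 1) \<and> (\<forall>w\<in>T. vge w (int r) y)"
proof -
  obtain z where z: "z \<noteq> 0" "v z > 0" "\<forall>w\<in>T. w z < 0"
    using isolating_element[OF assms] by blast
  define s where "s = Suc r"
  have "int s * 1 \<le> int s * v z" using z by (intro mult_left_mono) auto
  moreover have "int s = int r + 1" by (simp add: s_def)
  ultimately have vz: "int r + 1 \<le> v (z ^ s)" unfolding val_power[OF v] by linarith
  have v1: "1 + z ^ s \<noteq> 0" "v (1 + z ^ s) = 0"
    using val_add_eq[OF v, of 1 "z ^ s"] vz by (simp_all add: vge_def val_one[OF v])
  have "1 / (1 + z ^ s) - 1 = - (z ^ s) / (1 + z ^ s)" using v1(1) by (simp add: field_simps)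
  moreover have "vge v (int r) (- (z ^ s) / (1 + z ^ s))"
    using vz v1 by (simp add: vge_divide_iff[OF v v1(1)] vge_uminus[OF v]) (simp add: vge_def)
  moreover have "vge w (int r) (1 / (1 + z ^ s))" if w: "w \<in> T" for w
  proof -
    have wp: "w \<in> places" using w assms by auto
    have "int s * w z \<le> int s * (-1)" using z w by (intro mult_left_mono) auto
    moreover have "int s = int r + 1" by (simp add: s_def)
    ultimately have wz: "w (z ^ s) \<le> - int r - 1" unfolding val_power[OF wp] by linarith
    have "vge w (w (z ^ s) + 1) 1" using wz by (simp add: vge_def val_one[OF wp])
    from val_add_eq(2)[OF wp _ this] z have "w (1 + z ^ s) = w (z ^ s)" by (simp add: add.commute)
    then show ?thesis using wz v1 by (simp add: vge_def val_divide[OF wp] val_one[OF wp])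
  qed
  ultimately show ?thesis by metis
qed

lemma weak_approximation:
  assumes T: "finite T" "T \<subseteq> places" and y: "\<And>v. v \<in> T \<Longrightarrow> vge v 0 (y v)"
  shows "\<exists>z. \<forall>v\<in>T. vge v (int r) (z - y v)"
proof -
  have "finite (\<Union>v\<in>T. (\<lambda>w. \<bar>w (y v)\<bar>) ` T)" using T by auto
  then have "bdd_above (\<Union>v\<in>T. (\<lambda>w. \<bar>w (y v)\<bar>) ` T)" by (rule bdd_above_finite)
  then obtain M where M: "\<And>v w. v \<in> T \<Longrightarrow> w \<in> T \<Longrightarrow> \<bar>w (y v)\<bar> \<le> M"
    unfolding bdd_above_def by blast
  \<comment> \<open>Multiplication by \<open>y v\<close> may lose up to \<open>M\<close> at the
    other places of \<open>T\<close>; the additional precision pays for this.\<close>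
  define s where "s = nat (int r + \<bar>M\<bar>)"
  have "\<forall>v\<in>T. \<exists>e. vge v (int s) (e - 1) \<and> (\<forall>w\<in>T - {v}. vge w (int s) e)"
    using T by (intro ballI near_idempotent) auto
  then obtain e where e: "\<And>v. v \<in> T \<Longrightarrow> vge v (int s) (e v - 1)"
      "\<And>v w. v \<in> T \<Longrightarrow> w \<in> T \<Longrightarrow> w \<noteq> v \<Longrightarrow> vge w (int s) (e v)" by (metis Diff_iff singletonD)
  have lift: "vge w (int r) (x * y v)" if "vge w (int s) x" "v \<in> T" "w \<in> T" for x v w
  proof -
    have "vge w (- \<bar>M\<bar>) (y v)" using M[of v w] that by (auto simp: vge_def)
    from vge_mult[OF _ that(1) this] T that show ?thesis
      by (auto simp: s_def elim!: vge_mono)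
  qed
  show ?thesis
  proof (intro exI[of _ "\<Sum>v\<in>T. e v * y v"] ballI)
    fix w assume w: "w \<in> T"
    then have wp: "w \<in> places" using T by auto
    have "(\<Sum>v\<in>T. e v * y v) - y w = (e w - 1) * y w + (\<Sum>v\<in>T - {w}. e v * y v)"
      using T w by (simp add: sum.remove[of T w] algebra_simps)
    moreover have "vge w (int r) \<dots>"
      using T w wp by (intro vge_add vge_sum lift e) auto
    ultimately show "vge w (int r) ((\<Sum>v\<in>T. e v * y v) - y w)" by simp
  qed
qed

section \<open>Digit expansions and residue systems\<close>

text \<open>Expansions of length \<open>m\<close> in powers of \<open>x\<close> with digits from
  \<open>Y\<close>. All counting below is about their number.\<close>

primrec digits :: "'a::field \<Rightarrow> 'a set \<Rightarrow> nat \<Rightarrow> 'a set" where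
  "digits x Y 0 = {0}"
| "digits x Y (Suc m) = (\<lambda>(y, s). y + x * s) ` (Y \<times> digits x Y m)"

definition is_subring :: "'a::field set \<Rightarrow> bool" where
  "is_subring R \<longleftrightarrow> 0 \<in> R \<and> 1 \<in> R \<and> (\<forall>x\<in>R. \<forall>y\<in>R. x - y \<in> R \<and> x * y \<in> R)"

lemma is_subringD:
  assumes "is_subring R"
  shows "0 \<in> R" "1 \<in> R" "x \<in> R \<Longrightarrow> y \<in> R \<Longrightarrow> x - y \<in> R" "x \<in> R \<Longrightarrow> y \<in> R \<Longrightarrow> x * y \<in> R"
    "x \<in> R \<Longrightarrow> - x \<in> R" "x \<in> R \<Longrightarrow> y \<in> R \<Longrightarrow> x + y \<in> R" "x \<in> R \<Longrightarrow> x ^ n \<in> R"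
proof -
  show 0: "0 \<in> R" and 1: "1 \<in> R" and d: "\<And>x y. x \<in> R \<Longrightarrow> y \<in> R \<Longrightarrow> x - y \<in> R"
    and m: "\<And>x y. x \<in> R \<Longrightarrow> y \<in> R \<Longrightarrow> x * y \<in> R"
    using assms by (auto simp: is_subring_def)
  show u: "\<And>x. x \<in> R \<Longrightarrow> - x \<in> R" using d[OF 0] by simp
  show "\<And>x y. x \<in> R \<Longrightarrow> y \<in> R \<Longrightarrow> x + y \<in> R" using d u by (metis diff_minus_eq_add)
  show "x \<in> R \<Longrightarrow> x ^ n \<in> R" by (induction n) (auto intro: 1 m)
qed

lemma finite_digits: "finite Y \<Longrightarrow> finite (digits x Y m)"
  by (induction m) auto

lemma digits_subset:
  assumes "is_subring R" "x \<in> R" "Y \<subseteq> R"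
  shows "digits x Y m \<subseteq> R"
  using assms(2,3) by (induction m) (auto intro!: is_subringD[OF assms(1)])

text \<open>Reduction modulo \<open>x\<close> inside \<open>R\<close> recovers the first digit,
  since distinct digits are incongruent; cancelling \<open>x\<close> leaves shorter
  expansions.\<close>

lemma card_digits:
  assumes R: "is_subring R" "x \<in> R" "Y \<subseteq> R" and "finite Y" "x \<noteq> 0"
    and inc: "\<And>y z c. y \<in> Y \<Longrightarrow> z \<in> Y \<Longrightarrow> c \<in> R \<Longrightarrow> y - z = x * c \<Longrightarrow> y = z"
  shows "card (digits x Y m) = card Y ^ m"
proof (induction m)
  case (Suc m)
  have "inj_on (\<lambda>(y, s). y + x * s) (Y \<times> digits x Y m)"
  proof (rule inj_onI, clarify)
    fix y s z t assume *: "y \<in> Y" "s \<in> digits x Y m" "z \<in> Y" "t \<in> digits x Y m"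
      "y + x * s = z + x * t"
    then have "y - z = x * (t - s)" by (simp add: algebra_simps)
    moreover have "t - s \<in> R" using digits_subset[OF R] * is_subringD(3)[OF R(1)] by blast
    ultimately have "y = z" using inc * by blast
    then show "y = z \<and> s = t" using * \<open>x \<noteq> 0\<close> by simp
  qed
  then show ?case using Suc by (simp add: card_image card_cartesian_product)
qed auto

text \<open>With a uniformizer as base, congruence to order 1 determines the first digit, and
  dividing the rest by \<open>u\<close> lowers the order of congruence by one.\<close>

lemma digits_incongruent:
  assumes v: "v \<in> places" and u: "u \<noteq> 0" "v u = 1" and Y: "\<And>y. y \<in> Y \<Longrightarrow> vge v 0 y"
    and inc: "\<And>y z. y \<in> Y \<Longrightarrow> z \<in> Y \<Longrightarrow> vge v 1 (y - z) \<Longrightarrow> y = z"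
  shows "y \<in> digits u Y e \<Longrightarrow> z \<in> digits u Y e \<Longrightarrow> vge v (int e) (y - z) \<Longrightarrow> y = z"
    "y \<in> digits u Y e \<Longrightarrow> vge v 0 y"
proof -
  have u1: "vge v 1 u" using u by (simp add: vge_def)
  have pos: "vge v 0 y" if "y \<in> digits u Y e" for e y
    using that
  proof (induction e arbitrary: y)
    case (Suc e)
    then obtain a s where as: "a \<in> Y" "s \<in> digits u Y e" "y = a + u * s" by auto
    have "vge v (1 + 0) (u * s)" by (intro vge_mult v u1 Suc as)
    then show ?case using as Y by (auto intro!: vge_add v elim: vge_mono)
  qed auto
  then show "y \<in> digits u Y e \<Longrightarrow> vge v 0 y" .
  show "y \<in> digits u Y e \<Longrightarrow> z \<in> digits u Y e \<Longrightarrow> vge v (int e) (y - z) \<Longrightarrow> y = z"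
  proof (induction e arbitrary: y z)
    case (Suc e)
    from Suc.prems(1) obtain a s where as: "a \<in> Y" "s \<in> digits u Y e" "y = a + u * s" by auto
    from Suc.prems(2) obtain b t where bt: "b \<in> Y" "t \<in> digits u Y e" "z = b + u * t" by auto
    have "vge v (1 + 0) (u * (s - t))" by (intro vge_mult v u1 vge_diff pos[OF as(2)] pos[OF bt(2)])
    moreover have "vge v 1 (y - z)" using Suc.prems(3) by (rule vge_mono) auto
    ultimately have "vge v 1 ((y - z) - u * (s - t))" using vge_diff[OF v] by simp
    moreover have "(y - z) - u * (s - t) = a - b" using as bt by (simp add: algebra_simps)
    ultimately have "a = b" using inc as bt by metis
    then have "y - z = u * (s - t)" using as bt by (simp add: algebra_simps)
    with Suc.prems(3) have "vge v (v u + int e) (u * (s - t))" using u by (simp add: add.commute)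
    then have "vge v (int e) (s - t)" using vge_cancel_mult[OF v u(1)] by blast
    then show ?case using Suc.IH as bt \<open>a = b\<close> by blast
  qed auto
qed

lemma valuation_subring:
  assumes "T \<subseteq> places" shows "is_subring {x. \<forall>v\<in>T. vge v 0 x}"
  using assms by (auto simp: is_subring_def intro!: vge_diff vge_one intro: vge_mult0)

text \<open>Representatives inside K stand for the residue field, so that residues can serve
  directly as digits.\<close>

definition residue_reps :: "('a::field \<Rightarrow> int) \<Rightarrow> 'a set \<Rightarrow> bool" where
  "residue_reps v Y \<longleftrightarrow> finite Y \<and> (\<forall>y\<in>Y. vge v 0 y) \<and>
     (\<forall>y\<in>Y. \<forall>z\<in>Y. vge v 1 (y - z) \<longrightarrow> y = z) \<and> (\<forall>x. vge v 0 x \<longrightarrow> (\<exists>y\<in>Y. vge v 1 (x - y)))"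

definition reps :: "('a::field \<Rightarrow> int) \<Rightarrow> 'a set" where
  "reps v = (SOME Y. residue_reps v Y)"

text \<open>In terms of the local degree this is \<open>N\<^sub>v ln p\<close>: the logarithm of the order of the residue field.\<close>

definition place_degree :: "('a::field \<Rightarrow> int) \<Rightarrow> real" where
  "place_degree v = ln (real (card (reps v)))"

text \<open>
  A function field in one variable over the prime field with \<open>p\<close> elements. The growth condition
  says that over each \<open>F\<^sub>p[x]\<close> the field has finite rank, phrased as a bound on digit sets
  whose expansions in powers of \<open>x\<close> are unique.
\<close>

locale function_field =
  fixes p :: nat and K :: "'k::field itself"
  assumes prime_p: "Factorial_Ring.prime p" and char_p: "of_nat p = (0 :: 'k)"
    and growth: "\<exists>R. \<forall>Y. finite Y \<longrightarrow> (\<forall>m. card (digits (x :: 'k) Y m) = card Y ^ m) \<longrightarrow> card Y \<le> R"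
begin

text \<open>Pairwise incongruent integral elements are digits with unique expansions in powers of a
  uniformizer, so \<open>growth\<close> bounds their number. A family of maximal size is a complete
  system.\<close>

lemma residue_reps_exists:
  fixes v :: "'k \<Rightarrow> int"
  assumes v: "v \<in> places" shows "\<exists>Y. residue_reps v Y"
proof -
  obtain u where u: "u \<noteq> 0" "v u = 1" using uniformizer_exists[OF v] by blast
  obtain R where R: "\<And>Y. finite Y \<Longrightarrow> (\<And>m. card (digits u Y m) = card Y ^ m) \<Longrightarrow> card Y \<le> R"
    using growth[of u] by blast
  define P where "P Y \<longleftrightarrow> finite Y \<and> (\<forall>y\<in>Y. vge v 0 y) \<and>
     (\<forall>y\<in>Y. \<forall>z\<in>Y. vge v 1 (y - z) \<longrightarrow> y = z)" for Y
  have bd: "card Y \<le> R" if Y: "P Y" for Y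
  proof (rule R)
    show "finite Y" using Y by (simp add: P_def)
    show "card (digits u Y m) = card Y ^ m" for m
    proof (rule card_digits)
      show "is_subring {x. \<forall>v\<in>{v}. vge v 0 x}" using v by (intro valuation_subring) auto
      fix y z c assume *: "y \<in> Y" "z \<in> Y" "c \<in> {x. \<forall>v\<in>{v}. vge v 0 x}" "y - z = u * c"
      then have "vge v 1 (y - z)" using u vge_mult0[OF v, of 1 u c] by (auto simp: vge_def)
      then show "y = z" using Y * by (auto simp: P_def)
    qed (use Y u in \<open>auto simp: P_def vge_def\<close>)
  qed
  have "P {}" by (simp add: P_def)
  then obtain Y where Y: "P Y" "\<And>Z. P Z \<Longrightarrow> card Z \<le> card Y"
    using ex_has_greatest_nat[of P "{}" card "Suc R"] bd le_imp_less_Suc by metis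
  have "\<exists>y\<in>Y. vge v 1 (x - y)" if x: "vge v 0 x" for x
  proof (rule ccontr)
    assume no: "\<not> ?thesis"
    then have "x \<notin> Y" by auto
    moreover have "P (insert x Y)" using Y(1) x no vge_diff_commute[OF v, of 1 x]
      by (auto simp: P_def)
    ultimately show False using Y(2)[of "insert x Y"] Y(1) by (simp add: P_def)
  qed
  then show ?thesis using Y(1) by (auto simp: P_def residue_reps_def)
qed

lemma reps:
  fixes v :: "'k \<Rightarrow> int"
  assumes "v \<in> places"
  shows "finite (reps v)" "y \<in> reps v \<Longrightarrow> vge v 0 y"
    "y \<in> reps v \<Longrightarrow> z \<in> reps v \<Longrightarrow> vge v 1 (y - z) \<Longrightarrow> y = z"
    "vge v 0 x \<Longrightarrow> \<exists>y\<in>reps v. vge v 1 (x - y)"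
proof -
  have *: "residue_reps v (reps v)"
    unfolding reps_def by (rule someI_ex[OF residue_reps_exists[OF assms]])
  show "finite (reps v)" "y \<in> reps v \<Longrightarrow> vge v 0 y"
    "y \<in> reps v \<Longrightarrow> z \<in> reps v \<Longrightarrow> vge v 1 (y - z) \<Longrightarrow> y = z"
    "vge v 0 x \<Longrightarrow> \<exists>y\<in>reps v. vge v 1 (x - y)"
    using * by (simp_all add: residue_reps_def)
qed

lemma card_reps_ge:
  fixes v :: "'k \<Rightarrow> int"
  assumes v: "v \<in> places" shows "card (reps v) \<ge> 2"
proof -
  obtain a where a: "a \<in> reps v" "vge v 1 (0 - a)" using reps(4)[OF v, of 0] by auto
  obtain b where b: "b \<in> reps v" "vge v 1 (1 - b)" using reps(4)[OF v, of 1] vge_one[OF v] by auto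
  have "a \<noteq> b"
  proof
    assume "a = b"
    then have "vge v 1 ((1 - b) - (0 - a))" by (intro vge_diff v a b)
    then show False using \<open>a = b\<close> val_one[OF v] by (simp add: vge_def)
  qed
  then have "card {a, b} = 2" by simp
  then show ?thesis using card_mono[OF reps(1)[OF v], of "{a, b}"] a b by auto
qed

lemma place_degree_ge:
  fixes v :: "'k \<Rightarrow> int"
  assumes v: "v \<in> places" shows "place_degree v \<ge> ln 2"
  using card_reps_ge[OF v] by (simp add: place_degree_def)

lemma place_degree_pos:
  fixes v :: "'k \<Rightarrow> int"
  assumes v: "v \<in> places" shows "place_degree v > 0"
  using place_degree_ge[OF v] ln_gt_zero[of "2 :: real"] by linarith

lemma exp_place_degree:
  fixes v :: "'k \<Rightarrow> int"
  assumes v: "v \<in> places" shows "exp (place_degree v) = real (card (reps v))"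
  using card_reps_ge[OF v] by (simp add: place_degree_def)

section \<open>Digit sets at several places and finiteness of zeros\<close>

lemma local_digit_set:
  fixes v :: "'k \<Rightarrow> int"
  assumes v: "v \<in> places"
  shows "\<exists>Y. finite Y \<and> card Y = card (reps v) ^ e \<and> (\<forall>y\<in>Y. vge v 0 y) \<and>
     (\<forall>y\<in>Y. \<forall>z\<in>Y. vge v (int e) (y - z) \<longrightarrow> y = z)"
proof -
  obtain u where u: "u \<noteq> 0" "v u = 1" using uniformizer_exists[OF v] by blast
  have "card (digits u (reps v) e) = card (reps v) ^ e"
  proof (rule card_digits)
    show "is_subring {x. \<forall>v\<in>{v}. vge v 0 x}" using v by (intro valuation_subring) auto
    fix y z c assume *: "y \<in> reps v" "z \<in> reps v" "c \<in> {x. \<forall>v\<in>{v}. vge v 0 x}" "y - z = u * c"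
    then have "vge v 1 (y - z)" using u vge_mult0[OF v, of 1 u c] by (auto simp: vge_def)
    then show "y = z" using * reps[OF v] by auto
  qed (use u reps[OF v] in \<open>auto simp: vge_def\<close>)
  then show ?thesis
    using digits_incongruent[OF v u, of "reps v"] reps[OF v] finite_digits[OF reps(1)[OF v]]
    by (intro exI[of _ "digits u (reps v) e"]) blast
qed

text \<open>Chinese remainder theorem: weak approximation realises every choice of local digits by
  one element. The order \<open>r\<close> of the approximation is above all \<open>e v\<close>, so
  the local classes stay apart.\<close>

lemma global_digit_set:
  fixes T :: "('k \<Rightarrow> int) set"
  assumes T: "finite T" "T \<subseteq> places"
  shows "\<exists>Y. finite Y \<and> card Y = (\<Prod>v\<in>T. card (reps v) ^ e v) \<and> (\<forall>y\<in>Y. \<forall>v\<in>T. vge v 0 y) \<and>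
     (\<forall>y\<in>Y. \<forall>z\<in>Y. (\<forall>v\<in>T. vge v (int (e v)) (y - z)) \<longrightarrow> y = z)"
proof -
  have "\<forall>v\<in>T. \<exists>Y. finite Y \<and> card Y = card (reps v) ^ e v \<and> (\<forall>y\<in>Y. vge v 0 y) \<and>
     (\<forall>y\<in>Y. \<forall>z\<in>Y. vge v (int (e v)) (y - z) \<longrightarrow> y = z)"
    using T by (intro ballI local_digit_set) auto
  then obtain L where L: "\<And>v. v \<in> T \<Longrightarrow> finite (L v)" "\<And>v. v \<in> T \<Longrightarrow> card (L v) = card (reps v) ^ e v"
      "\<And>v y. v \<in> T \<Longrightarrow> y \<in> L v \<Longrightarrow> vge v 0 y"
      "\<And>v y z. v \<in> T \<Longrightarrow> y \<in> L v \<Longrightarrow> z \<in> L v \<Longrightarrow> vge v (int (e v)) (y - z) \<Longrightarrow> y = z"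
    by metis
  define r where "r = (\<Sum>v\<in>T. e v)"
  have r: "int (e v) \<le> int r" if "v \<in> T" for v
    unfolding r_def of_nat_le_iff using member_le_sum[of v T e] T that by simp
  have "\<exists>z. \<forall>v\<in>T. vge v (int r) (z - f v)" if "f \<in> Pi\<^sub>E T L" for f
    using weak_approximation[OF T, of f r] L that by (auto simp: PiE_iff)
  then obtain A where A: "\<And>f v. f \<in> Pi\<^sub>E T L \<Longrightarrow> v \<in> T \<Longrightarrow> vge v (int r) (A f - f v)" by metis
  have key: "f = g" if fg: "f \<in> Pi\<^sub>E T L" "g \<in> Pi\<^sub>E T L" "\<And>v. v \<in> T \<Longrightarrow> vge v (int (e v)) (A f - A g)"
    for f g
  proof (rule PiE_ext[OF fg(1,2)])
    fix v assume v: "v \<in> T"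
    then have vp: "v \<in> places" using T by auto
    have "vge v (int (e v)) (f v - A f)" "vge v (int (e v)) (A g - g v)"
      using A[OF fg(1) v] A[OF fg(2) v] vge_diff_commute[OF vp] r[OF v] vge_mono by blast+
    with fg(3)[OF v] have "vge v (int (e v)) (f v - g v)" using vge_trans_diff[OF vp] by blast
    then show "f v = g v" using L(4)[OF v] fg v by (auto simp: PiE_iff)
  qed
  have "inj_on A (Pi\<^sub>E T L)" using key by (intro inj_onI) auto
  then have "card (A ` Pi\<^sub>E T L) = (\<Prod>v\<in>T. card (reps v) ^ e v)"
    using L(2) T by (simp add: card_image card_PiE)
  moreover have "vge v 0 (A f)" if "f \<in> Pi\<^sub>E T L" "v \<in> T" for f v
  proof -
    have vp: "v \<in> places" using T that by auto
    have "vge v 0 (A f - f v)" using A[OF that] by (rule vge_mono) auto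
    moreover have "vge v 0 (f v)" using L that by (auto simp: PiE_iff)
    ultimately show ?thesis using vge_add[OF vp, of 0 "A f - f v" "f v"] by simp
  qed
  moreover have "A f = A g" if "f \<in> Pi\<^sub>E T L" "g \<in> Pi\<^sub>E T L" "\<forall>v\<in>T. vge v (int (e v)) (A f - A g)" for f g
    using key[OF that(1,2)] that(3) by simp
  moreover have "finite (A ` Pi\<^sub>E T L)" using L(1) T by (intro finite_imageI finite_PiE) auto
  ultimately show ?thesis
    by (intro exI[of _ "A ` Pi\<^sub>E T L"]) (simp only: ball_simps, blast)
qed

text \<open>\<open>Y\<close> represents the elements integral on \<open>T\<close> modulo \<open>x\<close>, so its digit expansions are unique.\<close>

lemma zero_digit_set:
  fixes x :: 'k
  assumes T: "finite T" "T \<subseteq> places" and x: "x \<noteq> 0" "\<And>v. v \<in> T \<Longrightarrow> v x > 0"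
  obtains Y where "finite Y" "Y \<noteq> {}" "ln (real (card Y)) = (\<Sum>v\<in>T. place_degree v * of_int (v x))"
    "\<And>m. card (digits x Y m) = card Y ^ m" "\<And>y v. y \<in> Y \<Longrightarrow> v \<in> T \<Longrightarrow> vge v 0 y"
proof -
  obtain Y where Y: "finite Y" "card Y = (\<Prod>v\<in>T. card (reps v) ^ nat (v x))"
     "\<And>y v. y \<in> Y \<Longrightarrow> v \<in> T \<Longrightarrow> vge v 0 y"
     "\<And>y z. y \<in> Y \<Longrightarrow> z \<in> Y \<Longrightarrow> (\<And>v. v \<in> T \<Longrightarrow> vge v (int (nat (v x))) (y - z)) \<Longrightarrow> y = z"
    using global_digit_set[OF T, of "\<lambda>v. nat (v x)"] by auto
  have pos: "card (reps v) > 0" if "v \<in> T" for v using card_reps_ge[of v] T that by auto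
  then have "card Y > 0" unfolding Y by (intro prod_pos) auto
  moreover have "ln (real (card Y)) = (\<Sum>v\<in>T. place_degree v * of_int (v x))"
  proof -
    have "ln (real (card Y)) = (\<Sum>v\<in>T. ln (real (card (reps v) ^ nat (v x))))"
      unfolding Y of_nat_prod using pos T by (intro ln_prod) auto
    also have "\<dots> = (\<Sum>v\<in>T. place_degree v * of_int (v x))"
      using pos x by (intro sum.cong) (auto simp: ln_realpow place_degree_def less_imp_le)
    finally show ?thesis .
  qed
  moreover have "card (digits x Y m) = card Y ^ m" for m
  proof (rule card_digits)
    show "is_subring {x. \<forall>v\<in>T. vge v 0 x}" using T by (intro valuation_subring) auto
    fix y z c assume *: "y \<in> Y" "z \<in> Y" "c \<in> {x. \<forall>v\<in>T. vge v 0 x}" "y - z = x * c"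
    have "vge v (int (nat (v x))) (y - z)" if "v \<in> T" for v
      unfolding *(4) using that * x T by (intro vge_mult0) (auto simp: vge_def less_imp_le)
    then show "y = z" using Y(4) * by auto
  qed (use Y x in \<open>auto simp: vge_def less_imp_le\<close>)
  ultimately show ?thesis using that[of Y] Y(1,3) by (auto simp: card_gt_0_iff simp del: Y(2))
qed

text \<open>With \<open>R\<close> the bound from \<open>growth\<close>, \<open>R + 1\<close> zeros
  would give a digit set with at least \<open>2 ^ (R + 1)\<close> elements, as every residue field
  has at least two.\<close>

lemma finite_zeros:
  fixes x :: 'k
  assumes x: "x \<noteq> 0" shows "finite {v \<in> places. v x > 0}"
proof (rule ccontr)
  assume inf: "infinite {v \<in> places. v x > 0}"
  obtain R where R: "\<And>Y. finite Y \<Longrightarrow> (\<And>m. card (digits x Y m) = card Y ^ m) \<Longrightarrow> card Y \<le> R"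
    using growth[of x] by blast
  obtain T where T: "finite T" "card T = Suc R" "T \<subseteq> {v \<in> places. v x > 0}"
    using infinite_arbitrarily_large[OF inf] by blast
  obtain Y where Y: "finite Y" "Y \<noteq> {}" "ln (real (card Y)) = (\<Sum>v\<in>T. place_degree v * of_int (v x))"
    "\<And>m. card (digits x Y m) = card Y ^ m"
    using zero_digit_set[of T x] T x by (metis (no_types, lifting) mem_Collect_eq subset_eq)
  have "(\<Sum>v\<in>T. ln 2) \<le> (\<Sum>v\<in>T. place_degree v * of_int (v x))"
  proof (rule sum_mono)
    fix v assume v: "v \<in> T"
    have "ln 2 * 1 \<le> place_degree v * of_int (v x)"
      using T v by (intro mult_mono place_degree_ge place_degree_pos[THEN less_imp_le]) auto
    then show "ln 2 \<le> place_degree v * of_int (v x)" by simp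
  qed
  then have "real (Suc R) * ln 2 \<le> ln (real (card Y))" using T Y by simp
  then have "ln (2 ^ Suc R) \<le> ln (real (card Y))" by (subst ln_realpow) auto
  then have "2 ^ Suc R \<le> real (card Y)" using Y by (subst (asm) ln_le_cancel_iff) (auto simp: card_gt_0_iff)
  then have "2 ^ Suc R \<le> card Y" by (metis of_nat_le_iff of_nat_numeral of_nat_power)
  also have "card Y \<le> R" using R Y by blast
  finally show False using less_exp[of "Suc R"] by linarith
qed

lemma finite_support:
  fixes x :: 'k
  shows "finite {v \<in> places. v x \<noteq> 0}"
proof (cases "x = 0")
  case True
  then show ?thesis using val_zero by (auto intro: finite_subset[of _ "{}"])
next
  case False
  have "{v \<in> places. v x \<noteq> 0} \<subseteq> {v \<in> places. v x > 0} \<union> {v \<in> places. v (inverse x) > 0}"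
    by (auto simp: val_inverse)
  moreover have "finite ({v \<in> places. v x > 0} \<union> {v \<in> places. v (inverse x) > 0})"
    using finite_zeros[OF False] finite_zeros[of "inverse x"] False by simp
  ultimately show ?thesis by (rule finite_subset)
qed

end

subsection \<open>Existence of poles\<close>

context function_field
begin

text \<open>A valuation ring need not be discrete in general. Here \<open>growth\<close> bounds the
  chains of elements that are not divisible by a given nonunit; this makes the maximal ideal
  \<open>m\<close> principal and gives every nonzero element of \<open>R\<close> a finite order with
  respect to its generator \<open>q\<close>.\<close>

lemma valuation_ring_place:
  fixes R :: "'k set"
  assumes R: "is_subring R" and dich: "\<And>a. a \<in> R \<or> inverse a \<in> R"
    and y: "y \<in> R" "y \<noteq> 0" "inverse y \<notin> R"
  shows "\<exists>v\<in>places. v y > 0"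
proof -
  note Rs = is_subringD[OF R]
  define m where "m = {a \<in> R. a = 0 \<or> inverse a \<notin> R}"
  have m0: "0 \<in> m" using Rs(1) by (simp add: m_def)
  have m1: "1 \<notin> m" using Rs(2) by (simp add: m_def)
  have ym: "y \<in> m" using y by (simp add: m_def)
  have mR: "a \<in> R" if "a \<in> m" for a using that by (simp add: m_def)
  have munit: "inverse a \<in> R" "a \<noteq> 0" if "a \<in> R" "a \<notin> m" for a using that by (auto simp: m_def)
  have mmult: "a * b \<in> m" if "a \<in> m" "b \<in> R" for a b
  proof (cases "a * b = 0")
    case False
    have "inverse (a * b) \<notin> R"
    proof
      assume "inverse (a * b) \<in> R"
      then have "b * inverse (a * b) \<in> R" using that Rs(4) by blast
      moreover have "b * inverse (a * b) = inverse a" using False by (simp add: field_simps)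
      ultimately have "inverse a \<in> R" by metis
      then show False using that False by (auto simp: m_def)
    qed
    then show ?thesis using that Rs(4) by (auto simp: m_def)
  qed (use m0 in auto)
  have madd: "a + b \<in> m" if "a \<in> m" "b \<in> m" for a b
  proof (cases "a = 0 \<or> b = 0")
    case False
    consider "a / b \<in> R" | "b / a \<in> R"
      using dich[of "a / b"] by (auto simp: inverse_divide)
    then show ?thesis
    proof cases
      case 1
      then have "b * (a / b + 1) \<in> m" using that Rs by (intro mmult) auto
      then show ?thesis using False by (simp add: field_simps)
    next
      case 2
      then have "a * (b / a + 1) \<in> m" using that Rs by (intro mmult) auto
      then show ?thesis using False by (simp add: field_simps)
    qed
  qed (use that m0 in auto)
  have unit1: "1 - a \<notin> m" if "a \<in> m" for a
    using madd[OF that, of "1 - a"] m1 by auto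
  have dichm: "a / b \<in> R \<or> b / a \<in> m" if "a \<noteq> 0" "b \<noteq> 0" for a b
    using dich[of "a / b"] by (auto simp: m_def inverse_divide)
  \<comment> \<open>Elements pairwise strictly comparable for divisibility and not divisible by
    \<open>x\<close> have unique digit expansions: if \<open>a - b = x * c\<close> with
    \<open>b / a\<close> in \<open>m\<close>, then \<open>1 - b / a\<close> is a unit, and
    \<open>x\<close> would divide \<open>a\<close>.\<close>
  have chain_bound: "\<exists>B. \<forall>Y. finite Y \<longrightarrow> Y \<subseteq> R - {0} \<longrightarrow>
      (\<forall>a\<in>Y. \<forall>b\<in>Y. a \<noteq> b \<longrightarrow> a / b \<in> m \<or> b / a \<in> m) \<longrightarrow> (\<forall>a\<in>Y. a / x \<notin> R) \<longrightarrow> card Y \<le> B"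
    if x: "x \<in> m" "x \<noteq> 0" for x
  proof -
    obtain B where B: "\<And>Y. finite Y \<Longrightarrow> (\<And>e. card (digits x Y e) = card Y ^ e) \<Longrightarrow> card Y \<le> B"
      using growth[of x] by blast
    have "card Y \<le> B" if Y: "finite Y" "Y \<subseteq> R - {0}"
      "\<forall>a\<in>Y. \<forall>b\<in>Y. a \<noteq> b \<longrightarrow> a / b \<in> m \<or> b / a \<in> m" "\<forall>a\<in>Y. a / x \<notin> R" for Y
    proof (rule B)
      have no: False if *: "a \<in> Y" "b \<in> Y" "c \<in> R" "a - b = x * c" "b / a \<in> m" for a b c
      proof -
        have a0: "a \<noteq> 0" using * Y by auto
        have u: "inverse (1 - b / a) \<in> R" "1 - b / a \<noteq> 0"
          using munit[OF _ unit1[OF *(5)]] Rs(2) Rs(3) mR[OF *(5)] by auto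
        have "a * (1 - b / a) = x * c" using *(4) a0 by (simp add: field_simps)
        then have "a / x = c * inverse (1 - b / a)" using u x by (simp add: field_simps)
        then show False using * Y u Rs(4) by auto
      qed
      show "card (digits x Y e) = card Y ^ e" for e
      proof (rule card_digits[OF R mR[OF x(1)]])
        fix a b c assume *: "a \<in> Y" "b \<in> Y" "c \<in> R" "a - b = x * c"
        show "a = b"
        proof (rule ccontr)
          assume "a \<noteq> b"
          then consider "b / a \<in> m" | "a / b \<in> m" using Y * by blast
          then show False
          proof cases
            case 2
            have "b - a = x * (- c)" using * by (simp add: algebra_simps)
            then show False using no[of b a "- c"] * 2 Rs(5) by blast
          qed (use no * in blast)
        qed
      qed (use Y x in auto)
    qed (use Y in auto)
    then show ?thesis by blast
  qed
  \<comment> \<open>The maximal ideal is principal. Otherwise every nonzero \<open>q\<close> in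
    \<open>m\<close> fails to divide some \<open>h q\<close> in \<open>m\<close>, and iterating
    \<open>h\<close> from \<open>y\<close> gives an infinite chain in which nothing after the start
    is divisible by \<open>y\<close>.\<close>
  have "\<exists>q\<in>m. q \<noteq> 0 \<and> (\<forall>b\<in>m. b / q \<in> R)"
  proof (rule ccontr)
    assume "\<not> ?thesis"
    then have "\<forall>q. \<exists>b. q \<in> m \<and> q \<noteq> 0 \<longrightarrow> b \<in> m \<and> b / q \<notin> R" by blast
    then obtain h where h: "\<And>q. q \<in> m \<Longrightarrow> q \<noteq> 0 \<Longrightarrow> h q \<in> m \<and> h q / q \<notin> R" by metis
    define b where "b i = (h ^^ i) y" for i
    have bS: "b (Suc i) = h (b i)" for i by (simp add: b_def)
    have b: "b i \<in> m \<and> b i \<noteq> 0" for i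
    proof (induction i)
      case 0 then show ?case using ym y by (simp add: b_def)
    next
      case (Suc i) then show ?case using h[of "b i"] Rs(1) by (auto simp: bS)
    qed
    have step: "b i / b (Suc i) \<in> m" for i
      using dichm[of "b (Suc i)" "b i"] b[of i] b[of "Suc i"] h[of "b i"] by (auto simp: bS)
    have lt: "b i / b (Suc (i + k)) \<in> m" for i k
    proof (induction k)
      case (Suc k)
      have "(b i / b (Suc (i + k))) * (b (Suc (i + k)) / b (Suc (Suc (i + k)))) \<in> m"
        using mmult[OF Suc mR[OF step]] .
      then show ?case using b by simp
    qed (use step in simp)
    have lt': "b i / b j \<in> m" if "i < j" for i j
      using lt[of i "j - i - 1"] that by simp
    have inj: "inj b"
    proof (rule linorder_injI)
      fix i j :: nat assume "i < j"
      then show "b i \<noteq> b j" using lt'[of i j] m1 b[of j] by auto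
    qed
    obtain B where B: "\<And>Y. finite Y \<Longrightarrow> Y \<subseteq> R - {0} \<Longrightarrow>
      (\<forall>a\<in>Y. \<forall>b\<in>Y. a \<noteq> b \<longrightarrow> a / b \<in> m \<or> b / a \<in> m) \<Longrightarrow> (\<forall>a\<in>Y. a / y \<notin> R) \<Longrightarrow> card Y \<le> B"
      using chain_bound[OF ym y(2)] by blast
    have "card (b ` {1..Suc B}) \<le> B"
    proof (rule B)
      show "b ` {1..Suc B} \<subseteq> R - {0}" using b mR by auto
      show "\<forall>a\<in>b ` {1..Suc B}. \<forall>c\<in>b ` {1..Suc B}. a \<noteq> c \<longrightarrow> a / c \<in> m \<or> c / a \<in> m"
        using lt' by (auto, metis linorder_neqE_nat)
      have "b i / y \<notin> R" if "i \<ge> 1" for i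
      proof
        assume "b i / y \<in> R"
        moreover have "y / b i \<in> m" using lt'[of 0 i] that by (simp add: b_def)
        ultimately show False using y b[of i] by (auto simp: m_def inverse_divide)
      qed
      then show "\<forall>a\<in>b ` {1..Suc B}. a / y \<notin> R" by auto
    qed auto
    moreover have "card (b ` {1..Suc B}) = Suc B"
      using inj by (subst card_image) (auto intro: inj_on_subset)
    ultimately show False by simp
  qed
  then obtain q where q: "q \<in> m" "q \<noteq> 0" "\<And>b. b \<in> m \<Longrightarrow> b / q \<in> R" by blast
  have qn: "q ^ Suc n \<in> m" for n
    using mmult[OF q(1), of "q ^ n"] mR[OF q(1)] Rs(7) by simp
  define unit where "unit a \<longleftrightarrow> a \<in> R \<and> a \<noteq> 0 \<and> inverse a \<in> R" for a
  have ord: "\<exists>n u. unit u \<and> a = u * q ^ n" if a: "a \<in> R" "a \<noteq> 0" for a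
  proof (cases "a \<in> m")
    case False
    then have "unit a" using munit[OF a(1)] a by (simp add: unit_def)
    then show ?thesis by (intro exI[of _ 0] exI[of _ a]) simp
  next
    case True
    \<comment> \<open>Otherwise the powers of \<open>q\<close> form an infinite chain not divisible
      by \<open>a\<close>. For the least such exponent the quotient is a unit, since a quotient in
      \<open>m\<close> could be divided by \<open>q\<close> once more.\<close>
    have "\<exists>n. q ^ n / a \<in> R"
    proof (rule ccontr)
      assume no: "\<not> ?thesis"
      obtain B where B: "\<And>Y. finite Y \<Longrightarrow> Y \<subseteq> R - {0} \<Longrightarrow>
        (\<forall>c\<in>Y. \<forall>b\<in>Y. c \<noteq> b \<longrightarrow> c / b \<in> m \<or> b / c \<in> m) \<Longrightarrow> (\<forall>c\<in>Y. c / a \<notin> R) \<Longrightarrow> card Y \<le> B"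
        using chain_bound[OF True a(2)] by blast
      have lt: "q ^ j / q ^ i \<in> m" if "i < j" for i j
      proof -
        have "q ^ j / q ^ i = q ^ (j - i)" using that q(2) by (simp add: power_diff)
        moreover have "Suc (j - i - 1) = j - i" using that by simp
        ultimately show ?thesis using qn[of "j - i - 1"] by metis
      qed
      have inj: "inj (\<lambda>i. q ^ i)"
      proof (rule linorder_injI)
        fix i j :: nat assume "i < j"
        then show "q ^ i \<noteq> q ^ j" using lt[of i j] m1 q(2) by auto
      qed
      have "card ((\<lambda>i. q ^ i) ` {..B}) \<le> B"
      proof (rule B)
        show "\<forall>c\<in>(\<lambda>i. q ^ i) ` {..B}. \<forall>b\<in>(\<lambda>i. q ^ i) ` {..B}. c \<noteq> b \<longrightarrow> c / b \<in> m \<or> b / c \<in> m"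
          using lt by (auto, metis linorder_neqE_nat)
      qed (use no q mR Rs(7) in auto)
      moreover have "card ((\<lambda>i. q ^ i) ` {..B}) = Suc B"
        using inj by (subst card_image) (auto intro: inj_on_subset)
      ultimately show False by simp
    qed
    then obtain n where n: "q ^ n / a \<in> R" "\<And>i. i < n \<Longrightarrow> q ^ i / a \<notin> R"
      using exists_least_iff[of "\<lambda>n. q ^ n / a \<in> R"] by blast
    have "q ^ n / a \<notin> m"
    proof
      assume *: "q ^ n / a \<in> m"
      show False
      proof (cases n)
        case 0
        then show False using * n(1) a by (auto simp: m_def inverse_divide)
      next
        case (Suc k)
        have "q ^ n / a / q \<in> R" using q(3)[OF *] .
        then show False using n(2)[of k] q(2) Suc by simp
      qed
    qed
    then have "inverse (q ^ n / a) \<in> R" using munit n by blast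
    then have "unit (a / q ^ n)" using n(1) a q by (simp add: unit_def inverse_divide)
    then show ?thesis using q by (intro exI[of _ n] exI[of _ "a / q ^ n"]) simp
  qed
  have unit_mult: "unit (a * b)" if "unit a" "unit b" for a b
    using that Rs(4) by (auto simp: unit_def)
  have unit_inv: "unit (inverse a)" if "unit a" for a
    using that by (auto simp: unit_def)
  have gen: "\<exists>k u. unit u \<and> a = u * q powi k" if a: "a \<noteq> 0" for a
  proof (cases "a \<in> R")
    case True
    then obtain n u where "unit u" "a = u * q ^ n" using ord a by blast
    then show ?thesis by (intro exI[of _ "int n"] exI[of _ u]) simp
  next
    case False
    then have "inverse a \<in> R" using dich by blast
    then obtain n u where nu: "unit u" "inverse a = u * q ^ n" using ord[of "inverse a"] a by auto
    then have "a = inverse u * q powi (- int n)"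
      by (metis inverse_inverse_eq inverse_mult_distrib power_int_minus power_int_of_nat)
    then show ?thesis using unit_inv[OF nu(1)] by blast
  qed
  have uniq0: "k \<le> 0" if "unit (q powi k)" for k
  proof (rule ccontr)
    assume "\<not> k \<le> 0"
    then have "q powi k \<in> m" using qn[of "nat k - 1"] by (simp add: power_int_def)
    then show False using that by (auto simp: unit_def m_def)
  qed
  have uniq: "k = l" if "unit u" "unit w" "u * q powi k = w * q powi l" for u w k l
  proof -
    have nz: "u \<noteq> 0" "w \<noteq> 0" using that by (auto simp: unit_def)
    have "q powi (k - l) = w * inverse u" "q powi (l - k) = u * inverse w"
      using that(3) nz q(2) by (auto simp: power_int_diff field_simps)
    then have "unit (q powi (k - l))" "unit (q powi (l - k))"
      using that unit_mult unit_inv by auto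
    then show ?thesis using uniq0[of "k - l"] uniq0[of "l - k"] by simp
  qed
  define v where "v a = (if a = 0 then 0 else THE k. \<exists>u. unit u \<and> a = u * q powi k)" for a
  have vI: "v (u * q powi k) = k" if "unit u" for u k
  proof -
    have "u * q powi k \<noteq> 0" using that q by (auto simp: unit_def)
    then show ?thesis unfolding v_def using that uniq by (auto intro!: the_equality)
  qed
  have u1: "unit 1" using Rs(2) by (simp add: unit_def)
  have vR: "v a \<ge> 0" if aR: "a \<in> R" for a
  proof (cases "a = 0")
    case True then show ?thesis by (simp add: v_def)
  next
    case False
    then obtain n u where "unit u" "a = u * q ^ n" using ord[OF aR] by blast
    then show ?thesis using vI[of u "int n"] by simp
  qed
  have vm: "v (a * b) = v a + v b" if ab: "a \<noteq> 0" "b \<noteq> 0" for a b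
  proof -
    obtain u k w l where *: "unit u" "a = u * q powi k" "unit w" "b = w * q powi l"
      using gen ab by metis
    have "a * b = (u * w) * q powi (k + l)" using * q by (simp add: power_int_add)
    then show ?thesis using vI unit_mult * by metis
  qed
  have va: "min (v a) (v b) \<le> v (a + b)" if ab: "a \<noteq> 0" "b \<noteq> 0" "a + b \<noteq> 0" for a b
  proof -
    have *: "v a \<le> v (a + b)" if ab: "a \<noteq> 0" "b \<noteq> 0" "a + b \<noteq> 0" "v a \<le> v b" for a b
    proof -
      obtain u k w l where *: "unit u" "a = u * q powi k" "unit w" "b = w * q powi l"
        using gen ab by metis
      then have kl: "v a = k" "k \<le> l" using vI[of u k] vI[of w l] ab(4) by auto
      have "a + b = q powi k * (u + w * q powi (l - k))"
        using * q by (simp add: power_int_diff algebra_simps)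
      moreover have "u + w * q powi (l - k) \<in> R"
        using * kl mR[OF q(1)] Rs by (auto simp: power_int_def unit_def)
      ultimately have "v (a + b) = v (q powi k) + v (u + w * q powi (l - k))" "v (u + w * q powi (l - k)) \<ge> 0"
        using vm ab(3) vR by auto
      then show ?thesis using kl vI[OF u1, of k] by simp
    qed
    show ?thesis using *[of a b] *[of b a] ab by (cases "v a \<le> v b") (auto simp: add.commute)
  qed
  have "k \<in> v ` (UNIV - {0})" for k
    using vI[OF u1, of k] q by (intro image_eqI[of _ _ "q powi k"]) auto
  then have "v \<in> places" using vm va by (auto simp: valuations_def v_def)
  moreover have "v y > 0"
  proof -
    obtain n u where nu: "unit u" "y = u * q ^ n" using ord y by blast
    then have "n \<noteq> 0" using y by (cases "n = 0") (auto simp: unit_def)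
    then show ?thesis using vI[of u "int n"] nu by simp
  qed
  ultimately show ?thesis by blast
qed

lemma inverse_power_mult:
  fixes w :: "'a::field"
  shows "w \<noteq> 0 \<Longrightarrow> i \<le> n \<Longrightarrow> inverse w ^ i * w ^ n = w ^ (n - i)"
  by (simp add: power_diff power_inverse divide_inverse mult.commute)

text \<open>If neither \<open>a\<close> nor its inverse were in \<open>R\<close>, maximality would
  put \<open>g\<close> into both rings obtained by adjoining them. The two polynomial expressions
  for \<open>g\<close> can be played off against each other, always shortening the longer one, until
  none is left.\<close>

lemma maximal_subring_dichotomy:
  fixes R :: "'k set"
  assumes R: "is_subring R" and g: "g \<noteq> 0" "inverse g \<in> R" "g \<notin> R"
    and max: "\<And>S. is_subring S \<Longrightarrow> R \<subseteq> S \<Longrightarrow> g \<notin> S \<Longrightarrow> S = R"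
  shows "a \<in> R \<or> inverse a \<in> R"
proof (rule ccontr)
  assume no: "\<not> ?thesis"
  note Rs = is_subringD[OF R]
  have sumR: "(\<Sum>i\<in>I. f i) \<in> R" if "\<And>i. i \<in> I \<Longrightarrow> f i \<in> R" for f :: "nat \<Rightarrow> 'k" and I
    using that by (induction I rule: infinite_finite_induct) (auto intro: Rs)
  define y where "y = inverse g"
  define P where "P a n \<longleftrightarrow> (\<exists>c. (\<forall>i. c i \<in> R) \<and> g = (\<Sum>i\<le>n. c i * a ^ i))" for a n
  have ex: "\<exists>n. P a n" if a: "a \<notin> R" for a
  proof -
    define S where "S = {poly q a | q. \<forall>i. Polynomial.coeff q i \<in> R}"
    have "is_subring S"
      unfolding is_subring_def
    proof (intro conjI ballI)
      show "0 \<in> S" unfolding S_def using Rs(1) by (intro CollectI exI[of _ 0]) auto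
      show "1 \<in> S" unfolding S_def using Rs(1,2)
        by (intro CollectI exI[of _ 1]) (auto simp: coeff_1)
      fix s t assume "s \<in> S" "t \<in> S"
      then obtain q r where *: "s = poly q a" "t = poly r a" "\<forall>i. Polynomial.coeff q i \<in> R"
        "\<forall>i. Polynomial.coeff r i \<in> R" by (auto simp: S_def)
      then show "s - t \<in> S" unfolding S_def using Rs(3) by (intro CollectI exI[of _ "q - r"]) auto
      show "s * t \<in> S" unfolding S_def using * Rs(4)
        by (intro CollectI exI[of _ "q * r"]) (auto simp: coeff_mult intro!: sumR)
    qed
    moreover have "R \<subseteq> S"
    proof
      fix r assume "r \<in> R"
      then show "r \<in> S" unfolding S_def using Rs(1)
        by (intro CollectI exI[of _ "[:r:]"]) (auto simp: coeff_pCons split: nat.split)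
    qed
    moreover have "a \<in> S" unfolding S_def using Rs(1,2)
      by (intro CollectI exI[of _ "[:0, 1:]"]) (auto simp: coeff_pCons split: nat.split)
    ultimately have "g \<in> S" using max[of S] a by blast
    then obtain q where "g = poly q a" "\<forall>i. Polynomial.coeff q i \<in> R" by (auto simp: S_def)
    then show ?thesis unfolding P_def poly_altdef by blast
  qed
  \<comment> \<open>Otherwise \<open>g\<close> is a polynomial in the inverse of
    \<open>w = 1 - y * s\<close>. Clearing denominators puts \<open>g * w ^ n\<close> into
    \<open>R\<close>; but \<open>w ^ n = 1 - y * s'\<close> and \<open>g * y = 1\<close>, so this
    element is \<open>g - s'\<close> and \<open>g\<close> would lie in \<open>R\<close>.\<close>
  have unit: "1 - y * s \<noteq> 0" "inverse (1 - y * s) \<in> R" if s: "s \<in> R" for s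
  proof -
    show nz: "1 - y * s \<noteq> 0"
    proof
      assume "1 - y * s = 0"
      then have "s = g" using g by (simp add: y_def field_simps)
      then show False using s g by simp
    qed
    show "inverse (1 - y * s) \<in> R"
    proof (rule ccontr)
      define w where "w = 1 - y * s"
      assume "inverse (1 - y * s) \<notin> R"
      then obtain n c where c: "\<forall>i. c i \<in> R" "g = (\<Sum>i\<le>n. c i * inverse w ^ i)"
        using ex[of "inverse w"] by (auto simp: P_def w_def)
      have yR: "y \<in> R" using g by (simp add: y_def)
      have wR: "w \<in> R" using yR s Rs by (auto simp: w_def)
      have "g * w ^ n = (\<Sum>i\<le>n. c i * w ^ (n - i))"
        unfolding c(2) sum_distrib_right
        using nz by (intro sum.cong) (auto simp: w_def[symmetric] mult.assoc inverse_power_mult)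
      also have "\<dots> \<in> R" using c wR Rs by (intro sumR) auto
      finally have 1: "g * w ^ n \<in> R" .
      have "\<exists>s'\<in>R. w ^ k = 1 - y * s'" for k
      proof (induction k)
        case 0 then show ?case using Rs(1) by (intro bexI[of _ 0]) auto
      next
        case (Suc k)
        then obtain s' where s': "s' \<in> R" "w ^ k = 1 - y * s'" by blast
        have "w ^ Suc k = 1 - y * (s' + s * (1 - y * s'))"
          by (simp add: s'(2)) (simp add: w_def algebra_simps)
        moreover have "s' + s * (1 - y * s') \<in> R" using s' s yR Rs by auto
        ultimately show ?case by blast
      qed
      then obtain s' where s': "s' \<in> R" "w ^ n = 1 - y * s'" by blast
      have "g * w ^ n + s' = g" using g by (simp add: s'(2) y_def algebra_simps)
      then show False using Rs(6)[OF 1 s'(1)] g by simp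
    qed
  qed
  \<comment> \<open>Multiplied by \<open>y\<close>, the expression in \<open>inverse a\<close>
    writes the unit \<open>1 - y * d 0\<close> by negative powers of \<open>a\<close>. Normalised
    and multiplied by \<open>a ^ n\<close>, it expresses \<open>a ^ n\<close> by lower powers, which
    removes the top term of the other expression.\<close>
  have reduce: "\<exists>k. n = Suc k \<and> P a k" if r: "P a n" "P (inverse a) m" "m \<le> n" "a \<noteq> 0" for a n m
  proof -
    obtain c where c: "\<And>i. c i \<in> R" "g = (\<Sum>i\<le>n. c i * a ^ i)" using r(1) by (auto simp: P_def)
    obtain d where d: "\<And>i. d i \<in> R" "g = (\<Sum>i\<le>m. d i * inverse a ^ i)" using r(2) by (auto simp: P_def)
    have "n \<noteq> 0" using c(1)[of 0] c(2) g(3) by (cases "n = 0") auto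
    then obtain k where k: "n = Suc k" by (cases n) auto
    define w where "w = inverse (1 - y * d 0)"
    have w: "w \<in> R" "w * (1 - y * d 0) = 1" using unit[OF d(1)[of 0]] by (auto simp: w_def)
    have yR: "y \<in> R" using g by (simp add: y_def)
    have "g = d 0 + (\<Sum>i=1..m. d i * inverse a ^ i)"
      unfolding d(2) sum.atMost_shift by (simp add: sum.atLeast1_atMost_eq)
    then have "y * (g - d 0) = y * (\<Sum>i=1..m. d i * inverse a ^ i)"
      by (simp only: add_diff_cancel_left')
    then have "1 - y * d 0 = (\<Sum>i=1..m. y * (d i * inverse a ^ i))"
      using g by (simp only: sum_distrib_left) (simp add: y_def right_diff_distrib)
    then have "1 = w * (\<Sum>i=1..m. y * (d i * inverse a ^ i))" using w(2) by simp
    then have "a ^ n = w * (\<Sum>i=1..m. y * (d i * inverse a ^ i)) * a ^ n" by simp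
    also have "\<dots> = (\<Sum>i=1..m. (w * y * d i) * (inverse a ^ i * a ^ n))"
      by (simp only: sum_distrib_left sum_distrib_right mult.assoc)
    also have "\<dots> = (\<Sum>i=1..m. (w * y * d i) * a ^ (n - i))"
      using r by (intro sum.cong) (auto simp: inverse_power_mult)
    finally have an: "a ^ n = (\<Sum>i=1..m. (w * y * d i) * a ^ (n - i))" .
    define e where "e j = c j + (if n - j \<in> {1..m} then c n * (w * y * d (n - j)) else 0)" for j
    have "(\<Sum>i=1..m. (w * y * d i) * a ^ (n - i)) =
        (\<Sum>j\<in>(\<lambda>i. n - i) ` {1..m}. (w * y * d (n - j)) * a ^ j)"
      using r by (subst sum.reindex) (auto intro!: inj_onI sum.cong)
    also have "\<dots> = (\<Sum>j\<le>k. if n - j \<in> {1..m} then (w * y * d (n - j)) * a ^ j else 0)"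
    proof (subst sum.inter_filter[symmetric])
      have "(\<lambda>i. n - i) ` {1..m} = {j \<in> {..k}. n - j \<in> {1..m}}"
      proof (intro equalityI subsetI)
        fix j assume "j \<in> {j \<in> {..k}. n - j \<in> {1..m}}"
        then show "j \<in> (\<lambda>i. n - i) ` {1..m}" using k by (intro image_eqI[of _ _ "n - j"]) auto
      qed (use r k in auto)
      then show "(\<Sum>j\<in>(\<lambda>i. n - i) ` {1..m}. (w * y * d (n - j)) * a ^ j) =
        (\<Sum>j\<in>{j \<in> {..k}. n - j \<in> {1..m}}. (w * y * d (n - j)) * a ^ j)" by simp
    qed simp
    finally have "a ^ n = (\<Sum>j\<le>k. if n - j \<in> {1..m} then (w * y * d (n - j)) * a ^ j else 0)"
      using an by simp
    then have "g = (\<Sum>j\<le>k. c j * a ^ j) + c n * (\<Sum>j\<le>k. if n - j \<in> {1..m} then (w * y * d (n - j)) * a ^ j else 0)"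
      using c(2) k by simp
    also have "\<dots> = (\<Sum>j\<le>k. e j * a ^ j)"
      unfolding sum_distrib_left sum.distrib[symmetric]
      by (intro sum.cong) (auto simp: e_def algebra_simps)
    finally have "g = (\<Sum>j\<le>k. e j * a ^ j)" .
    moreover have "e j \<in> R" for j using c d w yR Rs by (auto simp: e_def)
    ultimately show ?thesis using k by (auto simp: P_def)
  qed
  have "False" if "P a n" "P (inverse a) m" "a \<noteq> 0" for a n m
    using that
  proof (induction "n + m" arbitrary: a n m rule: less_induct)
    case less
    show ?case
    proof (cases "m \<le> n")
      case True
      then obtain k where "n = Suc k" "P a k" using reduce less.prems by blast
      then show ?thesis using less.hyps[of k m a] less.prems by simp
    next
      case False
      then obtain k where "m = Suc k" "P (inverse a) k"
        using reduce[of "inverse a" m n] less.prems by auto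
      then show ?thesis using less.hyps[of n k a] less.prems by simp
    qed
  qed
  moreover have "a \<noteq> 0" using no Rs(1) by auto
  ultimately show False using ex[of a] ex[of "inverse a"] no by blast
qed

text \<open>The powers of \<open>g\<close> are combinations of \<open>g ^ 0, ..., g ^ d\<close> with
  coefficients modulo \<open>p\<close>. These are finitely many elements, so two powers
  coincide.\<close>

lemma power_eq_one_of_integral:
  fixes g :: 'k
  assumes g: "g \<noteq> 0" and d: "g ^ Suc d = (\<Sum>i\<le>d. of_int (c i) * g ^ i)"
  shows "\<exists>m>0. g ^ m = 1"
proof -
  have p0: "p > 0" using prime_p by (simp add: prime_gt_0_nat)
  define F where "F = {(\<Sum>i\<le>d. of_int (a i) * g ^ i) | a :: nat \<Rightarrow> int. True}"
  have mod: "(of_int (z mod int p) :: 'k) = of_int z" for z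
  proof -
    have "(of_int z :: 'k) = of_int (z mod int p + int p * (z div int p))" by simp
    also have "\<dots> = of_int (z mod int p)" using char_p by (simp only: of_int_add of_int_mult of_int_of_nat_eq) simp
    finally show ?thesis by simp
  qed
  have "finite F"
  proof (rule finite_subset)
    show "F \<subseteq> (\<lambda>a. \<Sum>i\<le>d. of_int (a i) * g ^ i) ` ({..d} \<rightarrow>\<^sub>E {0..<int p})"
    proof
      fix x assume "x \<in> F"
      then obtain a where a: "x = (\<Sum>i\<le>d. of_int (a i) * g ^ i)" by (auto simp: F_def)
      have "x = (\<Sum>i\<le>d. of_int (restrict (\<lambda>i. a i mod int p) {..d} i) * g ^ i)"
        unfolding a by (intro sum.cong) (auto simp: mod)
      then show "x \<in> (\<lambda>a. \<Sum>i\<le>d. of_int (a i) * g ^ i) ` ({..d} \<rightarrow>\<^sub>E {0..<int p})"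
        using p0 by (intro image_eqI[of _ _ "restrict (\<lambda>i. a i mod int p) {..d}"]) auto
    qed
  qed (auto intro: finite_PiE)
  moreover have "g ^ n \<in> F" for n
  proof (induction n)
    case 0
    have "(1 :: 'k) = (\<Sum>i\<le>d. of_int (if i = 0 then 1 else 0) * g ^ i)"
      by (simp add: if_distrib[of of_int] if_distrib[of "\<lambda>x. x * _"] cong: if_cong)
    then show ?case unfolding F_def by (auto intro!: exI[of _ "\<lambda>i. if i = 0 then 1 else 0"])
  next
    case (Suc n)
    then obtain a where a: "g ^ n = (\<Sum>i\<le>d. of_int (a i) * g ^ i)" by (auto simp: F_def)
    define b where "b i = (if i = 0 then 0 else a (i - 1)) + a d * c i" for i
    have "g ^ Suc n = (\<Sum>i\<le>d. of_int (a i) * g ^ Suc i)"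
      by (simp add: a sum_distrib_left algebra_simps)
    also have "\<dots> = (\<Sum>i<d. of_int (a i) * g ^ Suc i) + of_int (a d) * (\<Sum>i\<le>d. of_int (c i) * g ^ i)"
      unfolding d[symmetric] by (simp flip: lessThan_Suc_atMost)
    also have "(\<Sum>i<d. of_int (a i) * g ^ Suc i) = (\<Sum>i\<le>d. of_int (if i = 0 then 0 else a (i - 1)) * g ^ i)"
      by (subst sum.atMost_shift) simp
    also have "\<dots> + of_int (a d) * (\<Sum>i\<le>d. of_int (c i) * g ^ i) = (\<Sum>i\<le>d. of_int (b i) * g ^ i)"
      unfolding sum_distrib_left sum.distrib[symmetric]
      by (intro sum.cong) (auto simp: b_def algebra_simps)
    finally show ?case by (auto simp: F_def)
  qed
  ultimately have "\<not> inj (\<lambda>n :: nat. g ^ n)"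
    by (meson finite_imageD finite_subset image_subsetI infinite_UNIV_nat)
  then obtain i j :: nat where "g ^ i = g ^ j" "i < j"
    by (auto simp: inj_def) (metis linorder_neqE_nat)
  then have "g ^ (j - i) = 1" using g by (simp add: power_diff)
  then show ?thesis using \<open>i < j\<close> by (intro exI[of _ "j - i"]) auto
qed

text \<open>Since \<open>g\<close> is not integral over the prime field, it is not in the ring
  generated by its inverse \<open>y\<close>. A subring maximal among those containing
  \<open>y\<close> but not \<open>g\<close> is a valuation ring in which \<open>y\<close> is a
  nonunit.\<close>

lemma pole_exists:
  fixes g :: 'k
  assumes g: "g \<noteq> 0" and no: "\<not> (\<exists>m>0. g ^ m = 1)"
  shows "\<exists>v\<in>places. v g < 0"
proof -
  define y where "y = inverse g"
  define A where "A = {R. is_subring R \<and> y \<in> R \<and> g \<notin> R}"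
  define R0 where "R0 = range (\<lambda>q :: int poly. poly (map_poly of_int q) y)"
  have "is_subring R0"
    unfolding is_subring_def
  proof (intro conjI ballI)
    show "0 \<in> R0" unfolding R0_def by (intro image_eqI[of _ _ 0]) auto
    show "1 \<in> R0" unfolding R0_def by (intro image_eqI[of _ _ 1]) auto
    fix s t assume "s \<in> R0" "t \<in> R0"
    then obtain q r where *: "s = poly (map_poly of_int q) y" "t = poly (map_poly of_int r) y"
      by (auto simp: R0_def)
    show "s - t \<in> R0" unfolding R0_def * by (intro image_eqI[of _ _ "q - r"]) (auto simp: hom_distribs)
    show "s * t \<in> R0" unfolding R0_def * by (intro image_eqI[of _ _ "q * r"]) (auto simp: hom_distribs)
  qed
  moreover have "y \<in> R0" unfolding R0_def by (intro image_eqI[of _ _ "[:0, 1:]"]) auto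
  moreover have "g \<notin> R0"
  proof
    assume "g \<in> R0"
    then obtain q where q: "g = poly (map_poly of_int q) y" by (auto simp: R0_def)
    define d where "d = Polynomial.degree (map_poly of_int q :: 'k poly)"
    have "g ^ Suc d = poly (map_poly of_int q) y * g ^ d" by (simp flip: q)
    also have "\<dots> = (\<Sum>i\<le>d. of_int (Polynomial.coeff q i) * (y ^ i * g ^ d))"
      by (simp add: poly_altdef[of _ y] d_def sum_distrib_right mult.assoc coeff_map_poly)
    also have "\<dots> = (\<Sum>i\<le>d. of_int (Polynomial.coeff q i) * g ^ (d - i))"
      using g by (intro sum.cong) (auto simp: y_def inverse_power_mult)
    also have "\<dots> = (\<Sum>i\<le>d. of_int (Polynomial.coeff q (d - i)) * g ^ i)"
      by (rule sum.reindex_bij_witness[of _ "\<lambda>i. d - i" "\<lambda>i. d - i"]) auto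
    finally show False
      using power_eq_one_of_integral[OF g, of d "\<lambda>i. Polynomial.coeff q (d - i)"] no by simp
  qed
  ultimately have "R0 \<in> A" by (simp add: A_def)
  have "\<exists>M\<in>A. \<forall>S\<in>A. M \<subseteq> S \<longrightarrow> S = M"
  proof (rule subset_Zorn_nonempty)
    show "A \<noteq> {}" using \<open>R0 \<in> A\<close> by blast
    fix C assume C: "C \<noteq> {}" "subset.chain A C"
    have sub: "S \<subseteq> T \<or> T \<subseteq> S" if "S \<in> C" "T \<in> C" for S T
      using C(2) that by (auto simp: subset.chain_def)
    have CA: "is_subring S" "y \<in> S" "g \<notin> S" if "S \<in> C" for S
      using C(2) that by (auto simp: subset.chain_def A_def)
    have "is_subring (\<Union>C)"
      unfolding is_subring_def
    proof (intro conjI ballI)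
      show "0 \<in> \<Union>C" "1 \<in> \<Union>C" using C(1) CA(1) by (auto simp: is_subring_def)
      fix s t assume "s \<in> \<Union>C" "t \<in> \<Union>C"
      then obtain S T where "S \<in> C" "s \<in> S" "T \<in> C" "t \<in> T" by blast
      then obtain U where "U \<in> C" "s \<in> U" "t \<in> U" using sub by blast
      then show "s - t \<in> \<Union>C" "s * t \<in> \<Union>C" using CA(1)[of U] by (auto simp: is_subring_def)
    qed
    then show "\<Union>C \<in> A" using C(1) CA by (auto simp: A_def)
  qed
  then obtain R where R: "R \<in> A" "\<And>S. S \<in> A \<Longrightarrow> R \<subseteq> S \<Longrightarrow> S = R" by blast
  then have RA: "is_subring R" "y \<in> R" "g \<notin> R" by (auto simp: A_def)
  have "a \<in> R \<or> inverse a \<in> R" for a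
  proof (rule maximal_subring_dichotomy[OF RA(1) g _ RA(3)])
    show "inverse g \<in> R" using RA by (simp add: y_def)
    fix S assume "is_subring S" "R \<subseteq> S" "g \<notin> S"
    then show "S = R" using R(2)[of S] RA(2) by (auto simp: A_def)
  qed
  then have "\<exists>v\<in>places. v y > 0"
    using RA g by (intro valuation_ring_place[OF RA(1)]) (auto simp: y_def)
  then show ?thesis by (auto simp: y_def val_inverse)
qed

end

subsection \<open>The product formula\<close>

lemma card_le_fibres:
  fixes S :: "'a::ab_group_add set"
  assumes R: "finite R" "g ` S \<subseteq> R" and A: "finite A"
    and diff: "\<And>x y. x \<in> S \<Longrightarrow> y \<in> S \<Longrightarrow> g x = g y \<Longrightarrow> x - y \<in> A"
  shows "finite S" "card S \<le> card R * card A"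
proof -
  have S: "S = (\<Union>r\<in>R. {x \<in> S. g x = r})" using R by auto
  have fib: "finite {x \<in> S. g x = r} \<and> card {x \<in> S. g x = r} \<le> card A" for r
  proof (cases "\<exists>y\<in>S. g y = r")
    case True
    then obtain y where y: "y \<in> S" "g y = r" by blast
    have sub: "{x \<in> S. g x = r} \<subseteq> (\<lambda>a. a + y) ` A"
    proof
      fix x assume "x \<in> {x \<in> S. g x = r}"
      then show "x \<in> (\<lambda>a. a + y) ` A" using diff[of x y] y by (intro image_eqI[of _ _ "x - y"]) auto
    qed
    have "card {x \<in> S. g x = r} \<le> card ((\<lambda>a. a + y) ` A)" using A sub by (intro card_mono) auto
    also have "\<dots> \<le> card A" using A by (rule card_image_le)
    finally show ?thesis using finite_subset[OF sub] A by auto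
  next
    case False
    then have "{x \<in> S. g x = r} = {}" by auto
    then show ?thesis by (simp only: finite.emptyI card.empty) simp
  qed
  show "finite S" by (subst S) (use R fib in auto)
  have "card S \<le> (\<Sum>r\<in>R. card {x \<in> S. g x = r})" by (subst S) (rule card_UN_le[OF R(1)])
  also have "\<dots> \<le> (\<Sum>r\<in>R. card A)" using fib by (intro sum_mono) auto
  finally show "card S \<le> card R * card A" by simp
qed

lemma le_of_nat_mult_le:
  fixes a b c :: real
  assumes "\<And>m :: nat. real m * a \<le> real m * b + c"
  shows "a \<le> b"
proof (rule ccontr)
  assume "\<not> a \<le> b"
  then obtain m :: nat where "c < real m * (a - b)" using reals_Archimedean3[of "a - b"] by auto
  then show False using assms[of m] by (simp add: algebra_simps)
qed

definition pole_order :: "('a::field \<Rightarrow> int) \<Rightarrow> 'a \<Rightarrow> int" where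
  "pole_order v x = max 0 (- v x)"

definition riemann_space :: "(('a::field \<Rightarrow> int) \<Rightarrow> nat) \<Rightarrow> 'a set" where
  "riemann_space E = {x. \<forall>v\<in>places. vge v (- int (E v)) x}"

definition residue :: "('a::field \<Rightarrow> int) \<Rightarrow> 'a \<Rightarrow> 'a" where
  "residue v x = (SOME y. y \<in> reps v \<and> vge v 1 (x - y))"

definition divisor_degree :: "(('a::field \<Rightarrow> int) \<Rightarrow> int) \<Rightarrow> real" where
  "divisor_degree c = (\<Sum>v\<in>{v \<in> places. c v \<noteq> 0}. place_degree v * of_int (c v))"

text \<open>The height over K itself, with logarithms of residue field orders as weights. It is
  compared with the Weil height only in \<open>height_orb_ge\<close>, and only up to a constant
  factor.\<close>

definition height :: "'a::field \<Rightarrow> real" where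
  "height x = divisor_degree (\<lambda>v. pole_order v x)"

lemma pole_order_nonneg: "0 \<le> pole_order v x" by (simp add: pole_order_def)

lemma vge_pole_order: "vge v (- pole_order v x) x" by (simp add: vge_def pole_order_def max_def)

lemma pole_order_le: "v \<in> places \<Longrightarrow> vge v (- k) x \<Longrightarrow> 0 \<le> k \<Longrightarrow> pole_order v x \<le> k"
  using val_zero[of v] by (auto simp: pole_order_def vge_def)

lemma riemann_spaceD: "x \<in> riemann_space E \<Longrightarrow> v \<in> places \<Longrightarrow> vge v (- int (E v)) x"
  by (simp add: riemann_space_def)

lemma divisor_degree_eq:
  assumes "finite T" "T \<subseteq> places" "\<And>v. v \<in> places \<Longrightarrow> v \<notin> T \<Longrightarrow> c v = 0"
  shows "divisor_degree c = (\<Sum>v\<in>T. place_degree v * of_int (c v))"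
  unfolding divisor_degree_def using assms by (intro sum.mono_neutral_left) auto

context function_field
begin

lemma residue:
  fixes v :: "'k \<Rightarrow> int"
  assumes "v \<in> places" "vge v 0 x"
  shows "residue v x \<in> reps v" "vge v 1 (x - residue v x)"
proof -
  have "\<exists>y. y \<in> reps v \<and> vge v 1 (x - y)" using reps(4)[OF assms] by blast
  from someI_ex[OF this] show "residue v x \<in> reps v" "vge v 1 (x - residue v x)"
    by (simp_all add: residue_def)
qed

lemma residue_eqD:
  fixes v :: "'k \<Rightarrow> int"
  assumes v: "v \<in> places" "vge v 0 x" "vge v 0 y" and eq: "residue v x = residue v y"
  shows "vge v 1 (x - y)"
proof -
  have "vge v 1 (residue v x - y)"
    using residue(2)[OF v(1,3)] vge_diff_commute[OF v(1)] eq by simp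
  then show ?thesis using vge_trans_diff[OF v(1) residue(2)[OF v(1,2)]] by blast
qed

text \<open>Constants are separated by their residues at \<open>v\<close>: a nonzero difference
  without poles is a root of unity by \<open>pole_exists\<close>, so its value at \<open>v\<close>
  is 0 and it cannot vanish there.\<close>

lemma finite_constants:
  assumes v: "v \<in> (places :: ('k \<Rightarrow> int) set)"
  shows "finite (riemann_space (\<lambda>_. 0) :: 'k set)"
proof (rule card_le_fibres(1))
  show "finite (reps v)" using reps v by blast
  show "residue v ` riemann_space (\<lambda>_. 0) \<subseteq> reps v"
    using residue(1)[OF v] v by (auto simp: riemann_space_def)
  fix x y :: 'k assume *: "x \<in> riemann_space (\<lambda>_. 0)" "y \<in> riemann_space (\<lambda>_. 0)" "residue v x = residue v y"
  have 1: "vge v 1 (x - y)" using residue_eqD[OF v] * v by (auto simp: riemann_space_def)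
  have 2: "vge w 0 (x - y)" if "w \<in> places" for w
    using vge_diff[OF that, of 0 x y] riemann_spaceD[OF *(1) that] riemann_spaceD[OF *(2) that] by simp
  have "x - y = 0"
  proof (rule ccontr)
    assume nz: "x - y \<noteq> 0"
    have "\<not> w (x - y) < 0" if "w \<in> places" for w using 2[OF that] nz by (simp add: vge_def)
    then have "\<not> (\<exists>w\<in>places. w (x - y) < 0)" by blast
    then obtain m where m: "m > 0" "(x - y) ^ m = 1" using pole_exists[OF nz] by blast
    then have "int m * v (x - y) = 0" using val_power[OF v, of "x - y" m] val_one[OF v] by simp
    then show False using m 1 nz by (auto simp: vge_def)
  qed
  then show "x - y \<in> {0}" by simp
qed simp

text \<open>The new freedom is the leading coefficient at \<open>v\<close>, that is the residue of
  \<open>w * x\<close>. Elements sharing it differ by an element of the smaller space.\<close>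

lemma riemann_space_step:
  assumes v: "v \<in> places" and fin: "finite (riemann_space E :: 'k set)"
  shows "finite (riemann_space (E(v := Suc (E v))) :: 'k set)"
    "card (riemann_space (E(v := Suc (E v))) :: 'k set) \<le> card (reps v) * card (riemann_space E :: 'k set)"
proof -
  obtain u where u: "u \<noteq> 0" "v u = 1" using uniformizer_exists[OF v] by blast
  define w where "w = u ^ Suc (E v)"
  have w: "w \<noteq> 0" "v w = int (E v) + 1" using u val_power[OF v, of u "Suc (E v)"] by (auto simp: w_def)
  let ?E = "E(v := Suc (E v))"
  have int: "vge v 0 (w * x)" if "x \<in> riemann_space ?E" for x
  proof -
    have "vge v (- v w) x" using riemann_spaceD[OF that v] w by (simp add: algebra_simps)
    then show ?thesis using vge_cancel_mult[OF v w(1), of "- v w" x] by simp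
  qed
  have R: "finite (reps v)" "(\<lambda>x. residue v (w * x)) ` riemann_space ?E \<subseteq> reps v"
    using reps(1)[OF v] residue(1)[OF v int] by auto
  have D: "x - y \<in> riemann_space E"
    if xy: "x \<in> riemann_space ?E" "y \<in> riemann_space ?E" "residue v (w * x) = residue v (w * y)" for x y
    unfolding riemann_space_def
  proof (intro CollectI ballI)
    fix z :: "'k \<Rightarrow> int" assume z: "z \<in> places"
    show "vge z (- int (E z)) (x - y)"
    proof (cases "z = v")
      case True
      have "vge v (v w + (- int (E v))) (w * (x - y))"
        using residue_eqD[OF v int[OF xy(1)] int[OF xy(2)] xy(3)] w by (simp add: algebra_simps)
      then show ?thesis using vge_cancel_mult[OF v w(1)] True by blast
    next
      case False
      then have "vge z (- int (E z)) x" "vge z (- int (E z)) y"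
        using riemann_spaceD[OF xy(1) z] riemann_spaceD[OF xy(2) z] by auto
      then show ?thesis using vge_diff[OF z] by blast
    qed
  qed
  show "finite (riemann_space ?E :: 'k set)" "card (riemann_space ?E :: 'k set) \<le> card (reps v) * card (riemann_space E :: 'k set)"
    using card_le_fibres[OF R fin D] by blast+
qed

lemma riemann_space_card:
  assumes c: "finite (riemann_space (\<lambda>_. 0) :: 'k set)" and T: "finite T" "T \<subseteq> (places :: ('k \<Rightarrow> int) set)"
  shows "finite (riemann_space (\<lambda>v. if v \<in> T then E v else 0) :: 'k set) \<and>
    card (riemann_space (\<lambda>v. if v \<in> T then E v else 0) :: 'k set)
      \<le> card (riemann_space (\<lambda>_. 0) :: 'k set) * (\<Prod>v\<in>T. card (reps v) ^ E v)"
  using T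
proof (induction T rule: finite_induct)
  case (insert v T)
  define F where "F = (\<lambda>v. if v \<in> T then E v else 0)"
  have v: "v \<in> places" using insert by auto
  have IH: "finite (riemann_space F :: 'k set)"
    "card (riemann_space F :: 'k set) \<le> card (riemann_space (\<lambda>_. 0) :: 'k set) * (\<Prod>v\<in>T. card (reps v) ^ E v)"
    using insert by (auto simp: F_def)
  define G where "G e = F(v := e)" for e
  have "finite (riemann_space (G e) :: 'k set) \<and>
    card (riemann_space (G e) :: 'k set)
      \<le> card (riemann_space (\<lambda>_. 0) :: 'k set) * (card (reps v) ^ e * (\<Prod>v\<in>T. card (reps v) ^ E v))" for e
  proof (induction e)
    case 0
    have "G 0 = F" using insert by (auto simp: F_def G_def)
    then show ?case using IH by simp
  next
    case (Suc e)
    have "(G e)(v := Suc (G e v)) = G (Suc e)" by (simp add: G_def)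
    with riemann_space_step[OF v, of "G e"] Suc
    have fin: "finite (riemann_space (G (Suc e)) :: 'k set)"
      and "card (riemann_space (G (Suc e)) :: 'k set) \<le> card (reps v) * card (riemann_space (G e) :: 'k set)"
      by simp_all
    then have "card (riemann_space (G (Suc e)) :: 'k set) \<le>
      card (reps v) * (card (riemann_space (\<lambda>_. 0) :: 'k set) * (card (reps v) ^ e * (\<Prod>v\<in>T. card (reps v) ^ E v)))"
      using Suc by (meson le_trans mult_le_mono2)
    then have "card (riemann_space (G (Suc e)) :: 'k set) \<le>
      card (riemann_space (\<lambda>_. 0) :: 'k set) * (card (reps v) ^ Suc e * (\<Prod>v\<in>T. card (reps v) ^ E v))"
      by (simp add: mult_ac)
    then show ?case using fin by blast
  qed
  note G = this[of "E v"]
  have eq: "G (E v) = (\<lambda>w. if w \<in> insert v T then E w else 0)" by (auto simp: F_def G_def)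
  show ?case using G insert(1,2) unfolding eq by simp
qed (use c in auto)

lemma riemann_space_bound:
  assumes "(places :: ('k \<Rightarrow> int) set) \<noteq> {}"
  obtains C where "C > 0" "\<And>T E. finite T \<Longrightarrow> T \<subseteq> places \<Longrightarrow> (\<And>v. v \<in> places \<Longrightarrow> v \<notin> T \<Longrightarrow> E v = 0) \<Longrightarrow>
    finite (riemann_space E :: 'k set) \<and>
    real (card (riemann_space E :: 'k set)) \<le> C * exp (\<Sum>v\<in>T. place_degree v * real (E v))"
proof -
  have fin: "finite (riemann_space (\<lambda>_. 0) :: 'k set)" using finite_constants assms by blast
  have "0 \<in> (riemann_space (\<lambda>_. 0) :: 'k set)" by (simp add: riemann_space_def)
  then have pos: "card (riemann_space (\<lambda>_. 0) :: 'k set) > 0" using fin by (auto simp: card_gt_0_iff)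
  have "finite (riemann_space E :: 'k set) \<and> real (card (riemann_space E :: 'k set))
      \<le> real (card (riemann_space (\<lambda>_. 0) :: 'k set)) * exp (\<Sum>v\<in>T. place_degree v * real (E v))"
    if T: "finite T" "T \<subseteq> places" "\<And>v. v \<in> places \<Longrightarrow> v \<notin> T \<Longrightarrow> E v = 0" for T E
  proof -
    have eq: "riemann_space (\<lambda>v. if v \<in> T then E v else 0) = (riemann_space E :: 'k set)"
      using T by (auto simp: riemann_space_def split: if_splits)
    have "real (\<Prod>v\<in>T. card (reps v) ^ E v) = (\<Prod>v\<in>T. exp (place_degree v * real (E v)))"
      unfolding of_nat_prod of_nat_power
      using T by (intro prod.cong) (auto simp: exp_place_degree exp_of_nat2_mult)
    also have "\<dots> = exp (\<Sum>v\<in>T. place_degree v * real (E v))" using T by (simp add: exp_sum)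
    finally have prod: "real (\<Prod>v\<in>T. card (reps v) ^ E v) = exp (\<Sum>v\<in>T. place_degree v * real (E v))" .
    note * = riemann_space_card[OF fin T(1,2), of E, unfolded eq]
    have "real (card (riemann_space E :: 'k set)) \<le>
        real (card (riemann_space (\<lambda>_. 0) :: 'k set) * (\<Prod>v\<in>T. card (reps v) ^ E v))"
      using * unfolding of_nat_le_iff by blast
    then show ?thesis using * unfolding of_nat_mult prod by blast
  qed
  then show ?thesis using that[of "real (card (riemann_space (\<lambda>_. 0) :: 'k set))"] pos by auto
qed

lemma finite_poles: "finite {v \<in> places. pole_order v (x :: 'k) \<noteq> 0}"
  by (rule finite_subset[OF _ finite_support[of x]]) (auto simp: pole_order_def)

lemma height_eq:
  fixes x :: 'k
  assumes "finite T" "T \<subseteq> places" "\<And>v. v \<in> places \<Longrightarrow> v \<notin> T \<Longrightarrow> pole_order v x = 0"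
  shows "height x = (\<Sum>v\<in>T. place_degree v * of_int (pole_order v x))"
  unfolding height_def using assms by (rule divisor_degree_eq)

lemma digits_in_riemann_space:
  fixes x :: 'k
  assumes Y: "\<And>y v. y \<in> Y \<Longrightarrow> v \<in> places \<Longrightarrow> vge v (- int (E v)) y"
  shows "digits x Y m \<subseteq> riemann_space (\<lambda>v. m * nat (pole_order v x) + E v)"
proof (induction m)
  case 0
  show ?case by (simp add: riemann_space_def)
next
  case (Suc m)
  show ?case
  proof
    fix z assume "z \<in> digits x Y (Suc m)"
    then obtain y s where z: "z = y + x * s" "y \<in> Y" "s \<in> digits x Y m" by auto
    have "vge v (- int (Suc m * nat (pole_order v x) + E v)) z" if v: "v \<in> places" for v
    proof -
      have "vge v (- int (m * nat (pole_order v x) + E v)) s"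
        using Suc z(3) v by (intro riemann_spaceD[where E = "\<lambda>v. m * nat (pole_order v x) + E v"]) blast+
      moreover have nn: "0 \<le> int m * pole_order v x" by (simp add: pole_order_nonneg)
      ultimately have "vge v (- pole_order v x + - int (m * nat (pole_order v x) + E v)) (x * s)"
        by (intro vge_mult v vge_pole_order)
      then
      have "vge v (- int (Suc m * nat (pole_order v x) + E v)) (x * s)"
        by (rule vge_mono) (auto simp: algebra_simps pole_order_nonneg)
      moreover have "vge v (- int (Suc m * nat (pole_order v x) + E v)) y"
        using Y[OF z(2) v] by (rule vge_mono) (use nn pole_order_nonneg[of v x] in \<open>auto simp: algebra_simps\<close>)
      ultimately show ?thesis unfolding z(1) by (intro vge_add v)
    qed
    then show "z \<in> riemann_space (\<lambda>v. Suc m * nat (pole_order v x) + E v)"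
      by (simp add: riemann_space_def)
  qed
qed

lemma finite_set_bound:
  fixes Y :: "'k set"
  assumes "finite Y"
  obtains T E where "finite T" "T \<subseteq> places" "\<And>v. v \<in> places \<Longrightarrow> v \<notin> T \<Longrightarrow> E v = 0"
    "\<And>y v. y \<in> Y \<Longrightarrow> v \<in> places \<Longrightarrow> vge v (- int (E v)) y"
proof -
  define E where "E v = (\<Sum>y\<in>Y. nat (pole_order v y))" for v :: "'k \<Rightarrow> int"
  define T where "T = (\<Union>y\<in>Y. {v \<in> places. pole_order v y \<noteq> 0})"
  have "vge v (- int (E v)) y" if "y \<in> Y" for y v
  proof -
    have "nat (pole_order v y) \<le> E v" unfolding E_def using assms that by (intro member_le_sum) auto
    then show ?thesis using vge_mono[OF vge_pole_order[of v y], of "- int (E v)"] by linarith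
  qed
  moreover have "finite T" "T \<subseteq> places" using assms finite_poles by (auto simp: T_def)
  moreover have "E v = 0" if "v \<in> places" "v \<notin> T" for v
    using that by (auto simp: E_def T_def intro!: sum.neutral)
  ultimately show ?thesis using that by blast
qed

text \<open>The \<open>card Y ^ m\<close> digit sums lie in a Riemann space of degree
  \<open>m * height x\<close> up to a constant. Taking logarithms and letting \<open>m\<close> grow
  compares the degree of the zeros with that of the poles.\<close>

lemma zeros_le_height:
  fixes x :: 'k
  assumes x: "x \<noteq> 0" and T: "finite T" "T \<subseteq> places" "\<And>v. v \<in> T \<Longrightarrow> v x > 0"
  shows "(\<Sum>v\<in>T. place_degree v * of_int (v x)) \<le> height x"
proof (cases "(places :: ('k \<Rightarrow> int) set) = {}")
  case True
  then show ?thesis using T by (simp add: height_def divisor_degree_def)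
next
  case False
  obtain Y where Y: "finite Y" "Y \<noteq> {}" "ln (real (card Y)) = (\<Sum>v\<in>T. place_degree v * of_int (v x))"
    "\<And>m. card (digits x Y m) = card Y ^ m" "\<And>y v. y \<in> Y \<Longrightarrow> v \<in> T \<Longrightarrow> vge v 0 y"
    by (rule zero_digit_set[OF T(1,2) x]) ((rule T(3), assumption), (rule that, assumption+))
  obtain S E where S: "finite S" "S \<subseteq> places" "\<And>v. v \<in> places \<Longrightarrow> v \<notin> S \<Longrightarrow> E v = 0"
    "\<And>y v. y \<in> Y \<Longrightarrow> v \<in> places \<Longrightarrow> vge v (- int (E v)) y" using finite_set_bound[OF Y(1)] by blast
  obtain C where C: "C > 0" "\<And>T E. finite T \<Longrightarrow> T \<subseteq> places \<Longrightarrow> (\<And>v. v \<in> places \<Longrightarrow> v \<notin> T \<Longrightarrow> E v = 0) \<Longrightarrow>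
    finite (riemann_space E :: 'k set) \<and>
    real (card (riemann_space E :: 'k set)) \<le> C * exp (\<Sum>v\<in>T. place_degree v * real (E v))"
    using riemann_space_bound[OF False] by blast
  define U where "U = S \<union> {v \<in> places. pole_order v x \<noteq> 0}"
  have U: "finite U" "U \<subseteq> places" using S finite_poles by (auto simp: U_def)
  define D where "D = (\<Sum>v\<in>U. place_degree v * real (E v))"
  have "real m * ln (real (card Y)) \<le> real m * height x + (ln C + D)" for m
  proof -
    define F where "F v = m * nat (pole_order v x) + E v" for v :: "'k \<Rightarrow> int"
    have F: "finite (riemann_space F :: 'k set)"
      "real (card (riemann_space F :: 'k set)) \<le> C * exp (\<Sum>v\<in>U. place_degree v * real (F v))"
      using C(2)[OF U, of F] S by (auto simp: U_def F_def)
    have "(\<Sum>v\<in>U. place_degree v * real (F v)) = real m * (\<Sum>v\<in>U. place_degree v * of_int (pole_order v x)) + D"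
      unfolding D_def sum_distrib_left sum.distrib[symmetric]
      by (intro sum.cong) (auto simp: F_def algebra_simps pole_order_nonneg)
    also have "(\<Sum>v\<in>U. place_degree v * of_int (pole_order v x)) = height x"
      using U by (intro height_eq[symmetric]) (auto simp: U_def)
    finally have sum: "(\<Sum>v\<in>U. place_degree v * real (F v)) = real m * height x + D" .
    have "digits x Y m \<subseteq> riemann_space F"
      unfolding F_def using digits_in_riemann_space[of Y E x m] S(4) by blast
    then have "card Y ^ m \<le> card (riemann_space F :: 'k set)"
      using card_mono[OF F(1)] unfolding Y(4)[symmetric] by blast
    then have "real (card Y) ^ m \<le> real (card (riemann_space F :: 'k set))"
      unfolding of_nat_power[symmetric] of_nat_le_iff .
    also have "\<dots> \<le> C * exp (real m * height x + D)" using F(2) unfolding sum .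
    finally have "real (card Y) ^ m \<le> C * exp (real m * height x + D)" .
    moreover have cY: "real (card Y) > 0" using Y by (auto simp: card_gt_0_iff)
    ultimately have "ln (real (card Y) ^ m) \<le> ln (C * exp (real m * height x + D))"
      using C(1) by (subst ln_le_cancel_iff) auto
    then show ?thesis using cY C(1) by (simp add: ln_realpow ln_mult)
  qed
  then show ?thesis using le_of_nat_mult_le[of "ln (real (card Y))" "height x" "ln C + D"] Y(3) by simp
qed

lemma height_nonneg: "0 \<le> height (x :: 'k)"
  unfolding height_def divisor_degree_def
  by (intro sum_nonneg mult_nonneg_nonneg) (auto simp: pole_order_nonneg place_degree_pos less_imp_le)

text \<open>The inequality between zeros and poles, applied to \<open>x\<close> and to its inverse,
  is an equality. This is the product formula.\<close>

lemma height_inverse: "height (inverse x) = height (x :: 'k)"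
proof -
  have le: "height (inverse x) \<le> height x" if "x \<noteq> 0" for x :: 'k
  proof -
    let ?T = "{v \<in> places. v x > 0}"
    have "height (inverse x) = (\<Sum>v\<in>?T. place_degree v * of_int (pole_order v (inverse x)))"
      using finite_zeros[OF that] by (intro height_eq) (auto simp: pole_order_def val_inverse)
    also have "\<dots> = (\<Sum>v\<in>?T. place_degree v * of_int (v x))"
      by (intro sum.cong) (auto simp: pole_order_def val_inverse)
    also have "\<dots> \<le> height x" using finite_zeros[OF that] that by (intro zeros_le_height) auto
    finally show ?thesis .
  qed
  show ?thesis using le[of x] le[of "inverse x"] by (cases "x = 0") auto
qed

lemma product_formula:
  fixes x :: 'k
  assumes x: "x \<noteq> 0" and T: "finite T" "T \<subseteq> places" "\<And>v. v \<in> places \<Longrightarrow> v \<notin> T \<Longrightarrow> v x = 0"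
  shows "(\<Sum>v\<in>T. place_degree v * of_int (v x)) = 0"
proof -
  have "(\<Sum>v\<in>T. place_degree v * of_int (v x)) =
    (\<Sum>v\<in>T. place_degree v * of_int (pole_order v (inverse x)) - place_degree v * of_int (pole_order v x))"
    using T by (intro sum.cong) (auto simp: pole_order_def val_inverse max_def)
  also have "\<dots> = height (inverse x) - height x"
    unfolding sum_subtractf using T
    by (subst (1 2) height_eq[OF T(1,2)]) (auto simp: pole_order_def val_inverse T(3))
  finally show ?thesis by (simp add: height_inverse)
qed

text \<open>The form in which the product formula is applied: a nonzero \<open>x\<close> can vanish
  at the poles of \<open>z\<close> only as far as \<open>c\<close> and the poles of \<open>u\<close>
  compensate. Later it serves to show that an element with too many zeros is 0.\<close>

lemma height_le_of_val_ge:
  fixes x z u :: 'k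
  assumes x: "x \<noteq> 0" and c: "finite {v \<in> places. c v \<noteq> 0}"
    and val: "\<And>v. v \<in> places \<Longrightarrow> - c v - k * pole_order v u + pole_order v z \<le> v x"
  shows "height z \<le> divisor_degree c + of_int k * height u"
proof -
  define T where "T = {v \<in> places. c v \<noteq> 0} \<union> {v \<in> places. pole_order v u \<noteq> 0} \<union>
    {v \<in> places. pole_order v z \<noteq> 0} \<union> {v \<in> places. v x \<noteq> 0}"
  have T: "finite T" "T \<subseteq> places"
    using c finite_poles finite_support by (auto simp: T_def)
  have "divisor_degree c = (\<Sum>v\<in>T. place_degree v * of_int (c v))"
    using T by (intro divisor_degree_eq) (auto simp: T_def)
  moreover have "height z = (\<Sum>v\<in>T. place_degree v * of_int (pole_order v z))"
    "height u = (\<Sum>v\<in>T. place_degree v * of_int (pole_order v u))"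
    using T by (auto intro!: height_eq simp: T_def)
  moreover have "(\<Sum>v\<in>T. place_degree v * of_int (v x)) = 0"
    using T by (intro product_formula x) (auto simp: T_def)
  moreover have "(\<Sum>v\<in>T. place_degree v * of_int (pole_order v z)) \<le>
    (\<Sum>v\<in>T. place_degree v * of_int (v x) + place_degree v * of_int (c v)
        + of_int k * (place_degree v * of_int (pole_order v u)))"
  proof (rule sum_mono)
    fix v assume "v \<in> T"
    then have v: "v \<in> places" using T by auto
    have "pole_order v z \<le> v x + c v + k * pole_order v u" using val[OF v] by linarith
    then have "(of_int (pole_order v z) :: real) \<le> of_int (v x + c v + k * pole_order v u)"
      unfolding of_int_le_iff .
    then have "place_degree v * of_int (pole_order v z) \<le> place_degree v * of_int (v x + c v + k * pole_order v u)"
      using place_degree_pos[OF v] by (intro mult_left_mono) auto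
    then show "place_degree v * of_int (pole_order v z) \<le> place_degree v * of_int (v x)
        + place_degree v * of_int (c v) + of_int k * (place_degree v * of_int (pole_order v u))"
      by (simp add: algebra_simps)
  qed
  ultimately show ?thesis by (simp add: sum.distrib sum_distrib_left)
qed

end

subsection \<open>A derivation with field of constants \<open>K\<^sup>p\<close>\<close>

text \<open>Terms with distinct values cannot cancel, so the smallest value among them is the value
  of the sum.\<close>

lemma vge_sum_distinct:
  assumes v: "v \<in> places" and I: "finite I"
    and inj: "\<And>i j. i \<in> I \<Longrightarrow> j \<in> I \<Longrightarrow> f i \<noteq> 0 \<Longrightarrow> f j \<noteq> 0 \<Longrightarrow> v (f i) = v (f j) \<Longrightarrow> i = j"
    and sum: "vge v k (\<Sum>i\<in>I. f i)" and i: "i \<in> I"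
  shows "vge v k (f i)"
proof (cases "f i = 0")
  case False
  define J where "J = {j \<in> I. f j \<noteq> 0}"
  have J: "finite J" "J \<noteq> {}" using I i False by (auto simp: J_def)
  have "Min ((\<lambda>j. v (f j)) ` J) \<in> (\<lambda>j. v (f j)) ` J" using J by (intro Min_in) auto
  then obtain j where j: "j \<in> J" "v (f j) = Min ((\<lambda>j. v (f j)) ` J)" by auto
  have min: "v (f j) \<le> v (f l)" if "l \<in> J" for l unfolding j(2) using J that by (intro Min_le) auto
  have lt: "vge v (v (f j) + 1) (f l)" if "l \<in> I - {j}" for l
  proof (cases "f l = 0")
    case False
    then have l: "l \<in> J" using that by (simp add: J_def)
    then have "v (f l) \<noteq> v (f j)" using inj[of l j] that j(1) by (auto simp: J_def)
    then show ?thesis using min[OF l] by (simp add: vge_def)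
  qed simp
  have rest: "vge v (v (f j) + 1) (\<Sum>l\<in>I - {j}. f l)" by (intro vge_sum v lt)
  have eq: "(\<Sum>i\<in>I. f i) = f j + (\<Sum>l\<in>I - {j}. f l)"
    using I j(1) by (simp add: sum.remove[of I j] J_def)
  have "f j \<noteq> 0" using j(1) by (simp add: J_def)
  from val_add_eq[OF v this rest] sum have "k \<le> v (f j)" unfolding eq by (simp add: vge_def)
  then show ?thesis using min[of i] i False by (simp add: vge_def J_def)
qed simp

lemma derivation_simps:
  assumes D: "is_derivation D"
  shows "D (x + y) = D x + D y" "D (x * y) = D x * y + x * D y" "D 0 = 0" "D 1 = 0"
    "D (- x) = - D x" "D (x - y) = D x - D y"
    "D (x ^ n) = of_nat n * x ^ (n - 1) * D x" "D (sum f I) = (\<Sum>i\<in>I. D (f i))"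
proof -
  show add: "\<And>x y. D (x + y) = D x + D y" and mult: "\<And>x y. D (x * y) = D x * y + x * D y"
    using D by (auto simp: is_derivation_def)
  have "D 0 + D 0 = D 0 + 0" using add[of 0 0] by (simp only: add_0_right)
  then show 0: "D 0 = 0" by (simp only: add_left_cancel)
  have "D 1 + D 1 = D 1 + 0" using mult[of 1 1] by (simp only: mult_1_left mult_1_right add_0_right)
  then show 1: "D 1 = 0" by (simp only: add_left_cancel)
  show min: "D (- x) = - D x" for x
    using add[of x "- x"] 0 by (simp add: add_eq_0_iff)
  show "D (x - y) = D x - D y" using add[of x "- y"] min by simp
  show "D (x ^ n) = of_nat n * x ^ (n - 1) * D x"
  proof (induction n)
    case (Suc n)
    then show ?case by (cases n) (auto simp: mult algebra_simps)
  qed (simp add: 1)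
  show "D (sum f I) = (\<Sum>i\<in>I. D (f i))"
    by (induction I rule: infinite_finite_induct) (auto simp: 0 add)
qed

lemma derivation_divide:
  assumes D: "is_derivation D" and y: "y \<noteq> 0"
  shows "D (x / y) = (D x * y - x * D y) / y ^ 2"
proof -
  have "D x = D (x / y) * y + (x / y) * D y"
    using derivation_simps(2)[OF D, of "x / y" y] y by simp
  then show ?thesis using y by (simp add: field_simps power2_eq_square)
qed

context function_field
begin

lemma CHAR_eq: "CHAR('k) = p"
proof -
  have "CHAR('k) dvd p" using char_p of_nat_eq_0_iff_char_dvd by blast
  then have "CHAR('k) = 1 \<or> CHAR('k) = p" using prime_p prime_nat_iff by auto
  moreover have "CHAR('k) \<noteq> 1" using of_nat_CHAR[where 'a = 'k] by (metis of_nat_1 zero_neq_one)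
  ultimately show ?thesis by blast
qed

lemma p_pos: "p > 0" using prime_p by (simp add: prime_gt_0_nat)

lemma frob_add: "(x + y :: 'k) ^ p = x ^ p + y ^ p"
  using prime_p by (intro freshmans_dream) (auto simp: CHAR_eq)

lemma frob_minus: "(- x :: 'k) ^ p = - (x ^ p)"
proof -
  have "x ^ p + (- x) ^ p = 0" using frob_add[of x "- x"] p_pos by (simp add: power_0_left)
  then show ?thesis by (simp add: add_eq_0_iff2 add.commute)
qed

lemma frob_diff: "(x - y :: 'k) ^ p = x ^ p - y ^ p"
  using frob_add[of x "- y"] by (simp add: frob_minus)

lemma frob_inj: "(x :: 'k) ^ p = y ^ p \<longleftrightarrow> x = y"
  using frob_diff[of x y] p_pos by auto

lemma frob_of_nat: "(of_nat n :: 'k) ^ p = of_nat n"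
  by (induction n) (auto simp: frob_add p_pos)

lemma of_nat_eq_0_iff: "(of_nat n :: 'k) = 0 \<longleftrightarrow> p dvd n"
  using of_nat_eq_0_iff_char_dvd[of n, where 'a = 'k] by (simp add: CHAR_eq)

text \<open>The nonzero terms have values congruent to \<open>i\<close> modulo \<open>p\<close>,
  hence pairwise distinct ones.\<close>

lemma vge_p_expansion:
  fixes v :: "'k \<Rightarrow> int"
  assumes v: "v \<in> places" and u: "u \<noteq> 0" "v u = 1"
    and x: "vge v k (\<Sum>i<p. a i ^ p * u ^ i)" and i: "i < p"
  shows "vge v k (a i ^ p * u ^ i)"
proof -
  have val: "v (a i ^ p * u ^ i) = int p * v (a i) + int i" if "a i \<noteq> 0" for i
    using that u val_mult[OF v, of "a i ^ p" "u ^ i"] val_power[OF v] by simp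
  show ?thesis
  proof (rule vge_sum_distinct[OF v _ _ x])
    fix i j assume ij: "i \<in> {..<p}" "j \<in> {..<p}" "a i ^ p * u ^ i \<noteq> 0" "a j ^ p * u ^ j \<noteq> 0"
      "v (a i ^ p * u ^ i) = v (a j ^ p * u ^ j)"
    then have "a i \<noteq> 0" "a j \<noteq> 0" using p_pos by (auto simp: power_0_left)
    then have "int p * v (a i) + int i = int p * v (a j) + int j" using ij val by simp
    then have "(int p * v (a i) + int i) mod int p = (int p * v (a j) + int j) mod int p" by simp
    then show "i = j" using ij by simp
  qed (use i in auto)
qed

lemma p_expansion_zero:
  fixes v :: "'k \<Rightarrow> int"
  assumes v: "v \<in> places" and u: "u \<noteq> 0" "v u = 1"
    and x: "(\<Sum>i<p. a i ^ p * u ^ i) = 0" and i: "i < p"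
  shows "a i = 0"
proof (rule ccontr)
  assume nz: "a i \<noteq> 0"
  have "vge v (v (a i ^ p * u ^ i) + 1) (a i ^ p * u ^ i)"
    using vge_p_expansion[OF v u _ i] x by simp
  then show False using nz u by (simp add: vge_def)
qed

lemma height_pos:
  fixes v :: "'k \<Rightarrow> int"
  assumes v: "v \<in> places" "v x < 0" shows "height (x :: 'k) > 0"
proof -
  have "height x = (\<Sum>w\<in>{w \<in> places. pole_order w x \<noteq> 0}. place_degree w * of_int (pole_order w x))"
    using finite_poles by (intro height_eq) auto
  also have "\<dots> > 0"
    using finite_poles[of x] v
    by (intro sum_pos2[of _ v] mult_pos_pos mult_nonneg_nonneg)
       (auto simp: pole_order_nonneg place_degree_pos less_imp_le pole_order_def[of v])
  finally show ?thesis .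
qed

text \<open>
  The digit sets fill the Riemann spaces containing them up to a bounded factor. This makes counting
  arguments sharp.
\<close>

lemma uniformizer_digits:
  fixes v :: "'k \<Rightarrow> int"
  assumes v: "v \<in> places" and u: "u \<noteq> 0" "v u = 1"
  obtains Y where "finite Y" "\<And>m. finite (digits u Y m)"
    "\<And>m. real (card (digits u Y m)) = exp (real m * height u)" "height u > 0"
proof -
  let ?T = "{w \<in> places. w u > 0}"
  obtain Y where Y: "finite Y" "Y \<noteq> {}" "ln (real (card Y)) = (\<Sum>w\<in>?T. place_degree w * of_int (w u))"
    "\<And>m. card (digits u Y m) = card Y ^ m" "\<And>y w. y \<in> Y \<Longrightarrow> w \<in> ?T \<Longrightarrow> vge w 0 y"
    by (rule zero_digit_set[of ?T u]) (use finite_zeros[OF u(1)] u in auto)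
  have "(\<Sum>w\<in>?T. place_degree w * of_int (w u)) = (\<Sum>w\<in>?T. place_degree w * of_int (pole_order w (inverse u)))"
    by (intro sum.cong) (auto simp: pole_order_def val_inverse)
  also have "\<dots> = height (inverse u)"
    using finite_zeros[OF u(1)] by (intro height_eq[symmetric]) (auto simp: pole_order_def val_inverse)
  finally have ln: "ln (real (card Y)) = height u" using Y(3) by (simp add: height_inverse)
  have "real (card Y) = exp (height u)" using Y(1,2) unfolding ln[symmetric] by (simp add: card_gt_0_iff)
  then have "real (card (digits u Y m)) = exp (real m * height u)" for m
    unfolding Y(4) by (simp add: exp_of_nat_mult)
  moreover have "height u > 0"
    using height_pos[OF v, of "inverse u"] u v by (simp add: height_inverse val_inverse)
  ultimately show ?thesis using that finite_digits Y(1) by blast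
qed

text \<open>
  If \<open>1, u, \<dots>, u\<^sup>p\<^sup>-\<^sup>1, x\<close> were independent over \<open>K\<^sup>p\<close>, the combinations with \<open>p\<close>-th powers of digit sums as
  coefficients would be too many for the Riemann space containing them.
\<close>

lemma p_expansion_exists:
  fixes v :: "'k \<Rightarrow> int"
  assumes v: "v \<in> places" and u: "u \<noteq> 0" "v u = 1"
  shows "\<exists>a. x = (\<Sum>i<p. a i ^ p * u ^ i)"
proof (rule ccontr)
  assume no: "\<not> ?thesis"
  obtain Y where Y: "finite Y" "\<And>m. finite (digits u Y m)"
    "\<And>m. real (card (digits u Y m)) = exp (real m * height u)" "height u > 0"
    using uniformizer_digits[OF v u] by blast
  define b where "b i = (if i < p then u ^ i else x)" for i
  define f where "f a = (\<Sum>i\<le>p. a i ^ p * b i)" for a :: "nat \<Rightarrow> 'k"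
  have fsplit: "f a = (\<Sum>i<p. a i ^ p * u ^ i) + a p ^ p * x" for a
    unfolding f_def by (simp add: b_def flip: lessThan_Suc_atMost)
  have inj: "\<forall>i\<le>p. a i = c i" if "f a = f c" for a c
  proof -
    define d where "d i = a i - c i" for i
    have "f a - f c = (\<Sum>i<p. a i ^ p * u ^ i - c i ^ p * u ^ i) + (a p ^ p - c p ^ p) * x"
      unfolding fsplit sum_subtractf by (simp add: algebra_simps)
    then have z: "(\<Sum>i<p. d i ^ p * u ^ i) + d p ^ p * x = 0"
      using that by (simp add: d_def frob_diff algebra_simps)
    have dp: "d p = 0"
    proof (rule ccontr)
      assume nz: "d p \<noteq> 0"
      have "d p ^ p * x = - (\<Sum>i<p. d i ^ p * u ^ i)" using z by (simp add: add_eq_0_iff)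
      then have "x = - (\<Sum>i<p. d i ^ p * u ^ i) / d p ^ p" using nz by (simp add: field_simps)
      also have "\<dots> = (\<Sum>i<p. (- d i / d p) ^ p * u ^ i)"
        by (simp add: sum_divide_distrib sum_negf[symmetric] power_divide frob_minus)
      finally show False using no by (metis (no_types))
    qed
    then have "(\<Sum>i<p. d i ^ p * u ^ i) = 0" using z p_pos by (simp add: power_0_left)
    then have "d i = 0" if "i < p" for i using p_expansion_zero[OF v u _ that] by blast
    then show ?thesis using dp by (auto simp: d_def le_less)
  qed
  obtain S E where S: "finite S" "S \<subseteq> places" "\<And>w. w \<in> places \<Longrightarrow> w \<notin> S \<Longrightarrow> E w = 0"
    "\<And>y w. y \<in> Y \<Longrightarrow> w \<in> places \<Longrightarrow> vge w (- int (E w)) y" using finite_set_bound[OF Y(1)] by blast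
  obtain S' F where S': "finite S'" "S' \<subseteq> places" "\<And>w. w \<in> places \<Longrightarrow> w \<notin> S' \<Longrightarrow> F w = 0"
    "\<And>y w. y \<in> b ` {..p} \<Longrightarrow> w \<in> places \<Longrightarrow> vge w (- int (F w)) y"
    using finite_set_bound[of "b ` {..p}"] by blast
  obtain C where C: "C > 0" "\<And>T E. finite T \<Longrightarrow> T \<subseteq> places \<Longrightarrow> (\<And>v. v \<in> places \<Longrightarrow> v \<notin> T \<Longrightarrow> E v = 0) \<Longrightarrow>
    finite (riemann_space E :: 'k set) \<and>
    real (card (riemann_space E :: 'k set)) \<le> C * exp (\<Sum>v\<in>T. place_degree v * real (E v))"
    using riemann_space_bound v by blast
  define U where "U = S \<union> S' \<union> {w \<in> places. pole_order w u \<noteq> 0}"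
  have U: "finite U" "U \<subseteq> places" using S S' finite_poles by (auto simp: U_def)
  define d where "d = (\<Sum>w\<in>U. place_degree w * real (p * E w + F w))"
  \<comment> \<open>On the left \<open>p + 1\<close> independent digit sums. On the right the degree
    of the space: \<open>p\<close>-th powers multiply pole orders by \<open>p\<close>, and
    multiplication by the fixed \<open>b i\<close> only adds a constant.\<close>
  have "real m * (real (p + 1) * height u) \<le> real m * (real p * height u) + (ln C + d)" for m
  proof -
    define G where "G w = p * (m * nat (pole_order w u) + E w) + F w" for w :: "'k \<Rightarrow> int"
    have G: "finite (riemann_space G :: 'k set)"
      "real (card (riemann_space G :: 'k set)) \<le> C * exp (\<Sum>w\<in>U. place_degree w * real (G w))"
      using C(2)[OF U, of G] S S' by (auto simp: U_def G_def)
    have "(\<Sum>w\<in>U. place_degree w * real (G w)) = real m * (real p * (\<Sum>w\<in>U. place_degree w * of_int (pole_order w u))) + d"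
      unfolding d_def sum_distrib_left sum.distrib[symmetric]
      by (intro sum.cong) (auto simp: G_def algebra_simps pole_order_nonneg)
    also have "(\<Sum>w\<in>U. place_degree w * of_int (pole_order w u)) = height u"
      using U by (intro height_eq[symmetric]) (auto simp: U_def)
    finally have sum: "(\<Sum>w\<in>U. place_degree w * real (G w)) = real m * (real p * height u) + d" .
    have img: "f ` ({..p} \<rightarrow>\<^sub>E digits u Y m) \<subseteq> riemann_space G"
    proof
      fix z assume "z \<in> f ` ({..p} \<rightarrow>\<^sub>E digits u Y m)"
      then obtain a where a: "z = f a" "a \<in> {..p} \<rightarrow>\<^sub>E digits u Y m" by blast
      have "vge w (- int (G w)) (f a)" if w: "w \<in> places" for w
        unfolding f_def
      proof (intro vge_sum w)
        fix i assume i: "i \<in> {..p}"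
        have "a i \<in> riemann_space (\<lambda>w. m * nat (pole_order w u) + E w)"
          using digits_in_riemann_space[of Y E u m] S(4) a(2) i by (auto simp: PiE_iff)
        from riemann_spaceD[OF this w] have "vge w (int p * - int (m * nat (pole_order w u) + E w)) (a i ^ p)"
          by (intro vge_power w)
        moreover have "vge w (- int (F w)) (b i)" using S'(4) i w by blast
        ultimately have "vge w (int p * - int (m * nat (pole_order w u) + E w) + - int (F w)) (a i ^ p * b i)"
          by (intro vge_mult w)
        then show "vge w (- int (G w)) (a i ^ p * b i)" by (simp add: G_def algebra_simps)
      qed
      then show "z \<in> riemann_space G" by (simp add: riemann_space_def a(1))
    qed
    have injf: "inj_on f ({..p} \<rightarrow>\<^sub>E digits u Y m)"
    proof (rule inj_onI)
      fix a c assume ac: "a \<in> {..p} \<rightarrow>\<^sub>E digits u Y m" "c \<in> {..p} \<rightarrow>\<^sub>E digits u Y m" "f a = f c"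
      show "a = c" by (rule PiE_ext[OF ac(1,2)]) (use inj[OF ac(3)] in auto)
    qed
    have "card (digits u Y m) ^ (p + 1) = card (f ` ({..p} \<rightarrow>\<^sub>E digits u Y m))"
      using injf by (simp add: card_image card_PiE)
    also have "\<dots> \<le> card (riemann_space G :: 'k set)" using card_mono[OF G(1) img] .
    finally have "real (card (digits u Y m) ^ (p + 1)) \<le> real (card (riemann_space G :: 'k set))"
      unfolding of_nat_le_iff .
    then have "exp (real m * height u) ^ (p + 1) \<le> C * exp (real m * (real p * height u) + d)"
      using G(2) unfolding of_nat_power Y(3) sum by linarith
    moreover have "exp (real m * height u) ^ (p + 1) = exp (real m * (real (p + 1) * height u))"
      unfolding exp_of_nat_mult[symmetric] by (simp add: mult_ac)
    ultimately have "ln (exp (real m * (real (p + 1) * height u))) \<le> ln (C * exp (real m * (real p * height u) + d))"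
      using C(1) by (subst ln_le_cancel_iff) auto
    then show ?thesis using C(1) by (simp add: ln_mult)
  qed
  then have "real (p + 1) * height u \<le> real p * height u"
    by (rule le_of_nat_mult_le)
  then show False using Y(4) by (simp add: algebra_simps)
qed


text \<open>Formal differentiation with respect to \<open>u\<close> in the basis
  \<open>1, u, ..., u ^ (p - 1)\<close> over the \<open>p\<close>-th powers, which are treated as
  constants.\<close>

lemma p_basis_derivation:
  fixes v :: "'k \<Rightarrow> int"
  assumes v: "v \<in> places" and u: "u \<noteq> 0" "v u = 1"
  obtains D :: "'k \<Rightarrow> 'k" where "is_derivation D" "\<And>x. D x = 0 \<Longrightarrow> \<exists>y. x = y ^ p"
proof -
  have "\<forall>x. \<exists>a. x = (\<Sum>i<p. a i ^ p * u ^ i)" using p_expansion_exists[OF v u] by blast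
  then obtain c where c: "\<And>x. x = (\<Sum>i<p. c x i ^ p * u ^ i)" by metis
  have uniq: "c (\<Sum>i<p. a i ^ p * u ^ i) i = a i" if i: "i < p" for a i
  proof -
    let ?x = "\<Sum>i<p. a i ^ p * u ^ i"
    have "(\<Sum>i<p. (c ?x i - a i) ^ p * u ^ i) = (\<Sum>i<p. c ?x i ^ p * u ^ i) - ?x"
      unfolding sum_subtractf[symmetric] by (intro sum.cong) (auto simp: frob_diff algebra_simps)
    also have "\<dots> = 0" using c[of ?x] by simp
    finally have "c ?x i - a i = 0" by (rule p_expansion_zero[OF v u _ i])
    then show ?thesis by simp
  qed
  define D where "D x = (\<Sum>i<p. of_nat i * c x i ^ p * u ^ (i - 1))" for x
  have DI: "D (\<Sum>i<p. a i ^ p * u ^ i) = (\<Sum>i<p. of_nat i * a i ^ p * u ^ (i - 1))" for a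
    unfolding D_def by (intro sum.cong) (auto simp: uniq)
  have Dadd: "D (x + y) = D x + D y" for x y
  proof -
    have "x + y = (\<Sum>i<p. (c x i + c y i) ^ p * u ^ i)"
      by (subst (1) c, subst (3) c) (simp add: frob_add algebra_simps sum.distrib)
    then show ?thesis
      using DI[of "\<lambda>i. c x i + c y i"] by (simp add: D_def frob_add algebra_simps sum.distrib)
  qed
  have D0: "D 0 = 0" using DI[of "\<lambda>_. 0"] p_pos by (simp add: power_0_left)
  have Dsum: "D (sum f I) = (\<Sum>i\<in>I. D (f i))" for f :: "nat \<Rightarrow> 'k" and I
    by (induction I rule: infinite_finite_induct) (auto simp: D0 Dadd)
  have Dscale: "D (a ^ p * x) = a ^ p * D x" for a x
  proof -
    have "a ^ p * x = (\<Sum>i<p. (a * c x i) ^ p * u ^ i)"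
      by (subst c) (simp add: power_mult_distrib sum_distrib_left mult.assoc)
    then show ?thesis
      using DI[of "\<lambda>i. a * c x i"] by (simp add: D_def power_mult_distrib sum_distrib_left mult_ac)
  qed
  have Du: "D (u ^ k) = of_nat k * u ^ (k - 1)" if "k < p" for k
  proof -
    have "u ^ k = (\<Sum>i<p. (if i = k then 1 else 0) ^ p * u ^ i)"
      using that p_pos by (simp add: power_0_left if_distrib[of "\<lambda>x. x ^ p"] if_distrib[of "\<lambda>x. x * _"] cong: if_cong)
    then have "D (u ^ k) = (\<Sum>i<p. of_nat i * (if i = k then 1 else 0) ^ p * u ^ (i - 1))"
      using DI by metis
    also have "\<dots> = (\<Sum>i<p. if i = k then of_nat k * u ^ (k - 1) else 0)"
      using p_pos by (intro sum.cong) (auto simp: power_0_left)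
    finally show ?thesis using that by simp
  qed
  \<comment> \<open>Products of basis elements reach the exponent \<open>2 * p - 2\<close>.
    Splitting off the constant \<open>u ^ p\<close> is harmless because \<open>k - p\<close> and
    \<open>k\<close> agree in K.\<close>
  have Du2: "D (u ^ k) = of_nat k * u ^ (k - 1)" if "k < 2 * p" for k
  proof (cases "k < p")
    case False
    have "D (u ^ k) = D (u ^ p * u ^ (k - p))" using False by (simp flip: power_add)
    also have "\<dots> = u ^ p * (of_nat (k - p) * u ^ (k - p - 1))"
      using that False by (simp add: Dscale Du)
    also have "\<dots> = of_nat k * u ^ (k - 1)"
    proof (cases "k = p")
      case True then show ?thesis by (simp add: char_p)
    next
      case neq: False
      have "u ^ p * u ^ (k - p - 1) = u ^ (k - 1)" using False neq by (simp flip: power_add)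
      moreover have "(of_nat (k - p) :: 'k) = of_nat k" using False by (simp add: of_nat_diff char_p)
      ultimately show ?thesis by (simp add: mult.left_commute)
    qed
    finally show ?thesis .
  qed (use Du in auto)
  have Dmult: "D (x * y) = D x * y + x * D y" for x y
  proof -
    have pw: "of_nat (i + j) * u ^ (i + j - 1) = of_nat i * u ^ (i - 1) * u ^ j + of_nat j * u ^ (j - 1) * u ^ i" for i j
      by (cases i; cases j) (auto simp: algebra_simps power_add)
    have "x * y = (\<Sum>i<p. \<Sum>j<p. (c x i * c y j) ^ p * u ^ (i + j))"
      by (subst (1) c, subst (3) c) (simp add: sum_product power_mult_distrib power_add mult_ac)
    then have "D (x * y) = (\<Sum>i<p. \<Sum>j<p. (c x i * c y j) ^ p * (of_nat (i + j) * u ^ (i + j - 1)))"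
      by (simp add: Dsum Dscale Du2)
    also have "\<dots> = (\<Sum>i<p. \<Sum>j<p. (of_nat i * c x i ^ p * u ^ (i - 1)) * (c y j ^ p * u ^ j))
        + (\<Sum>i<p. \<Sum>j<p. (c x i ^ p * u ^ i) * (of_nat j * c y j ^ p * u ^ (j - 1)))"
      unfolding pw sum.distrib[symmetric]
      by (intro sum.cong refl) (simp add: power_mult_distrib algebra_simps)
    also have "\<dots> = D x * (\<Sum>j<p. c y j ^ p * u ^ j) + (\<Sum>i<p. c x i ^ p * u ^ i) * D y"
      by (simp add: D_def sum_product)
    finally show ?thesis using c by metis
  qed
  have "\<exists>y. x = y ^ p" if "D x = 0" for x
  proof -
    \<comment> \<open>Multiplication by \<open>u\<close> restores basis form. The coefficients are
      \<open>p\<close>-th powers because natural numbers are their own \<open>p\<close>-th powers in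
      K.\<close>
    have "(\<Sum>i<p. (of_nat i * c x i) ^ p * u ^ i) = D x * u"
      unfolding D_def sum_distrib_right
    proof (intro sum.cong refl)
      fix i show "(of_nat i * c x i) ^ p * u ^ i = of_nat i * c x i ^ p * u ^ (i - 1) * u"
        by (cases i) (simp_all add: power_mult_distrib frob_of_nat p_pos del: of_nat_Suc)
    qed
    then have z: "(\<Sum>i<p. (of_nat i * c x i) ^ p * u ^ i) = 0" using that by simp
    have "c x i = 0" if "0 < i" "i < p" for i
    proof -
      have "of_nat i * c x i = 0" by (rule p_expansion_zero[OF v u z that(2)])
      moreover have "\<not> p dvd i" using that by (auto dest: dvd_imp_le)
      ultimately show ?thesis by (simp add: of_nat_eq_0_iff)
    qed
    then have "(\<Sum>i<p. c x i ^ p * u ^ i) = (\<Sum>i\<in>{0}. c x i ^ p * u ^ i)"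
      using p_pos by (intro sum.mono_neutral_right) (auto simp: power_0_left)
    then have "x = c x 0 ^ p" using c[of x] by simp
    then show ?thesis by blast
  qed
  moreover have "is_derivation D" using Dadd Dmult by (simp add: is_derivation_def)
  ultimately show ?thesis using that by blast
qed

section \<open>Poles created by a derivation\<close>

text \<open>Differentiation is termwise on the \<open>p\<close>-expansion, where no cancellation
  hides poles. In general one order is lost besides the pole of \<open>D u\<close>. For integral
  \<open>x\<close> it is not: \<open>0 \<le> p * v (a i) + i\<close> with \<open>i < p\<close> makes
  the \<open>a i\<close> themselves integral.\<close>

lemma derivation_expansion:
  fixes v :: "'k \<Rightarrow> int"
  assumes D: "is_derivation D" and v: "v \<in> places" and u: "u \<noteq> 0" "v u = 1"
  shows "vge v k x \<Longrightarrow> vge v (- d) (D u) \<Longrightarrow> vge v (k - 1 - d) (D x)"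
    "vge v 0 x \<Longrightarrow> vge v (- d) (D u) \<Longrightarrow> vge v (- d) (D x)"
proof -
  obtain a where a: "x = (\<Sum>i<p. a i ^ p * u ^ i)" using p_expansion_exists[OF v u] by blast
  have Dx: "D x = (\<Sum>i<p. a i ^ p * (of_nat i * u ^ (i - 1)) * D u)"
    unfolding a derivation_simps(8)[OF D]
    by (intro sum.cong refl) (simp add: derivation_simps(2,7)[OF D] char_p mult_ac)
  show "vge v (k - 1 - d) (D x)" if k: "vge v k x" and d: "vge v (- d) (D u)"
    unfolding Dx
  proof (intro vge_sum v)
    fix i assume i: "i \<in> {..<p}"
    show "vge v (k - 1 - d) (a i ^ p * (of_nat i * u ^ (i - 1)) * D u)"
    proof (cases i)
      case (Suc j)
      have "vge v k (a i ^ p * u ^ i)" using vge_p_expansion[OF v u k[unfolded a]] i by simp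
      then have "vge v (v u + (k - 1)) (u * (a i ^ p * u ^ j))" using u Suc by (simp add: mult_ac)
      then have "vge v (k - 1) (a i ^ p * u ^ j)" using vge_cancel_mult[OF v u(1)] by blast
      then have "vge v (k - 1 + 0 + - d) (a i ^ p * u ^ j * of_nat i * D u)"
        by (intro vge_mult v vge_of_nat d)
      then show ?thesis using Suc by (simp add: mult_ac)
    qed simp
  qed
  show "vge v (- d) (D x)" if k: "vge v 0 x" and d: "vge v (- d) (D u)"
    unfolding Dx
  proof (intro vge_sum v)
    fix i assume i: "i \<in> {..<p}"
    show "vge v (- d) (a i ^ p * (of_nat i * u ^ (i - 1)) * D u)"
    proof (cases "a i = 0")
      case False
      have "vge v 0 (a i ^ p * u ^ i)" using vge_p_expansion[OF v u k[unfolded a]] i by simp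
      then have "0 \<le> int p * v (a i) + int i"
        using False u val_mult[OF v, of "a i ^ p" "u ^ i"] by (simp add: vge_def val_power[OF v])
      then have "v (a i) \<ge> 0"
      proof (rule contrapos_pp)
        assume "\<not> v (a i) \<ge> 0"
        then have "int p * v (a i) \<le> int p * (-1)" by (intro mult_left_mono) auto
        then show "\<not> 0 \<le> int p * v (a i) + int i" using i by auto
      qed
      then have "vge v 0 (a i)" by (simp add: vge_def)
      moreover have "vge v 0 u" using u by (simp add: vge_def)
      ultimately have "vge v (0 + (0 + 0) + - d) (a i ^ p * (of_nat i * u ^ (i - 1)) * D u)"
        by (intro vge_mult v vge_of_nat d vge_power0)
      then show ?thesis by simp
    qed (use p_pos in \<open>simp add: power_0_left\<close>)
  qed
qed

text \<open>A simple zero \<open>y\<close> would be a uniformizer with integral derivative, and then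
  \<open>D\<close> would preserve integrality at \<open>v\<close>, so that \<open>v\<close> would
  not be bad.\<close>

lemma derivation_double_zero:
  fixes v :: "'k \<Rightarrow> int"
  assumes D: "is_derivation D" and v: "v \<in> places"
    and bad: "vge v 0 x" "\<not> vge v 0 (D x)" and y: "vge v 1 y" "vge v 0 (D y)"
  shows "vge v 2 y"
proof (rule ccontr)
  assume "\<not> vge v 2 y"
  then have "y \<noteq> 0" "v y = 1" using y by (auto simp: vge_def)
  from derivation_expansion(2)[OF D v this bad(1), of 0] y bad show False by simp
qed

text \<open>
  At a bad place outside a fixed finite set, digit sums with the same residue differ by a double zero.
  By the pigeonhole principle some nonzero difference has more zeros than poles if the bad places have
  large total degree.
\<close>

lemma finite_bad_places:
  assumes D: "is_derivation (D :: 'k \<Rightarrow> 'k)"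
  shows "finite {v \<in> places. \<exists>x. vge v 0 x \<and> \<not> vge v 0 (D x)}" (is "finite ?B")
proof (rule ccontr)
  assume inf: "infinite ?B"
  then obtain v0 where v0: "v0 \<in> (places :: ('k \<Rightarrow> int) set)" using not_finite_existsD by blast
  obtain u where u: "u \<noteq> 0" "v0 u = 1" using uniformizer_exists[OF v0] by blast
  obtain Y where Y: "finite Y" "\<And>m. finite (digits u Y m)"
    "\<And>m. real (card (digits u Y m)) = exp (real m * height u)" "height u > 0"
    using uniformizer_digits[OF v0 u] by blast
  let ?F = "Y \<union> {u, D u} \<union> D ` Y"
  have "finite ?F" using Y(1) by simp
  then obtain S E where S: "finite S" "S \<subseteq> places" "\<And>w. w \<in> places \<Longrightarrow> w \<notin> S \<Longrightarrow> E w = 0"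
    "\<And>y w. y \<in> ?F \<Longrightarrow> w \<in> places \<Longrightarrow> vge w (- int (E w)) y"
    by (rule finite_set_bound) (rule that, assumption+)
  define d where "d = (\<Sum>w\<in>S. place_degree w * real (E w))"
  have int: "vge w 0 z \<and> vge w 0 (D z)" if "w \<in> places" "w \<notin> S" "z \<in> digits u Y m" for w z m
    using that(3)
  proof (induction m arbitrary: z)
    case 0 then show ?case by (simp add: derivation_simps(3)[OF D])
  next
    case (Suc m)
    then obtain y s where z: "z = y + u * s" "y \<in> Y" "s \<in> digits u Y m" by auto
    have F: "vge w 0 x" if "x \<in> ?F" for x using S(3)[of w] S(4)[OF that] \<open>w \<in> places\<close> \<open>w \<notin> S\<close> by force
    have m0: "vge w 0 (a * b)" if "vge w 0 a" "vge w 0 b" for a b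
      using vge_mult0[OF \<open>w \<in> places\<close>] that by blast
    have s: "vge w 0 s" "vge w 0 (D s)" using Suc.IH[OF z(3)] by auto
    have "vge w 0 y" "vge w 0 u" "vge w 0 (D y)" "vge w 0 (D u)" using F z(2) by auto
    then show ?case unfolding z(1) derivation_simps(1,2)[OF D]
      using s by (intro conjI vge_add m0 \<open>w \<in> places\<close>)
  qed
  have "infinite (?B - S)" using inf S(1) by simp
  obtain N :: nat where N: "height u + d < real N * ln 2"
    using reals_Archimedean3[of "ln 2 :: real"] by auto
  obtain B where B: "finite B" "card B = N" "B \<subseteq> ?B - S"
    using infinite_arbitrarily_large[OF \<open>infinite (?B - S)\<close>] by blast
  have Bp: "B \<subseteq> places" using B(3) by blast
  define b where "b = (\<Sum>w\<in>B. place_degree w)"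
  have "(\<Sum>w\<in>B. ln 2) \<le> b" unfolding b_def using Bp by (intro sum_mono place_degree_ge) auto
  then have b: "height u + d < b" using N B(2) by simp
  \<comment> \<open>This gives \<open>b < m * height u \<le> b + height u\<close>: more digit sums
    than the \<open>exp b\<close> residue vectors on \<open>B\<close>, while the degree
    \<open>m * height u + d\<close> of the poles stays below the degree \<open>2 * b\<close> of the
    double zeros.\<close>
  define m where "m = nat \<lfloor>b / height u\<rfloor> + 1"
  have d0: "d \<ge> 0" unfolding d_def using S(2)
    by (intro sum_nonneg mult_nonneg_nonneg) (auto simp: place_degree_pos less_imp_le)
  have "b / height u \<ge> 0" using b Y(4) d0 by simp
  then have "real m = of_int \<lfloor>b / height u\<rfloor> + 1" by (simp add: m_def)
  then have "b / height u < real m" "real m \<le> b / height u + 1" by linarith+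
  then have m: "b < real m * height u" "real m * height u \<le> b + height u"
    using Y(4) by (simp_all add: field_simps)
  define g where "g z = restrict (\<lambda>w. residue w z) B" for z :: 'k
  have "g ` digits u Y m \<subseteq> Pi\<^sub>E B reps"
    using residue(1) int B by (fastforce simp: g_def)
  moreover have "finite (Pi\<^sub>E B reps)" using B reps(1) by (intro finite_PiE) auto
  moreover have "card (Pi\<^sub>E B reps) < card (digits u Y m)"
  proof -
    have "real (card (Pi\<^sub>E B reps)) = (\<Prod>w\<in>B. exp (place_degree w))"
      using B Bp by (auto simp: card_PiE exp_place_degree intro!: prod.cong)
    also have "\<dots> = exp b" unfolding b_def using B by (simp add: exp_sum)
    also have "\<dots> < real (card (digits u Y m))" unfolding Y(3) using m by simp
    finally show ?thesis by simp
  qed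
  ultimately have "\<not> inj_on g (digits u Y m)"
    by (metis card_mono card_image not_le)
  then obtain s t where st: "s \<in> digits u Y m" "t \<in> digits u Y m" "s \<noteq> t" "g s = g t"
    by (auto simp: inj_on_def)
  have dz: "vge w 2 (s - t)" if w: "w \<in> B" for w
  proof -
    have wp: "w \<in> places" "w \<notin> S" using B w by auto
    obtain x where x: "vge w 0 x" "\<not> vge w 0 (D x)" using B w by auto
    have "residue w s = residue w t" using st(4) w by (metis g_def restrict_apply')
    then have "vge w 1 (s - t)" using residue_eqD[OF wp(1)] int[OF wp] st by blast
    moreover have "vge w 0 (D (s - t))"
      unfolding derivation_simps(6)[OF D] using int[OF wp] st by (intro vge_diff wp) auto
    ultimately show ?thesis using derivation_double_zero[OF D wp(1) x] by blast
  qed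
  define c where "c w = int m * pole_order w u + int (E w) - (if w \<in> B then 2 else 0)" for w
  define T where "T = B \<union> S \<union> {w \<in> places. pole_order w u \<noteq> 0}"
  have T: "finite T" "T \<subseteq> places" using B S Bp finite_poles by (auto simp: T_def)
  have c0: "c w = 0" if "w \<in> places" "w \<notin> T" for w
    using that S(3) by (auto simp: c_def T_def)
  have "height (0 :: 'k) \<le> divisor_degree c + of_int 0 * height (0 :: 'k)"
  proof (rule height_le_of_val_ge)
    show "s - t \<noteq> 0" using st by simp
    show "finite {v \<in> places. c v \<noteq> 0}" using c0 by (intro finite_subset[OF _ T(1)]) blast
    fix w :: "'k \<Rightarrow> int" assume w: "w \<in> places"
    have "- c w \<le> w (s - t)"
    proof (cases "w \<in> B")
      case True
      then have "E w = 0" using S(3) B w by auto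
      moreover have "2 \<le> w (s - t)" using dz[OF True] st by (simp add: vge_def)
      moreover have "pole_order w u = 0"
      proof -
        have "vge w (- 0) u" using S(4)[of u w] w \<open>E w = 0\<close> by simp
        from pole_order_le[OF w this] pole_order_nonneg[of w u] show ?thesis by simp
      qed
      ultimately show ?thesis using True by (simp add: c_def)
    next
      case False
      have "digits u Y m \<subseteq> riemann_space (\<lambda>w. m * nat (pole_order w u) + E w)"
        using S(4) by (intro digits_in_riemann_space) blast
      then have "vge w (- int (m * nat (pole_order w u) + E w)) (s - t)"
        using st riemann_spaceD[OF _ w] by (intro vge_diff w) blast+
      then show ?thesis using st False by (simp add: vge_def c_def pole_order_nonneg)
    qed
    then show "- c w - 0 * pole_order w 0 + pole_order w 0 \<le> w (s - t)"
      by (simp add: pole_order_def val_zero[OF w])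
  qed
  moreover have "divisor_degree c = (\<Sum>w\<in>T. place_degree w * of_int (c w))"
    using T c0 by (intro divisor_degree_eq)
  moreover have "\<dots> = real m * (\<Sum>w\<in>T. place_degree w * of_int (pole_order w u)) +
    (\<Sum>w\<in>T. place_degree w * real (E w)) - 2 * (\<Sum>w\<in>T. if w \<in> B then place_degree w else 0)"
    unfolding sum_distrib_left sum.distrib[symmetric] sum_subtractf[symmetric]
    by (intro sum.cong) (auto simp: c_def algebra_simps)
  moreover have "(\<Sum>w\<in>T. place_degree w * of_int (pole_order w u)) = height u"
    using T by (intro height_eq[symmetric]) (auto simp: T_def)
  moreover have "(\<Sum>w\<in>T. place_degree w * real (E w)) = d"
    unfolding d_def using T S(3) by (intro sum.mono_neutral_right) (auto simp: T_def)
  moreover have "(\<Sum>w\<in>T. if w \<in> B then place_degree w else 0) = b"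
  proof -
    have "(\<Sum>w\<in>T. if w \<in> B then place_degree w else 0) = (\<Sum>w\<in>T \<inter> B. place_degree w)"
      using T by (simp add: sum.inter_restrict)
    also have "T \<inter> B = B" by (auto simp: T_def)
    finally show ?thesis by (simp add: b_def)
  qed
  ultimately have "height (0 :: 'k) \<le> real m * height u + d - 2 * b" by simp
  then show False using height_nonneg[of "0 :: 'k"] m b by linarith
qed

text \<open>\<open>d v\<close> is the pole order of the derivative of a uniformizer at bad places
  and 0 elsewhere, so its support is finite by \<open>finite_bad_places\<close>.\<close>

lemma derivation_bound:
  assumes D: "is_derivation (D :: 'k \<Rightarrow> 'k)"
  obtains d where "finite {v \<in> places. d v \<noteq> 0}" "\<And>v. 0 \<le> d v"
    "\<And>v k x. v \<in> places \<Longrightarrow> vge v k x \<Longrightarrow> vge v (k - 1 - d v) (D x)"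
    "\<And>v x. v \<in> places \<Longrightarrow> vge v 0 x \<Longrightarrow> vge v (- d v) (D x)"
proof -
  have "\<forall>v\<in>places. \<exists>u :: 'k. u \<noteq> 0 \<and> v u = 1" using uniformizer_exists by metis
  then obtain u where u: "\<And>v. v \<in> places \<Longrightarrow> (u v :: 'k) \<noteq> 0" "\<And>v. v \<in> places \<Longrightarrow> v (u v) = 1" by metis
  define d where "d v = (if \<exists>x. vge v 0 x \<and> \<not> vge v 0 (D x) then pole_order v (D (u v)) else 0)" for v
  have d: "vge v (- d v) (D (u v))" if v: "v \<in> places" for v
  proof (cases "\<exists>x. vge v 0 x \<and> \<not> vge v 0 (D x)")
    case True then show ?thesis using vge_pole_order by (simp add: d_def)
  next
    case False
    have "vge v 0 (u v)" using u[OF v] by (simp add: vge_def)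
    then have "vge v 0 (D (u v))" using False by blast
    moreover have "d v = 0" unfolding d_def by (rule if_not_P[OF False])
    ultimately show ?thesis by simp
  qed
  show ?thesis
  proof (rule that)
    show "finite {v \<in> places. d v \<noteq> 0}"
      by (rule finite_subset[OF _ finite_bad_places[OF D]]) (auto simp: d_def split: if_splits)
    show "0 \<le> d v" for v by (simp add: d_def pole_order_nonneg)
    show "vge v (k - 1 - d v) (D x)" if "v \<in> places" "vge v k x" for v k x
      using derivation_expansion(1)[OF D that(1) u[OF that(1)] that(2) d[OF that(1)]] .
    show "vge v (- d v) (D x)" if "v \<in> places" "vge v 0 x" for v x
      using derivation_expansion(2)[OF D that(1) u[OF that(1)] that(2) d[OF that(1)]] .
  qed
qed

end

subsection \<open>The one-step lemma\<close>

lemma derivation_poly: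
  fixes f :: "'a::field poly"
  assumes D: "is_derivation D"
  shows "D (poly f z) = poly (map_poly D f) z + poly (pderiv f) z * D z"
proof (induction f)
  case 0
  then show ?case by (simp add: derivation_simps(3)[OF D])
next
  case (pCons a f)
  have "map_poly D (pCons a f) = pCons (D a) (map_poly D f)"
    by (intro poly_eqI) (auto simp: coeff_map_poly derivation_simps(3)[OF D] coeff_pCons split: nat.split)
  then show ?case
    by (simp add: derivation_simps(1,2)[OF D] pCons.IH pderiv_pCons algebra_simps)
qed

text \<open>If \<open>D e = \<alpha> * e\<close> and \<open>D e' = u * e'\<close> with
  \<open>e'\<close> nonzero, this says that all coefficients of f(e X) / e' are constants of
  \<open>D\<close>.\<close>

definition twisted_constant :: "('a::field \<Rightarrow> 'a) \<Rightarrow> 'a poly \<Rightarrow> 'a \<Rightarrow> 'a \<Rightarrow> bool" where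
  "twisted_constant D f u \<alpha> \<longleftrightarrow> (\<forall>j. D (Polynomial.coeff f j) = (u - of_nat j * \<alpha>) * Polynomial.coeff f j)"

text \<open>
  Solutions of \<open>z' = \<alpha> z\<close> are mapped by \<open>f\<close> to solutions of \<open>y' = u y\<close> when the coefficients of the
  defect polynomial vanish.
\<close>

definition defect :: "('a::field \<Rightarrow> 'a) \<Rightarrow> 'a poly \<Rightarrow> 'a \<Rightarrow> 'a \<Rightarrow> 'a poly" where
  "defect D f u \<alpha> = smult u f - map_poly D f - smult \<alpha> (pCons 0 (pderiv f))"

lemma coeff_defect:
  assumes D: "is_derivation D"
  shows "Polynomial.coeff (defect D f u \<alpha>) j =
    (u - of_nat j * \<alpha>) * Polynomial.coeff f j - D (Polynomial.coeff f j)"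
  by (cases j) (auto simp: defect_def coeff_map_poly derivation_simps(3)[OF D] coeff_pCons coeff_pderiv
      algebra_simps)

lemma twisted_constant_iff_defect:
  assumes D: "is_derivation D"
  shows "twisted_constant D f u \<alpha> \<longleftrightarrow> defect D f u \<alpha> = 0"
  by (auto simp: twisted_constant_def poly_eq_iff coeff_defect[OF D])

lemma defect_identity:
  assumes D: "is_derivation D" and eq: "D (poly f z) = u * poly f z"
  shows "poly (pderiv f) z * (D z - \<alpha> * z) = poly (defect D f u \<alpha>) z"
  using eq unfolding derivation_poly[OF D] by (simp add: defect_def algebra_simps)

lemma vge_poly:
  assumes v: "v \<in> places" and q: "\<And>j. vge v k (Polynomial.coeff q j)" "Polynomial.degree q \<le> n"
    and z: "vge v (- P) z" "P \<ge> 0"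
  shows "vge v (k - int n * P) (poly q z)"
  unfolding poly_altdef
proof (intro vge_sum v)
  fix j assume "j \<in> {..Polynomial.degree q}"
  then have "int j * P \<le> int n * P" using q z by (intro mult_right_mono) auto
  moreover have "vge v (k + int j * (- P)) (Polynomial.coeff q j * z ^ j)"
    by (intro vge_mult vge_power v q z)
  ultimately show "vge v (k - int n * P) (Polynomial.coeff q j * z ^ j)"
    by (elim vge_mono) simp
qed

context function_field
begin

text \<open>The defect \<open>r\<close> has degree at most \<open>n - 2\<close>: a suitable \<alpha>
  kills its top coefficient, centring kills the next. Since \<open>pderiv f\<close> has degree
  \<open>n - 1\<close>, the quotient \<open>s = D z - \<alpha> * z\<close> vanishes at the large
  poles of \<open>z\<close> up to bounded errors and \<open>u\<close>. A large height of
  \<open>z\<close> therefore forces \<open>s = 0\<close>, and then \<open>r = 0\<close>.\<close>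

lemma one_step:
  fixes f :: "'k poly"
  assumes D: "is_derivation (D :: 'k \<Rightarrow> 'k)"
    and deg: "Polynomial.degree f \<ge> 2" "(of_nat (Polynomial.degree f) :: 'k) \<noteq> 0"
    and centred: "Polynomial.coeff f (Polynomial.degree f - 1) = 0"
  shows "\<exists>C. \<forall>z u. D (poly f z) = u * poly f z \<longrightarrow> C + height u < height z \<longrightarrow>
    (\<exists>\<alpha>. D z = \<alpha> * z \<and> twisted_constant D f u \<alpha>)"
proof -
  define n where "n = Polynomial.degree f"
  define l where "l = Polynomial.lead_coeff f"
  have l: "l \<noteq> 0" using deg(1) by (auto simp: l_def)
  have n0: "(of_nat n :: 'k) \<noteq> 0" "n \<ge> 2" using deg by (simp_all add: n_def)
  obtain d where d: "finite {v \<in> places. d v \<noteq> 0}" "\<And>v. 0 \<le> d v"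
    "\<And>v k x. v \<in> places \<Longrightarrow> vge v k x \<Longrightarrow> vge v (k - 1 - d v) (D x)"
    "\<And>v x. v \<in> places \<Longrightarrow> vge v 0 x \<Longrightarrow> vge v (- d v) (D x)"
    using derivation_bound[OF D] by blast
  let ?A = "Polynomial.coeff f"
  define F where "F = ?A ` {..n} \<union> (\<lambda>j. D (?A j)) ` {..n} \<union>
    {inverse (of_nat n), D l / (of_nat n * l), inverse (of_nat n * l)}"
  have "finite F" by (simp add: F_def)
  then obtain S E where S: "finite S" "S \<subseteq> places" "\<And>w. w \<in> places \<Longrightarrow> w \<notin> S \<Longrightarrow> E w = 0"
    "\<And>y w. y \<in> F \<Longrightarrow> w \<in> places \<Longrightarrow> vge w (- int (E w)) y"
    by (rule finite_set_bound) (rule that, assumption+)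
  define c where "c v = int (E v) + d v" for v
  have c0: "c v \<ge> 0" for v using d(2) by (simp add: c_def)
  have cF: "vge v (- c v) y" if "y \<in> F" "v \<in> places" for y v
    using S(4)[OF that] by (rule vge_mono) (simp add: c_def d(2))
  have cA: "vge v (- c v) (?A j)" "vge v (- c v) (D (?A j))" if v: "v \<in> places" for v j
  proof -
    have "vge v (- c v) (?A j) \<and> vge v (- c v) (D (?A j))"
    proof (cases "j \<le> n")
      case True
      then show ?thesis using cF[OF _ v] by (auto simp: F_def)
    next
      case False
      then have "?A j = 0" by (intro coeff_eq_0) (simp add: n_def)
      then show ?thesis by (simp add: derivation_simps(3)[OF D])
    qed
    then show "vge v (- c v) (?A j)" "vge v (- c v) (D (?A j))" by blast+
  qed
  have "\<exists>\<alpha>. D z = \<alpha> * z \<and> twisted_constant D f u \<alpha>"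
    if eq: "D (poly f z) = u * poly f z" and h: "divisor_degree (\<lambda>v. 7 * c v) + height u < height z" for z u
  proof -
    \<comment> \<open>The value for which the coefficient \<open>n\<close> of the defect vanishes,
      namely u - n \<alpha> = D l / l.\<close>
    define \<alpha> where "\<alpha> = u * inverse (of_nat n) - D l / (of_nat n * l)"
    define r where "r = defect D f u \<alpha>"
    define s where "s = D z - \<alpha> * z"
    have sr: "poly (pderiv f) z * s = poly r z"
      unfolding s_def r_def by (rule defect_identity[OF D eq])
    have r: "Polynomial.coeff r j = (u - of_nat j * \<alpha>) * ?A j - D (?A j)" for j
      unfolding r_def by (rule coeff_defect[OF D])
    have "Polynomial.coeff r n = 0"
      unfolding r \<alpha>_def using l n0 by (simp add: l_def n_def field_simps)
    moreover have "Polynomial.coeff r (n - 1) = 0"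
      unfolding r using centred by (simp add: n_def derivation_simps(3)[OF D])
    moreover have "Polynomial.coeff r j = 0" if "j > n" for j
      unfolding r using that by (simp add: n_def coeff_eq_0 derivation_simps(3)[OF D])
    ultimately have r0: "Polynomial.coeff r j = 0" if "j > n - 2" for j
      using that n0 by (cases "j > n"; cases "j = n"; cases "j = n - 1") auto
    then have degr: "Polynomial.degree r \<le> n - 2" by (intro degree_le) auto
    have bound_imp: False if x: "x \<noteq> 0"
      "\<And>v. v \<in> places \<Longrightarrow> vge v (- 7 * c v - pole_order v u + pole_order v z) x" for x
    proof -
      have "height z \<le> divisor_degree (\<lambda>v. 7 * c v) + of_int 1 * height u"
      proof (rule height_le_of_val_ge[OF x(1)])
        show "finite {v \<in> places. 7 * c v \<noteq> 0}"
          by (rule finite_subset[of _ "S \<union> {v \<in> places. d v \<noteq> 0}"]) (use S d(1) in \<open>auto simp: c_def\<close>)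
        show "- (7 * c v) - 1 * pole_order v u + pole_order v z \<le> v x" if "v \<in> places" for v
          using x(2)[OF that] x(1) by (simp add: vge_def)
      qed
      then show False using h by simp
    qed
    have al: "vge v (- pole_order v u - c v) \<alpha>" if v: "v \<in> places" for v
      unfolding \<alpha>_def
    proof (rule vge_diff[OF v])
      have "vge v (- pole_order v u + - c v) (u * inverse (of_nat n))"
        by (intro vge_mult v vge_pole_order cF) (auto simp: F_def)
      then show "vge v (- pole_order v u - c v) (u * inverse (of_nat n))" by simp
      have "vge v (- c v) (D l / (of_nat n * l))" by (intro cF v) (auto simp: F_def)
      then show "vge v (- pole_order v u - c v) (D l / (of_nat n * l))"
        by (rule vge_mono) (simp add: pole_order_nonneg)
    qed
    have rb: "vge v (- pole_order v u - 2 * c v) (Polynomial.coeff r j)" if v: "v \<in> places" for v j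
      unfolding r
    proof (rule vge_diff[OF v])
      have "vge v (- pole_order v u - c v) (u - of_nat j * \<alpha>)"
      proof (rule vge_diff[OF v])
        show "vge v (- pole_order v u - c v) u"
          using vge_pole_order by (rule vge_mono) (simp add: c0)
        show "vge v (- pole_order v u - c v) (of_nat j * \<alpha>)"
          using vge_mult[OF v vge_of_nat[OF v, of j] al[OF v]] by simp
      qed
      from vge_mult[OF v this cA(1)[OF v, of j]]
      show "vge v (- pole_order v u - 2 * c v) ((u - of_nat j * \<alpha>) * ?A j)" by (simp add: algebra_simps)
      show "vge v (- pole_order v u - 2 * c v) (D (?A j))"
        using cA(2)[OF v, of j] by (rule vge_mono) (use c0[of v] pole_order_nonneg[of v u] in linarith)
    qed
    have s0: "s = 0"
    proof (rule ccontr)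
      assume s: "s \<noteq> 0"
      show False
      proof (rule bound_imp[OF s])
        fix v :: "'k \<Rightarrow> int" assume v: "v \<in> places"
        define P where "P = pole_order v z"
        define U where "U = pole_order v u"
        have PU: "P \<ge> 0" "U \<ge> 0" "vge v (- P) z" using vge_pole_order by (auto simp: P_def U_def pole_order_nonneg)
        note cv = c0[of v]
        show "vge v (- 7 * c v - pole_order v u + pole_order v z) s"
        \<comment> \<open>At a small pole \<open>s\<close> is bounded below by
          \<open>- 5 * c v - U\<close> directly, and \<open>P \<le> 2 * c v\<close> raises the
          constant to 7. At a larger pole the leading term \<open>t\<close> dominates
          \<open>poly (pderiv f) z\<close>, and dividing by it gains \<open>n - 1\<close> powers of
          the pole against the \<open>n - 2\<close> of \<open>r\<close>.\<close>
        proof (cases "P \<le> 2 * c v")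
          case True
          have "vge v (- 5 * c v - U) (D z)"
          proof (cases "P = 0")
            case True
            then have "vge v (- d v) (D z)" using d(4)[OF v] PU by simp
            then show ?thesis by (rule vge_mono) (use cv PU d(2)[of v] in \<open>simp add: c_def\<close>)
          next
            case False
            have "vge v (- P - 1 - d v) (D z)" by (intro d(3) v PU)
            then show ?thesis
              by (rule vge_mono) (use cv PU d(2)[of v] False \<open>P \<le> 2 * c v\<close> in \<open>simp add: c_def\<close>)
          qed
          moreover have "vge v (- 5 * c v - U) (\<alpha> * z)"
            using vge_mult[OF v al[OF v] PU(3)]
            by (rule vge_mono) (use cv PU True in \<open>simp add: U_def\<close>)
          ultimately have "vge v (- 5 * c v - U) s" unfolding s_def by (intro vge_diff v)
          then show ?thesis by (rule vge_mono) (use cv PU True in \<open>simp add: U_def P_def\<close>)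
        next
          case False
          then have "P > 0" using cv by simp
          then have z: "z \<noteq> 0" "v z = - P" using val_zero[OF v] by (auto simp: P_def pole_order_def)
          define t where "t = of_nat n * l * z ^ (n - 1)"
          define g where "g = pderiv f - Polynomial.monom (of_nat n * l) (n - 1)"
          have nl: "of_nat n * l \<noteq> 0" using n0 l by simp
          have "vge v (- c v) (inverse (of_nat n * l))" by (intro cF v) (auto simp: F_def)
          then have vnl: "v (of_nat n * l) \<le> c v" using nl by (simp add: vge_def val_inverse[OF v] del: inverse_mult_distrib)
          have t: "t \<noteq> 0" "v t = v (of_nat n * l) - int (n - 1) * P"
            using nl z val_mult[OF v nl, of "z ^ (n - 1)"] by (auto simp: t_def val_power[OF v])
          have g: "Polynomial.coeff g j = (if j > n - 2 then 0 else of_nat (Suc j) * ?A (Suc j))" for j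
          proof -
            consider "j < n - 1" | "j = n - 1" | "j > n - 1" by linarith
            then show ?thesis
            proof cases
              case 2
              then show ?thesis using n0 by (simp add: g_def coeff_pderiv l_def n_def del: of_nat_Suc)
            next
              case 3
              then have "?A (Suc j) = 0" by (intro coeff_eq_0) (simp add: n_def)
              then show ?thesis using 3 by (simp add: g_def coeff_pderiv)
            qed (use n0 in \<open>auto simp: g_def coeff_pderiv simp del: of_nat_Suc\<close>)
          qed
          have "vge v (- c v - int (n - 2) * P) (poly g z)"
          proof (rule vge_poly[OF v _ _ PU(3,1)])
            show "vge v (- c v) (Polynomial.coeff g j)" for j
              using vge_mult[OF v vge_of_nat[OF v, of "Suc j"] cA(1)[OF v, of "Suc j"]]
              unfolding g by (auto simp del: of_nat_Suc)
            show "Polynomial.degree g \<le> n - 2" using g by (intro degree_le) auto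
          qed
          moreover have nP: "int (n - 1) * P = int (n - 2) * P + P"
          proof -
            have "int (n - 1) = int (n - 2) + 1" using n0 by simp
            then show ?thesis by (simp add: algebra_simps)
          qed
          ultimately have gt: "vge v (v t + 1) (poly g z)"
            using vnl False by (elim vge_mono) (simp add: t)
          have "poly (pderiv f) z = t + poly g z"
            by (simp add: g_def t_def poly_monom)
          with val_add_eq[OF v t(1) gt]
          have fp: "poly (pderiv f) z \<noteq> 0" "v (poly (pderiv f) z) = v t" by simp_all
          have "vge v (- U - 2 * c v - int (n - 2) * P) (poly r z)"
            using rb[OF v] degr by (intro vge_poly v PU) (auto simp: U_def)
          then have "- U - 2 * c v - int (n - 2) * P \<le> v t + v s"
            unfolding sr[symmetric] using fp s val_mult[OF v fp(1) s] by (simp add: vge_def)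
          then show ?thesis using vnl nP t(2) cv by (simp add: vge_def U_def P_def)
        qed
      qed
    qed
    \<comment> \<open>Now \<open>z\<close> is a root of \<open>r\<close>. If \<open>r\<close> were
      nonzero, its leading term at \<open>z\<close> would be cancelled by lower terms, so the
      leading coefficient would vanish at the poles of \<open>z\<close> up to bounded errors and
      \<open>u\<close>, again against the height of \<open>z\<close>.\<close>
    have "r = 0"
    proof (rule ccontr)
      assume r: "r \<noteq> 0"
      define m where "m = Polynomial.degree r"
      define q where "q = r - Polynomial.monom (Polynomial.lead_coeff r) m"
      have q: "Polynomial.coeff q j = (if j \<ge> m then 0 else Polynomial.coeff r j)" for j
        by (cases "j = m") (auto simp: q_def m_def coeff_eq_0)
      have pr: "Polynomial.lead_coeff r * z ^ m = - poly q z"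
      proof -
        have "poly r z = 0" using sr s0 by simp
        then show ?thesis by (simp add: q_def poly_monom)
      qed
      show False
      proof (rule bound_imp[of "Polynomial.lead_coeff r"])
        show "Polynomial.lead_coeff r \<noteq> 0" using r by simp
        fix v :: "'k \<Rightarrow> int" assume v: "v \<in> places"
        define P where "P = pole_order v z"
        define U where "U = pole_order v u"
        have PU: "P \<ge> 0" "U \<ge> 0" "vge v (- P) z" using vge_pole_order by (auto simp: P_def U_def pole_order_nonneg)
        note cv = c0[of v]
        show "vge v (- 7 * c v - pole_order v u + pole_order v z) (Polynomial.lead_coeff r)"
        proof (cases "P = 0")
          case True
          show ?thesis using rb[OF v] by (rule vge_mono) (use True cv in \<open>simp add: P_def\<close>)
        next
          case False
          then have z: "z \<noteq> 0" "v z = - P" using val_zero[OF v] by (auto simp: P_def pole_order_def)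
          have "m \<noteq> 0"
          proof
            assume "m = 0"
            then have "q = 0" using q by (intro poly_eqI) simp
            then show False using pr r z by simp
          qed
          have "vge v (- U - 2 * c v - int (m - 1) * P) (poly q z)"
          proof (rule vge_poly[OF v _ _ PU(3,1)])
            show "vge v (- U - 2 * c v) (Polynomial.coeff q j)" for j
              using rb[OF v, of j] by (simp add: q U_def)
            show "Polynomial.degree q \<le> m - 1" using q by (intro degree_le) auto
          qed
          then have "vge v (- U - 2 * c v - int (m - 1) * P) (Polynomial.lead_coeff r * z ^ m)"
            unfolding pr vge_uminus[OF v] .
          moreover have "v (Polynomial.lead_coeff r * z ^ m) = v (Polynomial.lead_coeff r) - int m * P"
            using r z val_mult[OF v, of "Polynomial.lead_coeff r" "z ^ m"] by (simp add: val_power[OF v])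
          moreover have "int m * P = int (m - 1) * P + P"
          proof -
            have "int m = int (m - 1) + 1" using \<open>m \<noteq> 0\<close> by simp
            then have "int m * P = (int (m - 1) + 1) * P" by (simp only:)
            then show ?thesis by (simp only: distrib_right mult_1)
          qed
          moreover have "Polynomial.lead_coeff r * z ^ m \<noteq> 0" using r z by simp
          ultimately have "- 7 * c v - U + P \<le> v (Polynomial.lead_coeff r)"
            using cv unfolding vge_def by linarith
          then show ?thesis by (simp add: vge_def U_def P_def)
        qed
      qed
    qed
    then show ?thesis
      using s0 twisted_constant_iff_defect[OF D] by (intro exI[of _ \<alpha>]) (simp add: r_def s_def)
  qed
  then show ?thesis by blast
qed

lemma twisted_constant_back:
  fixes f :: "'k poly"
  assumes D: "is_derivation D" and "twisted_constant D f u \<alpha>" and "D (poly f z) = u * poly f z"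
    and "poly (pderiv f) z \<noteq> 0"
  shows "D z = \<alpha> * z"
  using defect_identity[OF D assms(3), of \<alpha>] assms twisted_constant_iff_defect[OF D] by simp

section \<open>Logarithmic derivatives and supports\<close>

definition support_degree :: "'k \<Rightarrow> real" where
  "support_degree x = (\<Sum>v\<in>{v \<in> places. v x \<noteq> 0}. place_degree v)"

text \<open>Apart from the fixed poles of \<open>D\<close>, a logarithmic derivative has at most
  simple poles, and these lie at zeros and poles of \<open>y\<close>. Multiplicities in
  \<open>y\<close> do not count.\<close>

lemma log_derivative_height:
  assumes D: "is_derivation (D :: 'k \<Rightarrow> 'k)"
  shows "\<exists>C. \<forall>y. y \<noteq> 0 \<longrightarrow> height (D y / y) \<le> C + support_degree y"
proof -
  obtain d where d: "finite {v \<in> places. d v \<noteq> 0}" "\<And>v. 0 \<le> d v"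
    "\<And>v k x. v \<in> places \<Longrightarrow> vge v k x \<Longrightarrow> vge v (k - 1 - d v) (D x)"
    "\<And>v x. v \<in> places \<Longrightarrow> vge v 0 x \<Longrightarrow> vge v (- d v) (D x)"
    using derivation_bound[OF D] by blast
  have "height (D y / y) \<le> divisor_degree d + support_degree y" if y: "y \<noteq> 0" for y
  proof -
    define b where "b v = (if v y \<noteq> 0 then 1 else 0 :: int)" for v :: "'k \<Rightarrow> int"
    have P: "pole_order v (D y / y) \<le> d v + b v" if v: "v \<in> places" for v
    proof (rule pole_order_le[OF v])
      have "vge v (v y - b v - d v) (D y)"
      proof (cases "v y = 0")
        case True
        then show ?thesis using d(4)[OF v, of y] by (simp add: vge_def b_def)
      next
        case False
        then show ?thesis using d(3)[OF v, of "v y" y] by (simp add: vge_def b_def)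
      qed
      then show "vge v (- (d v + b v)) (D y / y)"
        unfolding vge_divide_iff[OF v y] by (simp add: algebra_simps)
    qed (simp add: d(2) b_def)
    have Pr: "real_of_int (pole_order v (D y / y)) \<le> real_of_int (d v) + real_of_int (b v)"
      if "v \<in> places" for v using P[OF that] by linarith
    define T where "T = {v \<in> places. d v \<noteq> 0} \<union> {v \<in> places. v y \<noteq> 0} \<union> {v \<in> places. pole_order v (D y / y) \<noteq> 0}"
    have T: "finite T" "T \<subseteq> places" using d(1) finite_support finite_poles by (auto simp: T_def)
    have "height (D y / y) = (\<Sum>v\<in>T. place_degree v * of_int (pole_order v (D y / y)))"
      using T by (intro height_eq) (auto simp: T_def)
    also have "\<dots> \<le> (\<Sum>v\<in>T. place_degree v * of_int (d v) + place_degree v * of_int (b v))"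
      unfolding ring_distribs(1)[symmetric]
      using T Pr by (intro sum_mono mult_left_mono) (auto simp: place_degree_pos less_imp_le)
    also have "\<dots> = (\<Sum>v\<in>T. place_degree v * of_int (d v)) + (\<Sum>v\<in>T. place_degree v * of_int (b v))"
      by (rule sum.distrib)
    also have "(\<Sum>v\<in>T. place_degree v * of_int (d v)) = divisor_degree d"
      using T by (intro divisor_degree_eq[symmetric]) (auto simp: T_def)
    also have "(\<Sum>v\<in>T. place_degree v * of_int (b v)) = (\<Sum>v\<in>{v \<in> places. v y \<noteq> 0}. place_degree v * of_int (b v))"
      using T by (intro sum.mono_neutral_right) (auto simp: T_def b_def)
    also have "\<dots> = support_degree y"
      unfolding support_degree_def by (intro sum.cong) (auto simp: b_def)
    finally show ?thesis .
  qed
  then show ?thesis by blast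
qed

end

subsection \<open>Descent along Frobenius\<close>

lemma finite_range_bound:
  fixes F :: "'b \<Rightarrow> real"
  assumes "finite (range g)" obtains C where "\<And>k. F (g k) \<le> C"
proof -
  have "bdd_above (F ` range g)" using assms by (intro bdd_above_finite) auto
  then show ?thesis using that by (auto simp: bdd_above_def)
qed

lemma pole_order_mult:
  assumes v: "v \<in> places" shows "pole_order v (x * y) \<le> pole_order v x + pole_order v y"
  using vge_mult[OF v vge_pole_order vge_pole_order, of x y]
  by (intro pole_order_le v) (auto simp: pole_order_nonneg algebra_simps)

lemma pole_order_add:
  assumes v: "v \<in> places" shows "pole_order v (x + y) \<le> pole_order v x + pole_order v y"
  by (intro pole_order_le v vge_add vge_mono[OF vge_pole_order]) (auto simp: pole_order_nonneg)

context function_field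
begin

lemma height_mono_add:
  fixes x y z :: 'k
  assumes "\<And>v. v \<in> places \<Longrightarrow> pole_order v x \<le> pole_order v y + pole_order v z"
  shows "height x \<le> height y + height z"
proof -
  define T where "T = {v \<in> places. pole_order v x \<noteq> 0} \<union> {v \<in> places. pole_order v y \<noteq> 0} \<union> {v \<in> places. pole_order v z \<noteq> 0}"
  have T: "finite T" "T \<subseteq> places" using finite_poles by (auto simp: T_def)
  have "height x = (\<Sum>v\<in>T. place_degree v * of_int (pole_order v x))"
    using T by (intro height_eq) (auto simp: T_def)
  also have "\<dots> \<le> (\<Sum>v\<in>T. place_degree v * (of_int (pole_order v y) + of_int (pole_order v z)))"
  proof (intro sum_mono mult_left_mono)
    fix v assume "v \<in> T"
    then have v: "v \<in> places" using T by auto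
    show "0 \<le> place_degree v" using place_degree_pos[OF v] by simp
    show "real_of_int (pole_order v x) \<le> of_int (pole_order v y) + of_int (pole_order v z)"
      using assms[OF v] by linarith
  qed
  also have "\<dots> = (\<Sum>v\<in>T. place_degree v * of_int (pole_order v y)) + (\<Sum>v\<in>T. place_degree v * of_int (pole_order v z))"
    by (simp add: algebra_simps sum.distrib)
  also have "(\<Sum>v\<in>T. place_degree v * of_int (pole_order v y)) = height y"
    using T by (intro height_eq[symmetric]) (auto simp: T_def)
  also have "(\<Sum>v\<in>T. place_degree v * of_int (pole_order v z)) = height z"
    using T by (intro height_eq[symmetric]) (auto simp: T_def)
  finally show ?thesis .
qed

lemma height_mult_le: "height (x * y :: 'k) \<le> height x + height y"
  by (intro height_mono_add pole_order_mult)

lemma height_add_le: "height (x + y :: 'k) \<le> height x + height y"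
  by (intro height_mono_add pole_order_add)

lemma height_power_le: "height (x ^ n :: 'k) \<le> real n * height x"
proof (induction n)
  case 0
  have "height (1 :: 'k) = 0"
    unfolding height_def divisor_degree_def by (intro sum.neutral) (auto simp: pole_order_def val_one)
  then show ?case by simp
next
  case (Suc n)
  then show ?case using height_mult_le[of x "x ^ n"] by (simp add: algebra_simps)
qed

lemma support_degree_nonneg: "0 \<le> support_degree (x :: 'k)"
  unfolding support_degree_def by (intro sum_nonneg) (auto simp: place_degree_pos less_imp_le)

lemma support_degree_mono:
  fixes x y z :: 'k
  assumes "\<And>v. v \<in> places \<Longrightarrow> v x \<noteq> 0 \<Longrightarrow> v y \<noteq> 0 \<or> v z \<noteq> 0"
  shows "support_degree x \<le> support_degree y + support_degree z"
proof -
  let ?S = "\<lambda>x :: 'k. {v \<in> places. v x \<noteq> 0}"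
  have fin: "finite (?S x)" for x by (rule finite_support)
  have "support_degree x \<le> (\<Sum>v\<in>?S y \<union> ?S z. place_degree v)"
    unfolding support_degree_def
    by (rule sum_mono2) (use assms fin in \<open>auto simp: place_degree_pos less_imp_le\<close>)
  also have "\<dots> \<le> support_degree y + support_degree z"
    unfolding support_degree_def using fin
    by (subst sum_Un) (auto intro!: sum_nonneg simp: place_degree_pos less_imp_le)
  finally show ?thesis .
qed

text \<open>The quotient A2 / A0 of a centred polynomial. It determines \<alpha> through
  \<open>twisted_mid_ratio\<close>, and z^2 divided by it is the invariant of the descent.\<close>

definition mid_ratio :: "'k poly \<Rightarrow> 'k" where
  "mid_ratio f = Polynomial.coeff f (Polynomial.degree f - 2) / Polynomial.lead_coeff f"

definition centred_poly :: "'k poly \<Rightarrow> bool" where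
  "centred_poly f \<longleftrightarrow> Polynomial.degree f \<ge> 3 \<and> (of_nat (Polynomial.degree f) :: 'k) \<noteq> 0 \<and>
     Polynomial.coeff f (Polynomial.degree f - 1) = 0 \<and> Polynomial.coeff f (Polynomial.degree f - 2) \<noteq> 0"

text \<open>
  The colours \<open>a\<close> record which polynomials are used at each time; they are kept during the descent,
  whereas \<open>f\<close> and \<open>z\<close> are replaced by twisted \<open>p\<close>-th roots. The last clause provides times at which
  \<open>z (Suc n) + x0\<close> has small support.
\<close>

definition dyn_system :: "(nat \<Rightarrow> 'c) \<Rightarrow> (nat \<Rightarrow> 'k poly) \<Rightarrow> (nat \<Rightarrow> 'k) \<Rightarrow> 'k \<Rightarrow> 'c \<Rightarrow> 'c \<Rightarrow> bool" where
  "dyn_system a f z x0 r s \<longleftrightarrow>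
     (\<forall>k. z (Suc k) = poly (f k) (z k)) \<and>
     (\<forall>k. centred_poly (f k)) \<and>
     finite (range f) \<and>
     (\<forall>k l. a k = a l \<and> a (Suc k) = a (Suc l) \<longrightarrow> f k = f l) \<and>
     (\<forall>k l. a k = a l \<longrightarrow> mid_ratio (f k) = mid_ratio (f l)) \<and>
     (\<forall>k n. \<exists>l\<ge>n. a l = a k \<and> a (Suc l) = a (Suc k)) \<and>
     (\<forall>k. poly (pderiv (f k)) (z k) \<noteq> 0) \<and>
     (\<forall>C. \<exists>n. \<forall>k\<ge>n. C < height (z k)) \<and>
     (\<forall>C. \<exists>n. a n = r \<and> a (Suc n) = s \<and> z (Suc n) + x0 \<noteq> 0 \<and>
        C * (1 + support_degree (z (Suc n) + x0)) < height (z n))"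

lemma mid_ratio_nonzero: "centred_poly f \<Longrightarrow> mid_ratio f \<noteq> 0"
  by (auto simp: centred_poly_def mid_ratio_def)

lemma two_nonzero:
  assumes "odd p" shows "(2 :: 'k) \<noteq> 0"
proof
  assume "(2 :: 'k) = 0"
  then have "p dvd 2" using of_nat_eq_0_iff[of 2] by simp
  then have "p = 2" using dvd_imp_le[of p 2] prime_ge_2_nat[OF prime_p] by simp
  then show False using assms by simp
qed

text \<open>In the quotient of the coefficients at \<open>n - 2\<close> and \<open>n\<close> the
  factor \<open>u\<close> drops out, and the difference of the indices gives
  \<open>2 * \<alpha>\<close>.\<close>

lemma twisted_mid_ratio:
  assumes D: "is_derivation D" and f: "centred_poly f" and t: "twisted_constant D f u \<alpha>"
  shows "D (mid_ratio f) = 2 * \<alpha> * mid_ratio f"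
proof -
  define n where "n = Polynomial.degree f"
  have n: "n \<ge> 2" using f by (simp add: centred_poly_def n_def)
  have l: "Polynomial.coeff f n \<noteq> 0" using f by (auto simp: centred_poly_def n_def)
  have "(of_nat (n - 2) :: 'k) = of_nat n - 2" using n by (simp add: of_nat_diff)
  then have E: "D (Polynomial.coeff f (n - 2)) = (u - (of_nat n - 2) * \<alpha>) * Polynomial.coeff f (n - 2)"
    "D (Polynomial.coeff f n) = (u - of_nat n * \<alpha>) * Polynomial.coeff f n"
    using t by (simp_all add: twisted_constant_def)
  show ?thesis
    unfolding mid_ratio_def n_def[symmetric] derivation_divide[OF D l] E
    using l by (simp add: field_simps power2_eq_square)
qed

text \<open>Every \<alpha> supplied by \<open>one_step\<close> equals \<open>\<alpha> k\<close>,
  because \<open>mid_ratio\<close> determines it. A time of small support starts a backward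
  induction along the orbit; recurrence of the colours carries the identities for late polynomials
  over to all of them.\<close>

lemma dyn_system_constant:
  assumes D: "is_derivation (D :: 'k \<Rightarrow> 'k)" and odd: "odd p" and sys: "dyn_system a f z x0 r s"
  defines "\<alpha> \<equiv> \<lambda>k. D (mid_ratio (f k)) / (2 * mid_ratio (f k))"
  shows "D (z k) = \<alpha> k * z k" "twisted_constant D (f k) (\<alpha> (Suc k)) (\<alpha> k)"
    "a (Suc k) = s \<Longrightarrow> D x0 = \<alpha> (Suc k) * x0"
proof -
  have z: "\<And>k. z (Suc k) = poly (f k) (z k)" and cen: "\<And>k. centred_poly (f k)"
    and fin: "finite (range f)"
    and fa: "\<And>k l. a k = a l \<Longrightarrow> a (Suc k) = a (Suc l) \<Longrightarrow> f k = f l"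
    and ma: "\<And>k l. a k = a l \<Longrightarrow> mid_ratio (f k) = mid_ratio (f l)"
    and recur: "\<And>k n. \<exists>l\<ge>n. a l = a k \<and> a (Suc l) = a (Suc k)"
    and der: "\<And>k. poly (pderiv (f k)) (z k) \<noteq> 0"
    and inf: "\<And>C. \<exists>n. \<forall>k\<ge>n. C < height (z k)"
    and top: "\<And>C. \<exists>n. a n = r \<and> a (Suc n) = s \<and> z (Suc n) + x0 \<noteq> 0 \<and>
        C * (1 + support_degree (z (Suc n) + x0)) < height (z n)"
    using sys unfolding dyn_system_def by blast+
  have uniq: "\<beta> = \<alpha> k" if "twisted_constant D g u \<beta>" "centred_poly g" "mid_ratio g = mid_ratio (f k)" for g u \<beta> k
    using twisted_mid_ratio[OF D that(2,1)] mid_ratio_nonzero[OF that(2)] that(3) two_nonzero[OF odd]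
    by (simp add: \<alpha>_def field_simps)
  \<comment> \<open>The element of small support is \<open>z (Suc n) + x0\<close>, the value of
    \<open>t n\<close>. Only the constant coefficient changes, which affects neither centring nor
    \<open>mid_ratio\<close> since the degree is at least 3.\<close>
  define t where "t k = f k + [:x0:]" for k
  have ct: "Polynomial.coeff (t k) j = Polynomial.coeff (f k) j + (if j = 0 then x0 else 0)" for k j
    by (cases j) (auto simp: t_def coeff_pCons)
  have f3: "Polynomial.degree (f k) \<ge> 3" for k using cen by (simp add: centred_poly_def)
  have dt: "Polynomial.degree (t k) = Polynomial.degree (f k)" for k
    unfolding t_def using f3[of k] by (intro degree_add_eq_left) auto
  have cent: "centred_poly (t k)" and mt: "mid_ratio (t k) = mid_ratio (f k)" for k
    using cen[of k] by (auto simp: centred_poly_def mid_ratio_def dt ct)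
  have step: "\<exists>C. \<forall>z u. D (poly g z) = u * poly g z \<longrightarrow> C + height u < height z \<longrightarrow>
      (\<exists>\<alpha>. D z = \<alpha> * z \<and> twisted_constant D g u \<alpha>)" if "centred_poly g" for g
    using that by (intro one_step D) (auto simp: centred_poly_def)
  define G where "G = range f \<union> range t"
  have Gc: "centred_poly g" if "g \<in> G" for g using that cen cent by (auto simp: G_def)
  have "range t = (\<lambda>g. g + [:x0:]) ` range f" by (auto simp: t_def)
  then have Gf: "finite G" using fin by (simp add: G_def)
  have "\<forall>g. \<exists>C. g \<in> G \<longrightarrow> (\<forall>z u. D (poly g z) = u * poly g z \<longrightarrow> C + height u < height z \<longrightarrow>
      (\<exists>\<alpha>. D z = \<alpha> * z \<and> twisted_constant D g u \<alpha>))" using step Gc by metis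
  then obtain Cg where Cg: "\<And>g z u. g \<in> G \<Longrightarrow> D (poly g z) = u * poly g z \<Longrightarrow> Cg g + height u < height z \<Longrightarrow>
      (\<exists>\<alpha>. D z = \<alpha> * z \<and> twisted_constant D g u \<alpha>)" by metis
  have "bdd_above (Cg ` G)" using Gf by (intro bdd_above_finite) auto
  then obtain C1 where C1: "\<And>g. g \<in> G \<Longrightarrow> Cg g \<le> C1" by (auto simp: bdd_above_def)
  obtain C2 where C2: "\<And>y. y \<noteq> 0 \<Longrightarrow> height (D y / y) \<le> C2 + support_degree y"
    using log_derivative_height[OF D] by blast
  obtain H where H: "\<And>k. height (\<alpha> k) \<le> H"
    using finite_range_bound[OF fin, of "\<lambda>g. height (D (mid_ratio g) / (2 * mid_ratio g))"]
    unfolding \<alpha>_def by blast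
  obtain M where M: "\<And>k. k \<ge> M \<Longrightarrow> C1 + H < height (z k)" using inf by blast
  \<comment> \<open>Here \<open>u\<close> is \<open>\<alpha> (Suc k)\<close>, whose height is
    bounded by \<open>H\<close> for all \<open>k\<close>. The height condition of
    \<open>one_step\<close> thus becomes the condition \<open>k \<ge> M\<close>.\<close>
  have pull: "D (z k) = \<alpha> k * z k \<and> twisted_constant D (f k) (\<alpha> (Suc k)) (\<alpha> k)"
    if pk: "k \<ge> M" "D (z (Suc k)) = \<alpha> (Suc k) * z (Suc k)" for k
  proof -
    have fG: "f k \<in> G" by (simp add: G_def)
    have "Cg (f k) + height (\<alpha> (Suc k)) < height (z k)"
      using M[OF pk(1)] C1[OF fG] H[of "Suc k"] by linarith
    then obtain \<beta> where b: "D (z k) = \<beta> * z k" "twisted_constant D (f k) (\<alpha> (Suc k)) \<beta>"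
      using Cg[OF fG, of "z k" "\<alpha> (Suc k)"] pk(2) z by auto
    then show ?thesis using uniq[OF b(2) cen] by simp
  qed
  have topn: "\<exists>n\<ge>N. a n = r \<and> a (Suc n) = s \<and> D (z n) = \<alpha> n * z n \<and> (\<exists>u. twisted_constant D (t n) u (\<alpha> n))" for N
  proof -
    \<comment> \<open>\<open>C1 + C2\<close> is what \<open>one_step\<close> needs for
      \<open>u = D y / y\<close>. The sum of the first \<open>N\<close> heights forces
      \<open>n \<ge> N\<close>, as \<open>height (z n)\<close> exceeds each of them. The bound
      \<open>C \<ge> 1\<close> turns the product with \<open>1 + support_degree y\<close> into a
      sum.\<close>
    define C where "C = max 1 (C1 + C2) + (\<Sum>k<N. height (z k))"
    obtain n where n: "a n = r" "a (Suc n) = s" "z (Suc n) + x0 \<noteq> 0"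
      "C * (1 + support_degree (z (Suc n) + x0)) < height (z n)" using top by blast
    define y where "y = z (Suc n) + x0"
    have S0: "(\<Sum>k<N. height (z k)) \<ge> 0" by (intro sum_nonneg height_nonneg)
    note sd = support_degree_nonneg[of y]
    have C: "C \<ge> 1" "C \<ge> C1 + C2" "C \<ge> (\<Sum>k<N. height (z k))" using S0 by (auto simp: C_def)
    have Cs: "C + support_degree y \<le> C * (1 + support_degree y)"
      using mult_right_mono[OF C(1) sd] by (simp add: algebra_simps)
    have "n \<ge> N"
    proof (rule ccontr)
      assume "\<not> n \<ge> N"
      then have "height (z n) \<le> (\<Sum>k<N. height (z k))" by (intro member_le_sum) (auto simp: height_nonneg)
      then show False using n(4) C Cs sd unfolding y_def by linarith
    qed
    have tG: "t n \<in> G" by (simp add: G_def)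
    have yt: "poly (t n) (z n) = y" by (simp add: t_def y_def z)
    have y0: "y \<noteq> 0" using n(3) by (simp add: y_def)
    have "Cg (t n) + height (D y / y) < height (z n)"
      using C1[OF tG] C2[OF y0] C Cs n(4) unfolding y_def[symmetric] by linarith
    then obtain \<beta> where b: "D (z n) = \<beta> * z n" "twisted_constant D (t n) (D y / y) \<beta>"
      using Cg[OF tG, of "z n" "D y / y"] y0 by (auto simp: yt)
    have "\<beta> = \<alpha> n" using uniq[OF b(2) cent mt] .
    then show ?thesis using b n \<open>n \<ge> N\<close> by blast
  qed
  have large: "D (z k) = \<alpha> k * z k" if "k \<ge> M" for k
  proof -
    obtain n where n: "n \<ge> k" "D (z n) = \<alpha> n * z n" using topn by blast
    show ?thesis using n(1)
    proof (induction rule: inc_induct)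
      case (step m)
      then show ?case using pull[of m] that by simp
    qed (rule n(2))
  qed
  \<comment> \<open>The polynomial at time \<open>k\<close> and both values of \<alpha> depend on
    the colours at \<open>k\<close> and \<open>Suc k\<close>, which occur again beyond
    \<open>M\<close>.\<close>
  have tw: "twisted_constant D (f k) (\<alpha> (Suc k)) (\<alpha> k)" for k
  proof -
    obtain l where l: "l \<ge> M" "a l = a k" "a (Suc l) = a (Suc k)" using recur by blast
    have "f l = f k" "\<alpha> l = \<alpha> k" "\<alpha> (Suc l) = \<alpha> (Suc k)"
      using fa[of l k] ma[of l k] ma[of "Suc l" "Suc k"] l by (simp_all add: \<alpha>_def)
    then show ?thesis using pull[of l] large[of "Suc l"] l(1) by simp
  qed
  then show "twisted_constant D (f k) (\<alpha> (Suc k)) (\<alpha> k)" .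
  show "D (z k) = \<alpha> k * z k"
  proof (cases "k \<ge> M")
    case False
    then have "k \<le> M" by simp
    then show ?thesis
    proof (induction rule: inc_induct)
      case base
      then show ?case using large by simp
    next
      case (step m)
      show ?case using step.IH z by (intro twisted_constant_back[OF D tw _ der]) simp
    qed
  qed (rule large)
  \<comment> \<open>\<open>f n\<close> and \<open>t n\<close> satisfy the twisted equations with the
    same \<open>\<alpha> n\<close>. Their equal leading coefficients give
    \<open>u = \<alpha> (Suc n)\<close>; the difference of their constant coefficients is
    \<open>x0\<close>.\<close>
  assume ak: "a (Suc k) = s"
  obtain n u where n: "a (Suc n) = s" "twisted_constant D (t n) u (\<alpha> n)" using topn by blast
  let ?d = "Polynomial.degree (f n)"
  have l: "Polynomial.coeff (f n) ?d \<noteq> 0" using f3[of n] by auto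
  have "D (Polynomial.coeff (t n) ?d) = (u - of_nat ?d * \<alpha> n) * Polynomial.coeff (t n) ?d"
    "D (Polynomial.coeff (f n) ?d) = (\<alpha> (Suc n) - of_nat ?d * \<alpha> n) * Polynomial.coeff (f n) ?d"
    using n(2) tw[of n] unfolding twisted_constant_def by blast+
  moreover have "Polynomial.coeff (t n) ?d = Polynomial.coeff (f n) ?d" using f3[of n] by (simp add: ct)
  ultimately have u: "u = \<alpha> (Suc n)" using l by simp
  have "D (Polynomial.coeff (t n) 0) = (u - of_nat 0 * \<alpha> n) * Polynomial.coeff (t n) 0"
    "D (Polynomial.coeff (f n) 0) = (\<alpha> (Suc n) - of_nat 0 * \<alpha> n) * Polynomial.coeff (f n) 0"
    using n(2) tw[of n] unfolding twisted_constant_def by blast+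
  then have "D x0 = \<alpha> (Suc n) * x0"
    by (simp add: ct u derivation_simps(1)[OF D] algebra_simps)
  moreover have "\<alpha> (Suc n) = \<alpha> (Suc k)" using ma[of "Suc n" "Suc k"] n(1) ak by (simp add: \<alpha>_def)
  ultimately show "D x0 = \<alpha> (Suc k) * x0" by simp
qed

end

section \<open>Extraction of p-th roots\<close>

lemma log_derivative_simps:
  assumes D: "is_derivation D"
  shows "D x = a * x \<Longrightarrow> D y = b * y \<Longrightarrow> D (x * y) = (a + b) * (x * y)"
    "D x = a * x \<Longrightarrow> D y = b * y \<Longrightarrow> y \<noteq> 0 \<Longrightarrow> D (x / y) = (a - b) * (x / y)"
    "D x = a * x \<Longrightarrow> D (x ^ n) = (of_nat n * a) * x ^ n"
proof -
  show "D x = a * x \<Longrightarrow> D y = b * y \<Longrightarrow> D (x * y) = (a + b) * (x * y)"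
    by (simp add: derivation_simps(2)[OF D] algebra_simps)
  show "D x = a * x \<Longrightarrow> D y = b * y \<Longrightarrow> y \<noteq> 0 \<Longrightarrow> D (x / y) = (a - b) * (x / y)"
    by (simp add: derivation_divide[OF D] field_simps power2_eq_square)
  show "D x = a * x \<Longrightarrow> D (x ^ n) = (of_nat n * a) * x ^ n"
    unfolding derivation_simps(7)[OF D] by (cases n) (simp_all add: mult_ac)
qed

context function_field
begin

definition proot :: "'k \<Rightarrow> 'k" where
  "proot x = (THE y. y ^ p = x)"

lemma proot_frob [simp]: "proot (x ^ p) = x"
  unfolding proot_def by (rule the_equality) (auto simp: frob_inj)

lemma proot_0 [simp]: "proot 0 = 0"
  using proot_frob[of 0] p_pos by (simp add: power_0_left)

lemma poly_map_frob: "poly (map_poly (\<lambda>c. c ^ p) q) (x ^ p) = (poly q x :: 'k) ^ p"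
proof (induction q)
  case 0
  then show ?case using p_pos by (simp add: power_0_left)
next
  case (pCons c q)
  have "map_poly (\<lambda>c. c ^ p) (pCons c q) = pCons (c ^ p) (map_poly (\<lambda>c. c ^ p) q)"
    using p_pos by (intro poly_eqI) (auto simp: coeff_map_poly coeff_pCons power_0_left split: nat.split)
  then show ?case by (simp add: pCons.IH frob_add power_mult_distrib)
qed

lemma pderiv_map_frob: "pderiv (map_poly (\<lambda>c. c ^ p) q) = map_poly (\<lambda>c. c ^ p) (pderiv q :: 'k poly)"
  using p_pos by (intro poly_eqI) (simp add: coeff_pderiv coeff_map_poly power_0_left
      power_mult_distrib frob_of_nat del: of_nat_Suc)

text \<open>The polynomial g for which e' g(x)^p = f(e x^p): scaling by \<open>e\<close> and
  \<open>e'\<close> makes all coefficients \<open>p\<close>-th powers, and Frobenius is stripped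
  off.\<close>

definition twisted_root :: "'k poly \<Rightarrow> 'k \<Rightarrow> 'k \<Rightarrow> 'k poly" where
  "twisted_root f e e' = map_poly proot (smult (1 / e') (pcompose f [:0, e:]))"

lemma twisted_root:
  assumes e: "e \<noteq> 0" "e' \<noteq> 0"
    and pow: "\<And>j. \<exists>c. Polynomial.coeff f j * e ^ j / e' = c ^ p"
  shows "Polynomial.coeff (twisted_root f e e') j ^ p = Polynomial.coeff f j * e ^ j / e'"
    "e' * poly (twisted_root f e e') x ^ p = poly f (e * x ^ p)"
    "e' * poly (pderiv (twisted_root f e e')) x ^ p = e * poly (pderiv f) (e * x ^ p)"
    "Polynomial.degree (twisted_root f e e') = Polynomial.degree f"
proof -
  define g where "g = smult (1 / e') (pcompose f [:0, e:])"
  have g: "Polynomial.coeff g j = Polynomial.coeff f j * e ^ j / e'" for j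
    by (simp add: g_def coeff_pcompose_linear)
  show c: "Polynomial.coeff (twisted_root f e e') j ^ p = Polynomial.coeff f j * e ^ j / e'" for j
  proof -
    obtain c where c: "Polynomial.coeff g j = c ^ p" using pow g by metis
    have "Polynomial.coeff (twisted_root f e e') j = proot (Polynomial.coeff g j)"
      by (simp add: twisted_root_def g_def coeff_map_poly)
    then show ?thesis by (simp add: c flip: g)
  qed
  have map: "map_poly (\<lambda>c. c ^ p) (twisted_root f e e') = g"
    using p_pos by (intro poly_eqI) (simp add: coeff_map_poly power_0_left c g)
  have pg: "poly g y = poly f (e * y) / e'" for y by (simp add: g_def poly_pcompose mult.commute)
  show "e' * poly (twisted_root f e e') x ^ p = poly f (e * x ^ p)"
    unfolding poly_map_frob[symmetric] map pg using e by simp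
  have "poly (pderiv g) y = e * poly (pderiv f) (e * y) / e'" for y
    by (simp add: g_def pderiv_smult pderiv_pcompose poly_pcompose pderiv_pCons mult_ac)
  then show "e' * poly (pderiv (twisted_root f e e')) x ^ p = e * poly (pderiv f) (e * x ^ p)"
    unfolding poly_map_frob[symmetric] pderiv_map_frob[symmetric] map using e by simp
  have "Polynomial.coeff (twisted_root f e e') j = 0 \<longleftrightarrow> Polynomial.coeff f j = 0" for j
    using c[of j] e p_pos by (metis divide_eq_0_iff mult_eq_0_iff power_eq_0_iff)
  then show "Polynomial.degree (twisted_root f e e') = Polynomial.degree f"
    unfolding Polynomial.degree_def by simp
qed

text \<open>Constants of \<open>D\<close> are \<open>p\<close>-th powers. So once the orbit and the
  coefficients are scaled by solutions \<open>e k\<close> of e' = \<alpha> e, everything has a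
  \<open>p\<close>-th root, and the roots inherit all clauses of \<open>dyn_system\<close> with the
  same colours.\<close>

lemma dyn_system_root:
  assumes D: "is_derivation (D :: 'k \<Rightarrow> 'k)" and ker: "\<And>x. D x = 0 \<Longrightarrow> \<exists>y. x = y ^ p"
    and odd: "odd p" and sys: "dyn_system a f z x0 r s"
  shows "\<exists>g w y0. dyn_system a g w y0 r s \<and>
    z 0 ^ 2 / mid_ratio (f 0) = (w 0 ^ 2 / mid_ratio (g 0)) ^ p"
proof -
  have z: "\<And>k. z (Suc k) = poly (f k) (z k)" and cen: "\<And>k. centred_poly (f k)"
    and fin: "finite (range f)"
    and fa: "\<And>k l. a k = a l \<Longrightarrow> a (Suc k) = a (Suc l) \<Longrightarrow> f k = f l"
    and ma: "\<And>k l. a k = a l \<Longrightarrow> mid_ratio (f k) = mid_ratio (f l)"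
    and recur: "\<And>k n. \<exists>l\<ge>n. a l = a k \<and> a (Suc l) = a (Suc k)"
    and der: "\<And>k. poly (pderiv (f k)) (z k) \<noteq> 0"
    and inf: "\<And>C. \<exists>n. \<forall>k\<ge>n. C < height (z k)"
    and top: "\<And>C. \<exists>n. a n = r \<and> a (Suc n) = s \<and> z (Suc n) + x0 \<noteq> 0 \<and>
        C * (1 + support_degree (z (Suc n) + x0)) < height (z n)"
    using sys unfolding dyn_system_def by blast+
  define B where "B k = mid_ratio (f k)" for k
  define \<alpha> where "\<alpha> k = D (B k) / (2 * B k)" for k
  \<comment> \<open>Oddness of \<open>p\<close> makes the exponent integral, and twice the exponent
    is \<open>p + 1\<close>, which is 1 in K. So the derivative of \<open>e k\<close> carries the
    factor \<alpha> rather than a multiple of it, and \<open>e k\<close> still depends on the colour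
    alone.\<close>
  define E where "E g = mid_ratio g ^ ((p + 1) div 2)" for g
  define e where "e k = E (f k)" for k
  have B0: "B k \<noteq> 0" for k using mid_ratio_nonzero[OF cen] by (simp add: B_def)
  have e0: "e k \<noteq> 0" for k using mid_ratio_nonzero[OF cen] by (simp add: e_def E_def)
  have ea: "e k = e l" if "a k = a l" for k l using ma[OF that] by (simp add: e_def E_def)
  have half: "(p + 1) div 2 * 2 = p + 1" by (rule dvd_div_mult_self) (use odd in simp)
  have esq: "e k ^ 2 = B k ^ (p + 1)" for k
    unfolding e_def E_def B_def power_mult[symmetric] half ..
  note const = dyn_system_constant[OF D odd sys, folded B_def, folded \<alpha>_def]
  have De: "D (e k) = \<alpha> k * e k" for k
  proof -
    have two: "(2 :: 'k) \<noteq> 0" using two_nonzero[OF odd] .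
    have "D (B k) = (2 * \<alpha> k) * B k" using B0 two by (simp add: \<alpha>_def)
    from log_derivative_simps(3)[OF D this, of "(p + 1) div 2"]
    have "D (e k) = (of_nat ((p + 1) div 2) * 2) * \<alpha> k * e k"
      by (simp add: e_def E_def B_def mult_ac)
    also have "(of_nat ((p + 1) div 2) * 2 :: 'k) = of_nat ((p + 1) div 2 * 2)" by simp
    also have "\<dots> = 1" unfolding half by (simp add: char_p)
    finally show ?thesis by simp
  qed
  have root: "\<exists>c. x / y = c ^ p" if "D x = \<beta> * x" "D y = \<beta> * y" "y \<noteq> 0" for x y \<beta>
    using ker[of "x / y"] log_derivative_simps(2)[OF D that] by simp
  define w where "w k = proot (z k / e k)" for k
  have w: "z k = e k * w k ^ p" for k
  proof -
    obtain c where "z k / e k = c ^ p" using root[OF const(1) De e0] by blast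
    then show ?thesis using e0 by (simp add: w_def field_simps)
  qed
  define g where "g k = twisted_root (f k) (e k) (e (Suc k))" for k
  have pow: "\<exists>c. Polynomial.coeff (f k) j * e k ^ j / e (Suc k) = c ^ p" for k j
  proof (rule root[OF _ De e0])
    have "D (Polynomial.coeff (f k) j) = (\<alpha> (Suc k) - of_nat j * \<alpha> k) * Polynomial.coeff (f k) j"
      using const(2)[of k] by (simp add: twisted_constant_def)
    from log_derivative_simps(1)[OF D this log_derivative_simps(3)[OF D De]]
    show "D (Polynomial.coeff (f k) j * e k ^ j) = \<alpha> (Suc k) * (Polynomial.coeff (f k) j * e k ^ j)" by simp
  qed
  note g = twisted_root[OF e0 e0 pow, folded g_def]
  have g0: "Polynomial.coeff (g k) j = 0 \<longleftrightarrow> Polynomial.coeff (f k) j = 0" for k j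
    using g(1)[of k j] e0[of k] e0[of "Suc k"] p_pos by (metis divide_eq_0_iff mult_eq_0_iff power_eq_0_iff)
  \<comment> \<open>The coefficient ratio is divided by \<open>e k ^ 2 = B k ^ (p + 1)\<close>,
    which leaves \<open>B k\<close> to the power \<open>- p\<close>. The new ratio is thus the
    inverse of the old one.\<close>
  have mg: "mid_ratio (g k) = inverse (B k)" for k
  proof -
    define n where "n = Polynomial.degree (f k)"
    have "n \<ge> 3" using cen[of k] by (simp add: centred_poly_def n_def)
    then have "n - 2 + 2 = n" by simp
    then have n: "e k ^ n = e k ^ (n - 2) * e k ^ 2" by (metis power_add)
    have "mid_ratio (g k) ^ p = (Polynomial.coeff (f k) (n - 2) * e k ^ (n - 2) / e (Suc k)) /
        (Polynomial.coeff (f k) n * e k ^ n / e (Suc k))"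
      unfolding mid_ratio_def g(4) n_def[symmetric] power_divide g(1) ..
    also have "\<dots> = B k / e k ^ 2"
      unfolding n using e0 by (simp add: B_def mid_ratio_def n_def[symmetric])
    also have "\<dots> = inverse (B k) ^ p" using B0[of k] by (simp add: esq power_inverse field_simps)
    finally show ?thesis by (simp only: frob_inj)
  qed
  \<comment> \<open>The translation is relevant only at times with colour \<open>s\<close>. All
    these have the same \<open>e\<close>, so any one of them may be used to scale
    \<open>x0\<close>.\<close>
  define y0 where "y0 = (if \<exists>n. a (Suc n) = s then proot (x0 / e (Suc (SOME n. a (Suc n) = s))) else 0)"
  have y0: "x0 = e (Suc n) * y0 ^ p" if n: "a (Suc n) = s" for n
  proof -
    define m where "m = (SOME n. a (Suc n) = s)"
    have m: "a (Suc m) = s" unfolding m_def using n by (rule someI)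
    obtain c where c: "x0 / e (Suc m) = c ^ p" using root[OF const(3)[OF m] De e0] by blast
    have "y0 = proot (x0 / e (Suc m))" unfolding y0_def m_def using n by auto
    then have "x0 = e (Suc m) * y0 ^ p" using c e0[of "Suc m"] by (simp add: field_simps)
    then show ?thesis using ea[of "Suc m" "Suc n"] m n by simp
  qed
  obtain He where He: "\<And>k. height (e k) \<le> He"
    using finite_range_bound[OF fin, of "\<lambda>g. height (E g)"] unfolding e_def by blast
  have hw: "height (z k) \<le> He + real p * height (w k)" for k
    using height_mult_le[of "e k" "w k ^ p"] height_power_le[of "w k" p] He[of k] w[of k] by simp
  have "dyn_system a g w y0 r s"
    unfolding dyn_system_def
  proof (intro conjI allI impI)
    show "w (Suc k) = poly (g k) (w k)" for k
    proof -
      have "e (Suc k) * w (Suc k) ^ p = e (Suc k) * poly (g k) (w k) ^ p"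
        unfolding g(2) by (simp flip: w z)
      then show ?thesis using e0 by (simp add: frob_inj)
    qed
    show "centred_poly (g k)" for k
      using cen[of k] by (simp add: centred_poly_def g(4) g0)
    have "range g \<subseteq> (\<lambda>(h, h'). twisted_root h (E h) (E h')) ` (range f \<times> range f)"
      by (auto simp: g_def e_def)
    then show "finite (range g)" by (rule finite_subset) (use fin in auto)
    show "g k = g l" if "a k = a l \<and> a (Suc k) = a (Suc l)" for k l
      using that fa[of k l] ea[of k l] ea[of "Suc k" "Suc l"] by (simp add: g_def)
    show "mid_ratio (g k) = mid_ratio (g l)" if "a k = a l" for k l
      using ma[OF that] by (simp add: mg B_def)
    show "\<exists>l\<ge>n. a l = a k \<and> a (Suc l) = a (Suc k)" for k n by (rule recur)
    show "poly (pderiv (g k)) (w k) \<noteq> 0" for k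
      using g(3)[of k "w k"] der[of k] e0 p_pos by (auto simp: power_0_left simp flip: w)
    show "\<exists>n. \<forall>k\<ge>n. C < height (w k)" for C
    proof -
      obtain n where n: "\<And>k. k \<ge> n \<Longrightarrow> He + real p * C < height (z k)" using inf by blast
      have "C < height (w k)" if "k \<ge> n" for k
      proof -
        have "real p * C < real p * height (w k)" using n[OF that] hw[of k] by linarith
        then show ?thesis using p_pos by simp
      qed
      then show ?thesis by blast
    qed
    fix C :: real
    define sd where "sd = support_degree"
    \<comment> \<open>It absorbs the factor \<open>p\<close> by which heights shrink, the height
      bound \<open>He\<close> of the scaling factors, and the support they contribute.\<close>
    define C' where "C' = real p * max C 0 * (1 + (\<Sum>x\<in>E ` range f. sd x)) + \<bar>He\<bar>"
    obtain n where n: "a n = r" "a (Suc n) = s" "z (Suc n) + x0 \<noteq> 0"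
      "C' * (1 + sd (z (Suc n) + x0)) < height (z n)" using top unfolding sd_def by blast
    have y: "z (Suc n) + x0 = e (Suc n) * (w (Suc n) + y0) ^ p"
      using y0[OF n(2)] w[of "Suc n"] by (simp add: frob_add algebra_simps)
    have nz: "w (Suc n) + y0 \<noteq> 0" using n(3) p_pos unfolding y by auto
    define Y where "Y = z (Suc n) + x0"
    have sd0: "0 \<le> sd x" for x by (simp add: sd_def support_degree_nonneg)
    have "sd (w (Suc n) + y0) \<le> sd Y + sd (e (Suc n))"
      unfolding sd_def
    proof (rule support_degree_mono)
      fix v :: "'k \<Rightarrow> int" assume v: "v \<in> places" "v (w (Suc n) + y0) \<noteq> 0"
      have "v Y = v (e (Suc n)) + int p * v (w (Suc n) + y0)"
        unfolding Y_def y using nz e0[of "Suc n"] val_mult[OF v(1), of "e (Suc n)" "(w (Suc n) + y0) ^ p"]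
        by (simp add: val_power[OF v(1)])
      then show "v Y \<noteq> 0 \<or> v (e (Suc n)) \<noteq> 0" using v p_pos by auto
    qed
    also have "sd (e (Suc n)) \<le> (\<Sum>x\<in>E ` range f. sd x)"
      using fin by (intro member_le_sum) (auto simp: e_def sd0)
    finally have *: "sd (w (Suc n) + y0) \<le> sd Y + (\<Sum>x\<in>E ` range f. sd x)" by simp
    have le: "1 + sd (w (Suc n) + y0) \<le> (1 + (\<Sum>x\<in>E ` range f. sd x)) * (1 + sd Y)"
    proof -
      have "0 \<le> (\<Sum>x\<in>E ` range f. sd x) * sd Y" by (intro mult_nonneg_nonneg sum_nonneg sd0)
      then show ?thesis using * by (simp add: algebra_simps)
    qed
    have "real p * (C * (1 + sd (w (Suc n) + y0))) \<le> real p * (max C 0 * (1 + sd (w (Suc n) + y0)))"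
      using sd0[of "w (Suc n) + y0"] by (intro mult_left_mono mult_right_mono) auto
    also have "\<dots> \<le> real p * (max C 0 * ((1 + (\<Sum>x\<in>E ` range f. sd x)) * (1 + sd Y)))"
      using le by (intro mult_left_mono) auto
    also have "\<dots> + \<bar>He\<bar> \<le> C' * (1 + sd Y)"
      using mult_nonneg_nonneg[OF abs_ge_zero[of He] sd0[of Y]] by (simp add: C'_def algebra_simps)
    finally have "real p * (C * (1 + sd (w (Suc n) + y0))) + \<bar>He\<bar> < height (z n)"
      using n(4) unfolding Y_def by simp
    then have "real p * (C * (1 + sd (w (Suc n) + y0))) < real p * height (w n)"
      using hw[of n] by linarith
    then have "C * (1 + sd (w (Suc n) + y0)) < height (w n)" using p_pos by simp
    then show "\<exists>n. a n = r \<and> a (Suc n) = s \<and> w (Suc n) + y0 \<noteq> 0 \<and>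
        C * (1 + support_degree (w (Suc n) + y0)) < height (w n)"
      using n nz unfolding sd_def by blast
  qed
  moreover have "z 0 ^ 2 / mid_ratio (f 0) = (w 0 ^ 2 / mid_ratio (g 0)) ^ p"
  proof -
    have "z 0 ^ 2 / mid_ratio (f 0) = e 0 ^ 2 * (w 0 ^ 2) ^ p / B 0"
      by (simp add: w[of 0] B_def power_mult_distrib flip: power_mult) (simp add: mult.commute)
    also have "\<dots> = (w 0 ^ 2 / mid_ratio (g 0)) ^ p"
      unfolding esq mg using B0[of 0] by (simp add: power_divide power_mult_distrib divide_inverse)
    finally show ?thesis .
  qed
  ultimately show ?thesis by blast
qed

text \<open>Each root extraction divides the pole order of the invariant at the fixed place
  \<open>v\<close> by \<open>p\<close>, so infinite descent applies.\<close>

lemma no_dyn_system: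
  assumes odd: "odd p" and v: "v \<in> places"
    and sys: "dyn_system a f z x0 r s" and neg: "v (z 0 ^ 2 / mid_ratio (f 0)) < 0"
  shows False
proof -
  obtain u where u: "(u :: 'k) \<noteq> 0" "v u = 1" using uniformizer_exists[OF v] by blast
  obtain D :: "'k \<Rightarrow> 'k" where D: "is_derivation D" "\<And>x. D x = 0 \<Longrightarrow> \<exists>y. x = y ^ p"
    using p_basis_derivation[OF v u] by blast
  define N where "N = nat (- v (z 0 ^ 2 / mid_ratio (f 0)))"
  show False
    using sys neg N_def
  proof (induction N arbitrary: f z x0 rule: less_induct)
    case (less N)
    obtain g w y0 where g: "dyn_system a g w y0 r s"
      "z 0 ^ 2 / mid_ratio (f 0) = (w 0 ^ 2 / mid_ratio (g 0)) ^ p"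
      using dyn_system_root[OF D odd less.prems(1)] by blast
    define k where "k = v (w 0 ^ 2 / mid_ratio (g 0))"
    have eq: "v (z 0 ^ 2 / mid_ratio (f 0)) = int p * k"
      unfolding g(2) k_def by (rule val_power[OF v])
    have pk: "int p * k < 0" using less.prems(2) unfolding eq .
    then have "k < 0" by (simp add: mult_less_0_iff)
    moreover have "p \<ge> 2" using prime_ge_2_nat[OF prime_p] .
    then have "int p * (- k) \<ge> 2 * (- k)" using \<open>k < 0\<close> by (intro mult_right_mono) auto
    ultimately have "nat (- k) < N" using less.prems(3) pk unfolding eq by auto
    then show False
      using less.IH[OF _ g(1)] \<open>k < 0\<close> by (simp add: k_def)
  qed
qed

end

subsection \<open>Finite extensions of rational function fields\<close>

lemma span_of_dimension:
  assumes "ring.dimension (ring_of_type_algebra :: 'k::field ring) n F E"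
  shows "\<exists>b :: nat \<Rightarrow> 'k. \<forall>y\<in>E. \<exists>c. (\<forall>i<n. c i \<in> F) \<and> y = (\<Sum>i<n. c i * b i)"
proof -
  let ?K = "ring_of_type_algebra :: 'k ring"
  have R: "ring ?K" by (rule ring_from_type_algebra)
  have sel: "monoid.mult ?K = (*)" "add ?K = (+)" "zero ?K = 0"
    by (simp_all add: ring_of_type_algebra_def fun_eq_iff)
  from assms show ?thesis
  proof (induction rule: ring.dimension.induct[OF R, consumes 1, case_names zero_dim Suc_dim])
    case (zero_dim F)
    have "\<exists>c. (\<forall>i<0 :: nat. c i \<in> F) \<and> y = (\<Sum>i<0. c i * (0 :: 'k))" if "y \<in> {zero ?K}" for y
      using that sel(3) by auto
    then show ?case by (rule exI[of _ "\<lambda>_. 0", OF ballI])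
  next
    case (Suc_dim v E n F)
    then obtain b where "\<forall>y\<in>E. \<exists>c. (\<forall>i<n. c i \<in> F) \<and> y = (\<Sum>i<n. c i * b i)" by (elim exE)
    then have b: "\<exists>c. (\<forall>i<n. c i \<in> F) \<and> y = (\<Sum>i<n. c i * b i)" if "y \<in> E" for y using that by (rule bspec)
    show ?case
    proof (rule exI[of _ "b(n := v)"], rule ballI)
      fix y assume "y \<in> ring.line_extension ?K F v E"
      then obtain k e where y: "k \<in> F" "e \<in> E" "y = k * v + e"
        unfolding ring.line_extension_mem_iff[OF R] sel by blast
      obtain c where c: "\<forall>i<n. c i \<in> F" "e = (\<Sum>i<n. c i * b i)" using b[OF y(2)] by blast
      have y1: "y = (\<Sum>i<Suc n. (c(n := k)) i * (b(n := v)) i)"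
        using c(2) y(3) by (simp add: add.commute)
      have y2: "\<forall>i<Suc n. (c(n := k)) i \<in> F" using c(1) y(1) by (simp add: less_Suc_eq)
      show "\<exists>c. (\<forall>i<Suc n. c i \<in> F) \<and> y = (\<Sum>i<Suc n. c i * (b(n := v)) i)"
        by (rule exI[of _ "c(n := k)"], rule conjI, rule y2, rule y1)
    qed
  qed
qed

context
  fixes \<iota> :: "'f::{finite, field} poly fract \<Rightarrow> 'k::field" and b :: "nat \<Rightarrow> 'k" and n :: nat
  assumes hom: "field_hom \<iota>"
    and span: "\<And>y. \<exists>c. (\<forall>i<n. c i \<in> range \<iota>) \<and> y = (\<Sum>i<n. c i * b i)"
begin

interpretation field_hom \<iota> by (rule hom)

definition scal :: "'f poly \<Rightarrow> 'k" where
  "scal c = \<iota> (to_fract c)"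

lemma scal_simps:
  "scal (c + d) = scal c + scal d" "scal (c * d) = scal c * scal d" "scal 0 = 0" "scal 1 = 1"
  "scal c = 0 \<longleftrightarrow> c = 0"
  by (simp_all add: scal_def hom_add hom_mult)

lemma scal_sum: "scal (sum f I) = (\<Sum>i\<in>I. scal (f i))"
  by (induction I rule: infinite_finite_induct) (auto simp: scal_simps)

text \<open>Elements with polynomial coordinates of bounded degree with respect to the spanning
  family \<open>b\<close>. Such a set is finite, with at most exponentially many elements in
  \<open>D\<close>.\<close>

definition lattice :: "nat \<Rightarrow> 'k set" where
  "lattice D = {\<Sum>i<n. scal (c i) * b i | c. \<forall>i. Polynomial.degree (c i) < D}"

lemma card_degree_less:
  "finite {c :: 'f poly. Polynomial.degree c < D}" "card {c :: 'f poly. Polynomial.degree c < D} \<le> CARD('f) ^ D"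
proof -
  let ?F = "\<lambda>g :: nat \<Rightarrow> 'f. \<Sum>i<D. Polynomial.monom (g i) i"
  have sub: "{c :: 'f poly. Polynomial.degree c < D} \<subseteq> ?F ` ({..<D} \<rightarrow>\<^sub>E UNIV)"
  proof
    fix c :: "'f poly" assume c: "c \<in> {c. Polynomial.degree c < D}"
    have eq: "c = ?F (restrict (Polynomial.coeff c) {..<D})"
    proof (rule poly_eqI)
      fix j
      show "Polynomial.coeff c j = Polynomial.coeff (?F (restrict (Polynomial.coeff c) {..<D})) j"
        using c by (cases "j < D") (auto simp: coeff_sum coeff_eq_0)
    qed
    show "c \<in> ?F ` ({..<D} \<rightarrow>\<^sub>E UNIV)"
      by (rule image_eqI[where x = "restrict (Polynomial.coeff c) {..<D}"], rule eq) auto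
  qed
  have fin: "finite ({..<D} \<rightarrow>\<^sub>E (UNIV :: 'f set))" by (intro finite_PiE) auto
  then show "finite {c :: 'f poly. Polynomial.degree c < D}" using finite_subset[OF sub] by blast
  have "card {c :: 'f poly. Polynomial.degree c < D} \<le> card (?F ` ({..<D} \<rightarrow>\<^sub>E UNIV))"
    using fin sub by (intro card_mono) auto
  also have "\<dots> \<le> card ({..<D} \<rightarrow>\<^sub>E (UNIV :: 'f set))" by (rule card_image_le[OF fin])
  finally show "card {c :: 'f poly. Polynomial.degree c < D} \<le> CARD('f) ^ D" by (simp add: card_PiE)
qed

lemma card_lattice: "finite (lattice D)" "card (lattice D) \<le> CARD('f) ^ (D * n)"
proof -
  let ?P = "{c :: 'f poly. Polynomial.degree c < D}"
  let ?F = "\<lambda>c. \<Sum>i<n. scal (c i) * b i"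
  have sub: "lattice D \<subseteq> ?F ` ({..<n} \<rightarrow>\<^sub>E ?P)"
  proof
    fix y assume "y \<in> lattice D"
    then obtain c where c: "y = ?F c" "\<forall>i. Polynomial.degree (c i) < D" by (auto simp: lattice_def)
    then have eq: "y = ?F (restrict c {..<n})" by simp
    show "y \<in> ?F ` ({..<n} \<rightarrow>\<^sub>E ?P)"
      by (rule image_eqI[where x = "restrict c {..<n}"], rule eq) (use c in auto)
  qed
  have fin: "finite ({..<n} \<rightarrow>\<^sub>E ?P)" using card_degree_less by (intro finite_PiE) auto
  show "finite (lattice D)" using finite_subset[OF sub] fin by blast
  have "card (lattice D) \<le> card (?F ` ({..<n} \<rightarrow>\<^sub>E ?P))" using fin sub by (intro card_mono) auto
  also have "\<dots> \<le> card ({..<n} \<rightarrow>\<^sub>E ?P)" by (rule card_image_le[OF fin])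
  also have "\<dots> = card ?P ^ n" by (simp add: card_PiE)
  also have "\<dots> \<le> (CARD('f) ^ D) ^ n" using card_degree_less by (intro power_mono) auto
  finally show "card (lattice D) \<le> CARD('f) ^ (D * n)" by (simp add: power_mult)
qed

lemma lattice_mono: "D \<le> D' \<Longrightarrow> lattice D \<subseteq> lattice D'"
  unfolding lattice_def by (blast intro: less_le_trans)

lemma lattice_add: "x \<in> lattice D \<Longrightarrow> y \<in> lattice D \<Longrightarrow> x + y \<in> lattice D"
proof -
  assume "x \<in> lattice D" "y \<in> lattice D"
  then obtain c d where *: "x = (\<Sum>i<n. scal (c i) * b i)" "\<forall>i. Polynomial.degree (c i) < D"
    "y = (\<Sum>i<n. scal (d i) * b i)" "\<forall>i. Polynomial.degree (d i) < D" by (auto simp: lattice_def)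
  then show ?thesis unfolding lattice_def
    by (intro CollectI exI[of _ "\<lambda>i. c i + d i"])
      (auto simp: scal_simps algebra_simps sum.distrib intro: degree_add_less)
qed

lemma lattice_scal:
  assumes "x \<in> lattice D" "Polynomial.degree r \<le> d" shows "scal r * x \<in> lattice (D + d)"
proof -
  obtain c where c: "x = (\<Sum>i<n. scal (c i) * b i)" "\<forall>i. Polynomial.degree (c i) < D"
    using assms by (auto simp: lattice_def)
  have "Polynomial.degree (r * c i) < D + d" for i
    using degree_mult_le[of r "c i"] assms(2) c(2)[rule_format, of i] by linarith
  then show ?thesis unfolding lattice_def
    by (intro CollectI exI[of _ "\<lambda>i. r * c i"]) (auto simp: c(1) scal_simps sum_distrib_left mult.assoc)
qed

lemma clear_denominators: "\<exists>q D. q \<noteq> 0 \<and> D > 0 \<and> scal q * y \<in> lattice D"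
proof -
  obtain c where c: "\<forall>i<n. c i \<in> range \<iota>" "y = (\<Sum>i<n. c i * b i)" using span by blast
  have "\<exists>a d. i < n \<longrightarrow> d \<noteq> 0 \<and> c i = \<iota> (Fract a d)" for i
  proof (cases "i < n")
    case True
    then obtain r where r: "c i = \<iota> r" using c by auto
    obtain a d where "r = Fract a d" "d \<noteq> 0" by (cases r)
    then show ?thesis using r by blast
  qed auto
  then obtain a d where ad: "\<And>i. i < n \<Longrightarrow> d i \<noteq> 0" "\<And>i. i < n \<Longrightarrow> c i = \<iota> (Fract (a i) (d i))" by metis
  define q where "q = (\<Prod>i<n. d i)"
  define e where "e i = (if i < n then a i * (\<Prod>j\<in>{..<n} - {i}. d j) else 0)" for i
  have "scal q * c i = scal (e i)" if i: "i < n" for i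
  proof -
    have q: "q = d i * (\<Prod>j\<in>{..<n} - {i}. d j)"
      unfolding q_def using i by (intro prod.remove) auto
    have "to_fract q * Fract (a i) (d i) = to_fract (e i)"
      using ad(1)[OF i] i by (simp add: q e_def Fract_conv_to_fract)
    then show ?thesis unfolding scal_def ad(2)[OF i] by (simp flip: hom_mult)
  qed
  then have "scal q * y = (\<Sum>i<n. scal (e i) * b i)"
    unfolding c(2) sum_distrib_left by (intro sum.cong) (auto simp: mult.assoc[symmetric])
  moreover have "Polynomial.degree (e i) < Suc (\<Sum>j<n. Polynomial.degree (e j))" for i
  proof (cases "i < n")
    case True
    then show ?thesis using member_le_sum[of i "{..<n}" "\<lambda>j. Polynomial.degree (e j)"] by simp
  qed (simp add: e_def)
  moreover have "q \<noteq> 0" using ad(1) by (simp add: q_def)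
  ultimately show ?thesis
    by (intro exI[of _ q] exI[of _ "Suc (\<Sum>j<n. Polynomial.degree (e j))"]) (auto simp: lattice_def)
qed

lemma clear_denominators_finite:
  assumes "finite Y" shows "\<exists>q D. q \<noteq> 0 \<and> D > 0 \<and> (\<forall>y\<in>Y. scal q * y \<in> lattice D)"
  using assms
proof (induction Y rule: finite_induct)
  case empty
  show ?case by (intro exI[of _ 1]) auto
next
  case (insert y Y)
  obtain q D where q: "q \<noteq> 0" "D > 0" "\<forall>y\<in>Y. scal q * y \<in> lattice D" using insert by blast
  obtain r D' where r: "r \<noteq> 0" "D' > 0" "scal r * y \<in> lattice D'" using clear_denominators by blast
  define N where "N = D + Polynomial.degree r + D' + Polynomial.degree q"
  have "scal (q * r) * x \<in> lattice N" if x: "x \<in> insert y Y" for x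
  proof -
    consider "x = y" | "x \<in> Y" using x by blast
    then show ?thesis
    proof cases
      case 1
      have "scal q * (scal r * y) \<in> lattice (D' + Polynomial.degree q)" by (intro lattice_scal r) simp
      then show ?thesis using lattice_mono[of "D' + Polynomial.degree q" N] 1
        by (auto simp: N_def scal_simps mult.assoc)
    next
      case 2
      have "scal r * (scal q * x) \<in> lattice (D + Polynomial.degree r)" using q 2 by (intro lattice_scal) auto
      then show ?thesis using lattice_mono[of "D + Polynomial.degree r" N]
        by (auto simp: N_def scal_simps mult_ac)
    qed
  qed
  then show ?case using q r by (intro exI[of _ "q * r"] exI[of _ N]) (auto simp: N_def)
qed

text \<open>Multiplication by \<open>x\<close> is described on the family \<open>b\<close> by a
  matrix of fractions. \<open>q\<close> clears its denominators, and \<open>\<delta>\<close> bounds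
  the degrees of the cleared entries.\<close>

lemma lattice_mult_bounded: "\<exists>q \<delta>. q \<noteq> 0 \<and> (\<forall>D. \<forall>y\<in>lattice D. scal q * (x * y) \<in> lattice (D + \<delta>))"
proof -
  obtain q D where q: "q \<noteq> 0" "D > 0" "\<forall>y\<in>(\<lambda>i. x * b i) ` {..<n}. scal q * y \<in> lattice D"
    using clear_denominators_finite[of "(\<lambda>i. x * b i) ` {..<n}"] by auto
  then have "\<forall>i. \<exists>c. i < n \<longrightarrow> scal q * (x * b i) = (\<Sum>j<n. scal (c j) * b j) \<and> (\<forall>j. Polynomial.degree (c j) < D)"
    by (auto simp: lattice_def)
  then obtain C where C: "\<And>i. i < n \<Longrightarrow> scal q * (x * b i) = (\<Sum>j<n. scal (C i j) * b j)"
    "\<And>i j. i < n \<Longrightarrow> Polynomial.degree (C i j) < D" by metis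
  have "scal q * (x * y) \<in> lattice (E + D)" if "y \<in> lattice E" for y E
  proof -
    obtain c where c: "y = (\<Sum>i<n. scal (c i) * b i)" "\<forall>i. Polynomial.degree (c i) < E"
      using \<open>y \<in> lattice E\<close> by (auto simp: lattice_def)
    have "scal q * (x * y) = (\<Sum>i<n. scal (c i) * (scal q * (x * b i)))"
      by (simp add: c(1) sum_distrib_left mult_ac)
    also have "\<dots> = (\<Sum>i<n. \<Sum>j<n. scal (c i * C i j) * b j)"
      by (intro sum.cong) (auto simp: C(1) sum_distrib_left scal_simps mult.assoc)
    also have "\<dots> = (\<Sum>j<n. scal (\<Sum>i<n. c i * C i j) * b j)"
      by (subst sum.swap) (simp add: scal_sum sum_distrib_right)
    finally have eq: "scal q * (x * y) = (\<Sum>j<n. scal (\<Sum>i<n. c i * C i j) * b j)" .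
    have "Polynomial.degree (\<Sum>i<n. c i * C i j) < E + D" for j
    proof (rule degree_sum_less)
      fix i assume "i \<in> {..<n}"
      then show "Polynomial.degree (c i * C i j) < E + D"
        using degree_mult_le[of "c i" "C i j"] c(2)[rule_format, of i] C(2)[of i j] by simp
    qed (use q in simp)
    then show ?thesis unfolding eq lattice_def
      by (intro CollectI exI[of _ "\<lambda>j. \<Sum>i<n. c i * C i j"] conjI allI refl)
  qed
  then show ?thesis using q(1) by blast
qed

text \<open>Multiplied by \<open>r * q ^ m\<close>, the digit sums of length \<open>m\<close> land
  in a lattice of degree \<open>D + m * \<delta>\<close>. If they are all distinct, comparing growth
  rates in \<open>m\<close> bounds \<open>card Y\<close> independently of \<open>r\<close> and
  \<open>D\<close>, which depend on \<open>Y\<close>.\<close>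

lemma growth_bound:
  "\<exists>R. \<forall>Y. finite Y \<longrightarrow> (\<forall>m. card (digits (x :: 'k) Y m) = card Y ^ m) \<longrightarrow> card Y \<le> R"
proof -
  obtain q \<delta>' where q: "q \<noteq> 0" "\<And>D y. y \<in> lattice D \<Longrightarrow> scal q * (x * y) \<in> lattice (D + \<delta>')"
    using lattice_mult_bounded by blast
  define \<delta> where "\<delta> = \<delta>' + Polynomial.degree q"
  have qx: "scal q * (x * y) \<in> lattice (D + \<delta>)" if "y \<in> lattice D" for y D
    using q(2)[OF that] lattice_mono[of "D + \<delta>'" "D + \<delta>"] by (auto simp: \<delta>_def)
  let ?Q = "CARD('f)"
  have "card Y \<le> ?Q ^ (\<delta> * n)" if Y: "finite Y" "\<And>m. card (digits x Y m) = card Y ^ m" for Y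
  proof (cases "Y = {}")
    case False
    obtain r D where r: "r \<noteq> 0" "D > 0" "\<forall>y\<in>Y. scal r * y \<in> lattice D"
      using clear_denominators_finite[OF Y(1)] by blast
    have dig: "scal (r * q ^ m) * s \<in> lattice (D + m * \<delta>)" if "s \<in> digits x Y m" for m s
      using that
    proof (induction m arbitrary: s)
      case 0
      have "0 \<in> lattice D" unfolding lattice_def using r(2)
        by (intro CollectI exI[of _ "\<lambda>_. 0"]) (auto simp: scal_simps)
      then show ?case using 0 by simp
    next
      case (Suc m)
      then obtain y t where s: "s = y + x * t" "y \<in> Y" "t \<in> digits x Y m" by auto
      have "Polynomial.degree (q ^ Suc m) \<le> Polynomial.degree q * Suc m" by (rule degree_power_le)
      also have "\<dots> \<le> Suc m * \<delta>" by (simp add: \<delta>_def algebra_simps)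
      finally have "scal (q ^ Suc m) * (scal r * y) \<in> lattice (D + Suc m * \<delta>)"
        using r(3) s(2) by (intro lattice_scal) auto
      moreover have "scal q * (x * (scal (r * q ^ m) * t)) \<in> lattice (D + Suc m * \<delta>)"
        using qx[OF Suc.IH[OF s(3)]] by (simp add: algebra_simps)
      ultimately have "scal (q ^ Suc m) * (scal r * y) + scal q * (x * (scal (r * q ^ m) * t)) \<in> lattice (D + Suc m * \<delta>)"
        by (rule lattice_add)
      moreover have "scal (r * q ^ Suc m) * s = scal (q ^ Suc m) * (scal r * y) + scal q * (x * (scal (r * q ^ m) * t))"
        by (simp add: s(1) scal_simps algebra_simps)
      ultimately show ?case by simp
    qed
    have "real m * ln (real (card Y)) \<le> real m * ln (real (?Q ^ (\<delta> * n))) + ln (real (?Q ^ (D * n)))" for m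
    proof -
      let ?h = "\<lambda>s. scal (r * q ^ m) * s"
      have nz: "scal (r * q ^ m) \<noteq> 0" using r q by (simp add: scal_simps(5))
      have "card Y ^ m = card (?h ` digits x Y m)"
        using nz by (subst card_image) (auto simp: Y(2) inj_on_def)
      also have "\<dots> \<le> card (lattice (D + m * \<delta>))" using dig card_lattice(1) by (intro card_mono) auto
      also have "\<dots> \<le> ?Q ^ ((D + m * \<delta>) * n)" by (rule card_lattice(2))
      also have "\<dots> = (?Q ^ (\<delta> * n)) ^ m * ?Q ^ (D * n)"
        by (simp add: algebra_simps flip: power_mult power_add)
      finally have "real (card Y ^ m) \<le> real ((?Q ^ (\<delta> * n)) ^ m * ?Q ^ (D * n))" unfolding of_nat_le_iff .
      then have "real (card Y) ^ m \<le> real (?Q ^ (\<delta> * n)) ^ m * real (?Q ^ (D * n))"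
        by (simp only: of_nat_mult of_nat_power)
      moreover have pos: "real (card Y) > 0" "real (?Q ^ (\<delta> * n)) > 0" "real (?Q ^ (D * n)) > 0"
        using False Y(1) by (auto simp: card_gt_0_iff)
      moreover have "real m * ln x \<le> real m * ln y + ln z" if "x ^ m \<le> y ^ m * z" "x > 0" "y > 0" "z > 0"
        for x y z :: real
      proof -
        have "ln (x ^ m) \<le> ln (y ^ m * z)" using that by (subst ln_le_cancel_iff) auto
        then show ?thesis using that by (simp add: ln_mult ln_realpow)
      qed
      ultimately show ?thesis by blast
    qed
    then have "ln (real (card Y)) \<le> ln (real (?Q ^ (\<delta> * n)))" by (rule le_of_nat_mult_le)
    moreover have "real (card Y) > 0" "real (?Q ^ (\<delta> * n)) > 0" using False Y(1) by (auto simp: card_gt_0_iff)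
    ultimately have "real (card Y) \<le> real (?Q ^ (\<delta> * n))" by (simp only: ln_le_cancel_iff)
    then show ?thesis by (simp only: of_nat_le_iff)
  qed simp
  then show ?thesis by blast
qed

end

lemma function_field_of_extension:
  fixes \<iota> :: "'p::prime_card mod_ring poly fract \<Rightarrow> 'k::field"
  assumes "finite_separable_extension \<iota>"
  shows "function_field TYPE('k) CARD('p)"
proof
  have hom: "field_hom \<iota>" using assms by (simp add: finite_separable_extension_def)
  interpret field_hom \<iota> by (rule hom)
  have R: "ring (ring_of_type_algebra :: 'k ring)" by (rule ring_from_type_algebra)
  show "Factorial_Ring.prime CARD('p)" by (rule prime_card)
  have "(of_nat CARD('p) :: 'p mod_ring poly) = 0" by (simp add: of_nat_poly)
  then have "(of_nat CARD('p) :: 'p mod_ring poly fract) = 0"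
    unfolding of_nat_fract by (simp add: Zero_fract_def)
  then show "of_nat CARD('p) = (0 :: 'k)" by (metis hom_of_nat hom_zero)
  obtain n where "ring.dimension (ring_of_type_algebra :: 'k ring) n (range \<iota>) UNIV"
    using assms unfolding finite_separable_extension_def ring.finite_dimension_def[OF R] by blast
  from span_of_dimension[OF this] obtain b :: "nat \<Rightarrow> 'k" where
    "\<And>y. \<exists>c. (\<forall>i<n. c i \<in> range \<iota>) \<and> y = (\<Sum>i<n. c i * b i)" by blast
  from growth_bound[OF hom this]
  show "\<exists>R. \<forall>Y. finite Y \<longrightarrow> (\<forall>m. card (digits (x :: 'k) Y m) = card Y ^ m) \<longrightarrow> card Y \<le> R" for x .
qed

subsection \<open>Centring the polynomials\<close>

lemma coeff_pcompose_shift: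
  fixes f :: "'a::field poly"
  shows "Polynomial.coeff (pcompose f [:c, 1:]) j =
    (\<Sum>i\<le>Polynomial.degree f. Polynomial.coeff f i * (of_nat (i choose j) * c ^ (i - j)))"
proof -
  have "pcompose f [:c, 1:] = (\<Sum>i\<le>Polynomial.degree f. pcompose (Polynomial.monom (Polynomial.coeff f i) i) [:c, 1:])"
    by (subst poly_as_sum_of_monoms[of f, symmetric]) (rule pcompose_sum)
  also have "\<dots> = (\<Sum>i\<le>Polynomial.degree f. smult (Polynomial.coeff f i) ([:c, 1:] ^ i))"
    by (intro sum.cong refl) (simp add: pcompose_altdef map_poly_monom poly_monom)
  finally have eq: "pcompose f [:c, 1:] = (\<Sum>i\<le>Polynomial.degree f. smult (Polynomial.coeff f i) ([:c, 1:] ^ i))" .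
  have "Polynomial.coeff ([:c, 1:] ^ i) j = of_nat (i choose j) * c ^ (i - j)" for i
  proof (cases "j \<le> i")
    case False
    then have "Polynomial.coeff ([:c, 1:] ^ i) j = 0"
      by (intro coeff_eq_0) (simp add: degree_linear_power)
    then show ?thesis using False by (simp add: binomial_eq_0)
  qed (simp add: coeff_linear_poly_power)
  then show ?thesis unfolding eq by (simp add: coeff_sum)
qed

definition centre_shift :: "'a::field poly \<Rightarrow> 'a" where
  "centre_shift f = - Polynomial.coeff f (Polynomial.degree f - 1) /
     (of_nat (Polynomial.degree f) * Polynomial.lead_coeff f)"

text \<open>The source is centred for \<open>f\<close>, the target for the polynomial
  \<open>g\<close> applied next. Orbits remain orbits in the moving coordinate, at the cost of a
  dependence on two consecutive polynomials.\<close>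

definition centre :: "'a::field poly \<Rightarrow> 'a poly \<Rightarrow> 'a poly" where
  "centre f g = pcompose f [:centre_shift f, 1:] - [:centre_shift g:]"

lemma poly_centre: "poly (centre f g) (x - centre_shift f) = poly f x - centre_shift g"
  by (simp add: centre_def poly_pcompose)

context function_field
begin

text \<open>For the shifted polynomial, \<open>2 * d * A0\<close> times the coefficient below the
  vanishing one is exactly \<open>delta_poly f\<close>. The target shift changes the constant
  coefficient only.\<close>

lemma centre_coeffs:
  fixes f g :: "'k poly"
  assumes odd: "odd p" and deg: "Polynomial.degree f \<ge> 3" "(of_nat (Polynomial.degree f) :: 'k) \<noteq> 0"
    and delta: "delta_poly f \<noteq> 0"
  shows "centred_poly (centre f g)" "mid_ratio (centre f g) = mid_ratio (pcompose f [:centre_shift f, 1:])"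
proof -
  define n where "n = Polynomial.degree f - 2"
  have d: "Polynomial.degree f = Suc (Suc n)" "n \<ge> 1" using deg by (auto simp: n_def)
  define c where "c = centre_shift f"
  define h where "h = pcompose f [:c, 1:]"
  define A0 where "A0 = Polynomial.coeff f (Suc (Suc n))"
  define A1 where "A1 = Polynomial.coeff f (Suc n)"
  define A2 where "A2 = Polynomial.coeff f n"
  have A0: "A0 \<noteq> 0" using d deg by (metis A0_def degree_0 leading_coeff_0_iff not_numeral_le_zero)
  have dc: "(of_nat (Suc (Suc n)) :: 'k) \<noteq> 0" using deg(2) d(1) by simp
  have c: "of_nat (Suc (Suc n)) * A0 * c = - A1"
    using A0 dc by (simp add: c_def centre_shift_def d A0_def A1_def del: of_nat_Suc)
  have hj: "Polynomial.coeff h j = (\<Sum>i\<in>{j..Suc (Suc n)}. Polynomial.coeff f i * (of_nat (i choose j) * c ^ (i - j)))" for j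
    unfolding h_def coeff_pcompose_shift d(1)
    by (rule sum.mono_neutral_right) (auto simp: binomial_eq_0)
  have s0: "(of_nat (Suc 0) :: 'k) = 1" by simp
  have h0: "Polynomial.coeff h (Suc (Suc n)) = A0" by (simp add: hj A0_def)
  have h1: "Polynomial.coeff h (Suc n) = 0"
  proof -
    have "{Suc n..Suc (Suc n)} = {Suc n, Suc (Suc n)}" by auto
    then have "Polynomial.coeff h (Suc n) = A1 + of_nat (Suc (Suc n)) * A0 * c"
      unfolding hj by (simp add: A0_def A1_def mult_ac s0 del: of_nat_Suc)
    then show ?thesis by (simp add: c del: of_nat_Suc)
  qed
  have h2: "Polynomial.coeff h n \<noteq> 0"
  proof -
    let ?b = "of_nat (Suc (Suc n) choose n) :: 'k"
    have b: "2 * ?b = of_nat (Suc (Suc n)) * of_nat (Suc n)"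
    proof -
      have "Suc (Suc n) choose n = Suc (Suc n) choose 2"
        using binomial_symmetric[of n "Suc (Suc n)"] by (simp add: numeral_2_eq_2)
      moreover have "2 * (Suc (Suc n) choose 2) = Suc (Suc n) * Suc n"
        by (simp add: choose_two)
      ultimately have "2 * (Suc (Suc n) choose n) = Suc (Suc n) * Suc n" by simp
      then have "(of_nat (2 * (Suc (Suc n) choose n)) :: 'k) = of_nat (Suc (Suc n) * Suc n)" by (simp only:)
      then show ?thesis by (simp only: of_nat_mult of_nat_numeral)
    qed
    have "{n..Suc (Suc n)} = {n, Suc n, Suc (Suc n)}" by auto
    then have "Polynomial.coeff h n = A2 + A1 * (of_nat (Suc n) * c) + A0 * (?b * c ^ 2)"
      unfolding hj by (simp add: A0_def A1_def A2_def add.assoc numeral_2_eq_2 s0 del: of_nat_Suc)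
    then have "2 * of_nat (Suc (Suc n)) * A0 * Polynomial.coeff h n =
      2 * of_nat (Suc (Suc n)) * A0 * A2 + 2 * A1 * of_nat (Suc n) * (of_nat (Suc (Suc n)) * A0 * c)
        + (2 * ?b) * A0 * c * (of_nat (Suc (Suc n)) * A0 * c)"
      by (simp add: algebra_simps power2_eq_square del: of_nat_Suc)
    also have "(2 * ?b) * A0 * c = of_nat (Suc n) * (of_nat (Suc (Suc n)) * A0 * c)"
      unfolding b by (simp only: mult_ac)
    also have "2 * of_nat (Suc (Suc n)) * A0 * A2 + 2 * A1 * of_nat (Suc n) * (of_nat (Suc (Suc n)) * A0 * c)
        + of_nat (Suc n) * (of_nat (Suc (Suc n)) * A0 * c) * (of_nat (Suc (Suc n)) * A0 * c) =
      2 * of_nat (Suc (Suc n)) * A0 * A2 - of_nat (Suc n) * A1 ^ 2"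
      unfolding c by (simp add: algebra_simps power2_eq_square del: of_nat_Suc)
    also have "\<dots> = delta_poly f"
      by (simp add: delta_poly_def Let_def top_coeff_def d A0_def A1_def A2_def)
    finally show ?thesis using delta by auto
  qed
  have hd: "Polynomial.degree h = Suc (Suc n)" by (simp add: h_def degree_pcompose d)
  have ch: "Polynomial.coeff (centre f g) j = Polynomial.coeff h j" if "j \<ge> 1" for j
    using that by (cases j) (auto simp: centre_def h_def c_def)
  have cd: "Polynomial.degree (centre f g) = Suc (Suc n)"
  proof (rule antisym)
    show "Polynomial.degree (centre f g) \<le> Suc (Suc n)"
    proof (rule degree_le, intro allI impI)
      fix i assume i: "Suc (Suc n) < i"
      then show "Polynomial.coeff (centre f g) i = 0" using ch[of i] hd by (simp add: coeff_eq_0)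
    qed
    show "Suc (Suc n) \<le> Polynomial.degree (centre f g)"
      using ch[of "Suc (Suc n)"] h0 A0 by (intro le_degree) simp
  qed
  show "centred_poly (centre f g)"
    using ch[of "Suc n"] ch[of n] h1 h2 d dc unfolding centred_poly_def cd by (simp del: of_nat_Suc)
  show "mid_ratio (centre f g) = mid_ratio (pcompose f [:centre_shift f, 1:])"
    using ch[of "Suc (Suc n)"] ch[of n] d unfolding mid_ratio_def cd h_def[unfolded c_def, symmetric]
    by (simp add: hd)
qed

end

subsection \<open>Heights along orbits\<close>

primrec orb :: "(nat \<Rightarrow> 'a::field poly) \<Rightarrow> 'a \<Rightarrow> nat \<Rightarrow> 'a" where
  "orb \<gamma> x 0 = x"
| "orb \<gamma> x (Suc n) = poly (\<gamma> n) (orb \<gamma> x n)"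

lemma seq_act_Aff: "seq_act \<gamma> n (Aff x) = Aff (orb \<gamma> x n)"
  by (induction n) (auto simp: poly_act_def)

lemma seq_act_Infty: "seq_act \<gamma> n Infty = Infty"
  by (induction n) (auto simp: poly_act_def)

lemma orb_add: "orb \<gamma> x (m + n) = orb (\<lambda>i. \<gamma> (i + m)) (orb \<gamma> x m) n"
  by (induction n) (auto simp: add.commute)

lemma seq_degree_add: "seq_degree \<gamma> (m + n) = seq_degree \<gamma> m * seq_degree (\<lambda>i. \<gamma> (i + m)) n"
  by (induction n) (auto simp: seq_degree_def lessThan_Suc add.commute mult_ac)

lemma seq_degree_Suc: "seq_degree \<gamma> (Suc n) = seq_degree \<gamma> n * Polynomial.degree (\<gamma> n)"
  by (simp add: seq_degree_def)

lemma seq_degree_ge: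
  assumes "\<And>n. Polynomial.degree (\<gamma> n) \<ge> 2" shows "2 ^ n \<le> seq_degree \<gamma> n"
proof (induction n)
  case (Suc n)
  then show ?case unfolding seq_degree_Suc
    using mult_mono[OF Suc assms[of n]] by (simp add: mult.commute)
qed (simp add: seq_degree_def)

lemma to_ac_poly: "poly (map_poly to_ac f) (to_ac x) = to_ac (poly f x)"
proof (induction f)
  case (pCons a f)
  have "map_poly to_ac (pCons a f) = pCons (to_ac a) (map_poly to_ac f)"
    by (intro poly_eqI) (auto simp: coeff_map_poly coeff_pCons split: nat.split)
  then show ?case by (simp add: pCons.IH)
qed simp

lemma orb_to_ac: "orb (\<lambda>i. map_poly to_ac (\<gamma> i)) (to_ac x) n = to_ac (orb \<gamma> x n)"
  by (induction n) (auto simp: to_ac_poly)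

lemma adjoin_ac_to_ac: "adjoin_ac (to_ac (y :: 'k::field)) = range to_ac"
proof -
  let ?R = "ring_of_type_algebra :: 'k alg_closure ring"
  have R: "field ?R" by (rule field_from_type_algebra)
  interpret R: field ?R by (rule R)
  have car: "carrier ?R = UNIV" and sel: "zero ?R = 0" "one ?R = 1" "monoid.mult ?R = (*)" "add ?R = (+)"
    by (simp_all add: ring_of_type_algebra_def fun_eq_iff)
  have "h \<in> range to_ac" if "h \<in> generate_field ?R (range to_ac)" for h
    using that
  proof (induction rule: generate_field.induct)
    case one
    show ?case unfolding sel to_ac_1[symmetric] by (rule rangeI)
  next
    case (a_inv h)
    have "h + a_inv ?R h = 0" using R.r_neg[of h] unfolding car sel by simp
    then have neg: "a_inv ?R h = - h" by (simp add: add_eq_0_iff)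
    obtain x where "h = to_ac x" using a_inv.IH by blast
    then show ?case unfolding neg using rangeI[of to_ac "- x"] by simp
  next
    case (m_inv h)
    have "h \<in> Units ?R" using m_inv.hyps unfolding R.field_Units car by simp
    then have "h * m_inv ?R h = 1" using R.Units_r_inv[of h] unfolding sel by simp
    then have inv: "m_inv ?R h = inverse h" by (simp add: inverse_unique)
    obtain x where "h = to_ac x" using m_inv.IH by blast
    then show ?case unfolding inv using rangeI[of to_ac "inverse x"] by simp
  next
    case (eng_add h1 h2)
    then obtain x y where "h1 = to_ac x" "h2 = to_ac y" by blast
    then show ?case unfolding sel using rangeI[of to_ac "x + y"] by simp
  next
    case (eng_mult h1 h2)
    then obtain x y where "h1 = to_ac x" "h2 = to_ac y" by blast
    then show ?case unfolding sel using rangeI[of to_ac "x * y"] by simp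
  qed
  then have "generate_field ?R (range to_ac) = range to_ac"
    by (auto intro: generate_field.incl)
  then show ?thesis unfolding adjoin_ac_def by (simp add: insert_absorb)
qed

lemma place_of_range_to_ac:
  assumes w: "w \<in> valuations (range (to_ac :: 'k::field \<Rightarrow> _))"
  shows "(\<lambda>x. w (to_ac x)) \<in> places"
proof -
  have im: "range to_ac - {0} = to_ac ` (UNIV - {0 :: 'k})" by auto
  have "w ` (to_ac ` (UNIV - {0 :: 'k})) = UNIV" using w unfolding valuations_def im by blast
  then have "(\<lambda>x. w (to_ac x)) ` (UNIV - {0 :: 'k}) = UNIV" by (simp add: image_image)
  moreover have "w (to_ac (x * y)) = w (to_ac x) + w (to_ac y)" if "x \<noteq> 0" "y \<noteq> 0" for x y :: 'k
    using w that unfolding valuations_def im by auto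
  moreover have "min (w (to_ac x)) (w (to_ac y)) \<le> w (to_ac (x + y))"
    if "x \<noteq> 0" "y \<noteq> 0" "x + y \<noteq> 0" for x y :: 'k
  proof -
    have "to_ac x + to_ac y \<noteq> 0" using that(3) by (metis to_ac_add to_ac_eq_0_iff)
    then show ?thesis using w that unfolding valuations_def im by auto
  qed
  moreover have "w (to_ac (0 :: 'k)) = 0" using w by (simp add: valuations_def)
  ultimately show ?thesis by (auto simp: valuations_def)
qed

text \<open>The fixed dummy value outside the subfield makes a valuation determined by its
  restriction.\<close>

lemma inj_place_of_range_to_ac:
  "inj_on (\<lambda>w x. w (to_ac x)) (valuations (range (to_ac :: 'k::field \<Rightarrow> _)))"
proof (rule inj_onI, rule ext)
  fix w w' :: "'k alg_closure \<Rightarrow> int" and y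
  assume *: "w \<in> valuations (range to_ac)" "w' \<in> valuations (range to_ac)"
    "(\<lambda>x. w (to_ac x)) = (\<lambda>x. w' (to_ac x))"
  show "w y = w' y"
  proof (cases "y \<in> range to_ac")
    case True
    then show ?thesis using fun_cong[OF *(3)] by auto
  next
    case False
    then show ?thesis using *(1,2) by (simp add: valuations_def)
  qed
qed

text \<open>Knowing where the poles can be turns the infinite sum into a finite one, so no question
  of summability arises. The local degrees and the field degree stay unevaluated.\<close>

lemma weil_height_eq:
  fixes T :: "('k::field \<Rightarrow> int) set"
  assumes T: "finite T" and y: "\<And>v. v \<in> places \<Longrightarrow> v \<notin> T \<Longrightarrow> pole_order v y = 0"
  defines "W \<equiv> {w \<in> valuations (range to_ac). (\<lambda>x. w (to_ac x)) \<in> T}"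
  shows "finite W" "weil_height (Aff (to_ac y)) = (\<Sum>w\<in>W. real (local_degree (range (to_ac :: 'k \<Rightarrow> _)) w) /
    real (ring.dim (ring_of_type_algebra :: 'k alg_closure ring) (range to_ac) (range (to_ac :: 'k \<Rightarrow> _)))
      * of_int (pole_order (\<lambda>x. w (to_ac x)) y))"
proof -
  let ?L = "range (to_ac :: 'k \<Rightarrow> _)"
  let ?d = "real (ring.dim (ring_of_type_algebra :: 'k alg_closure ring) ?L ?L)"
  show fin: "finite W"
  proof (rule finite_imageD)
    show "finite ((\<lambda>w x. w (to_ac x)) ` W)" by (rule finite_subset[OF _ T]) (auto simp: W_def)
    show "inj_on (\<lambda>w x. w (to_ac x)) W"
      by (rule inj_on_subset[OF inj_place_of_range_to_ac]) (auto simp: W_def)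
  qed
  have p0: "pole_order (\<lambda>x. w (to_ac x)) y = - min (w (to_ac y)) 0" for w by (simp add: pole_order_def)
  have "field_height ?L (to_ac y) = (\<Sum>w\<in>W. real (local_degree ?L w) * of_int (pole_order (\<lambda>x. w (to_ac x)) y))"
  proof (cases "y = 0")
    case True
    have "pole_order (\<lambda>x. w (to_ac x)) 0 = 0" if "w \<in> W" for w
      using val_zero[OF place_of_range_to_ac, of w] that by (simp add: W_def pole_order_def)
    then show ?thesis using True by (simp add: field_height_def)
  next
    case False
    have "(\<Sum>\<^sub>\<infinity>w\<in>valuations ?L. real_of_int (min (w (to_ac y)) 0) * real (local_degree ?L w)) =
      (\<Sum>\<^sub>\<infinity>w\<in>W. real_of_int (min (w (to_ac y)) 0) * real (local_degree ?L w))"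
    proof (rule infsum_cong_neutral)
      fix w assume "w \<in> valuations ?L - W"
      then have "pole_order (\<lambda>x. w (to_ac x)) y = 0"
        using y[OF place_of_range_to_ac, of w] by (auto simp: W_def)
      then show "real_of_int (min (w (to_ac y)) 0) * real (local_degree ?L w) = 0" unfolding p0 by simp
    qed (auto simp: W_def)
    then show ?thesis
      using False fin unfolding field_height_def p0 by (simp add: sum_negf mult.commute)
  qed
  then show "weil_height (Aff (to_ac y)) = (\<Sum>w\<in>W. real (local_degree ?L w) / ?d * of_int (pole_order (\<lambda>x. w (to_ac x)) y))"
    by (simp add: weil_height_def adjoin_ac_to_ac sum_divide_distrib)
qed

context function_field
begin

lemma poly_pole_order_bound:
  fixes S :: "'k poly set"
  assumes "finite S"
  obtains T c where "finite T" "T \<subseteq> places" "\<And>v. v \<in> places \<Longrightarrow> v \<notin> T \<Longrightarrow> c v = 0" "\<And>v. 0 \<le> c v"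
    "\<And>f v x. f \<in> S \<Longrightarrow> v \<in> places \<Longrightarrow>
      pole_order v (poly f x) \<le> int (Polynomial.degree f) * pole_order v x + c v"
    "\<And>f v j. f \<in> S \<Longrightarrow> v \<in> places \<Longrightarrow> vge v (- c v) (Polynomial.coeff f j)"
proof -
  define Y where "Y = (\<Union>f\<in>S. range (Polynomial.coeff f))"
  have "range (Polynomial.coeff f) \<subseteq> Polynomial.coeff f ` {..Polynomial.degree f} \<union> {0}" for f :: "'k poly"
    by (metis (no_types, lifting) UnI1 UnI2 atMost_iff coeff_eq_0 image_eqI image_subsetI insertI1 not_le)
  then have "finite (range (Polynomial.coeff f))" for f :: "'k poly"
    by (rule finite_subset) auto
  then have "finite Y" using assms by (auto simp: Y_def)
  then obtain T E where T: "finite T" "T \<subseteq> places" "\<And>w. w \<in> places \<Longrightarrow> w \<notin> T \<Longrightarrow> E w = 0"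
    "\<And>y w. y \<in> Y \<Longrightarrow> w \<in> places \<Longrightarrow> vge w (- int (E w)) y"
    by (rule finite_set_bound) (rule that, assumption+)
  have co: "vge v (- int (E v)) (Polynomial.coeff f j)" if "f \<in> S" "v \<in> places" for f v j
    using T(4)[of "Polynomial.coeff f j" v] that by (auto simp: Y_def)
  have "pole_order v (poly f x) \<le> int (Polynomial.degree f) * pole_order v x + int (E v)"
    if "f \<in> S" "v \<in> places" for f v x
  proof (rule pole_order_le[OF that(2)])
    have "vge v (- int (E v) - int (Polynomial.degree f) * pole_order v x) (poly f x)"
      using co that by (intro vge_poly that vge_pole_order pole_order_nonneg) auto
    then show "vge v (- (int (Polynomial.degree f) * pole_order v x + int (E v))) (poly f x)"
      by (simp add: algebra_simps)
  qed (simp add: pole_order_nonneg)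
  then show ?thesis using that[of T "\<lambda>v. int (E v)"] T co by simp
qed

lemma height_poly_bound:
  fixes S :: "'k poly set"
  assumes "finite S"
  obtains C where "C \<ge> 0" "\<And>f x. f \<in> S \<Longrightarrow> height (poly f x) \<le> real (Polynomial.degree f) * height x + C"
proof -
  obtain T c where T: "finite T" "T \<subseteq> places" "\<And>v. v \<in> places \<Longrightarrow> v \<notin> T \<Longrightarrow> c v = 0" "\<And>v. 0 \<le> c v"
    "\<And>f v x. f \<in> S \<Longrightarrow> v \<in> places \<Longrightarrow>
      pole_order v (poly f x) \<le> int (Polynomial.degree f) * pole_order v x + c v"
    using poly_pole_order_bound[OF assms] by metis
  define C where "C = (\<Sum>v\<in>T. place_degree v * of_int (c v))"
  have "height (poly f x) \<le> real (Polynomial.degree f) * height x + C" if f: "f \<in> S" for f x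
  proof -
    define U where "U = T \<union> {v \<in> places. pole_order v x \<noteq> 0} \<union> {v \<in> places. pole_order v (poly f x) \<noteq> 0}"
    have U: "finite U" "U \<subseteq> places" using T finite_poles by (auto simp: U_def)
    have "height (poly f x) = (\<Sum>v\<in>U. place_degree v * of_int (pole_order v (poly f x)))"
      using U by (intro height_eq) (auto simp: U_def)
    also have "\<dots> \<le> (\<Sum>v\<in>U. place_degree v * (real (Polynomial.degree f) * of_int (pole_order v x) + of_int (c v)))"
    proof (intro sum_mono mult_left_mono)
      fix v assume "v \<in> U"
      then have v: "v \<in> places" using U by auto
      show "0 \<le> place_degree v" using place_degree_pos[OF v] by simp
      have "real_of_int (pole_order v (poly f x)) \<le> of_int (int (Polynomial.degree f) * pole_order v x + c v)"
        using T(5)[OF f v, of x] by (simp only: of_int_le_iff)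
      then show "real_of_int (pole_order v (poly f x)) \<le> real (Polynomial.degree f) * of_int (pole_order v x) + of_int (c v)"
        by simp
    qed
    also have "\<dots> = real (Polynomial.degree f) * (\<Sum>v\<in>U. place_degree v * of_int (pole_order v x))
        + (\<Sum>v\<in>U. place_degree v * of_int (c v))"
      by (simp add: algebra_simps sum.distrib sum_distrib_left)
    also have "(\<Sum>v\<in>U. place_degree v * of_int (pole_order v x)) = height x"
      using U by (intro height_eq[symmetric]) (auto simp: U_def)
    also have "(\<Sum>v\<in>U. place_degree v * of_int (c v)) = C"
      unfolding C_def using T U by (intro sum.mono_neutral_right) (auto simp: U_def)
    finally show ?thesis .
  qed
  moreover have "C \<ge> 0" unfolding C_def using T
    by (intro sum_nonneg mult_nonneg_nonneg) (auto simp: place_degree_pos less_imp_le)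
  ultimately show ?thesis using that by blast
qed

text \<open>Adding \<open>C\<close> makes the recursion purely multiplicative, since
  \<open>2 * C\<close> is at most the degree times \<open>C\<close>.\<close>

lemma orb_height_bound:
  assumes C: "C \<ge> 0" "\<And>n x. height (poly (\<gamma> n) x) \<le> real (Polynomial.degree (\<gamma> n)) * height x + C"
    and deg: "\<And>n. Polynomial.degree (\<gamma> n) \<ge> 2"
  shows "height (orb \<gamma> x n :: 'k) + C \<le> real (seq_degree \<gamma> n) * (height x + C)"
proof (induction n)
  case 0
  then show ?case by (simp add: seq_degree_def)
next
  case (Suc n)
  let ?d = "real (Polynomial.degree (\<gamma> n))"
  have "2 * C \<le> ?d * C" using deg[of n] C(1) by (intro mult_right_mono) auto
  then have "height (orb \<gamma> x (Suc n)) + C \<le> ?d * (height (orb \<gamma> x n) + C)"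
    using C(2)[of n "orb \<gamma> x n"] by (simp add: algebra_simps)
  also have "\<dots> \<le> ?d * (real (seq_degree \<gamma> n) * (height x + C))"
    using Suc by (intro mult_left_mono) auto
  finally show ?case by (simp add: seq_degree_Suc mult_ac)
qed

lemma integral_orb:
  assumes v: "v \<in> places" and co: "\<And>n j. vge v 0 (Polynomial.coeff (\<gamma> n) j)" and x: "vge v 0 x"
  shows "vge v 0 (orb \<gamma> x n)"
proof (induction n)
  case (Suc n)
  have "vge v (0 - int (Polynomial.degree (\<gamma> n)) * 0) (poly (\<gamma> n) (orb \<gamma> x n))"
    using Suc co by (intro vge_poly v) auto
  then show ?case by simp
qed (use x in simp)

lemma congruent_orb:
  assumes v: "v \<in> places" and co: "\<And>n j. vge v 0 (Polynomial.coeff (\<gamma> n) j)"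
    and x: "vge v 0 x" "vge v 0 y" "vge v 1 (x - y)"
  shows "vge v 1 (orb \<gamma> x n - orb \<gamma> y n)"
proof (induction n)
  case (Suc n)
  let ?a = "orb \<gamma> x n" and ?b = "orb \<gamma> y n"
  have ab: "vge v 0 ?a" "vge v 0 ?b" using integral_orb[OF v co] x by auto
  have "vge v 1 (poly f ?a - poly f ?b) \<and> vge v 0 (poly f ?b)"
    if "\<And>j. vge v 0 (Polynomial.coeff f j)" for f
    using that
  proof (induction f)
    case (pCons c f)
    have cf: "vge v 0 (Polynomial.coeff f j)" for j using pCons.prems[of "Suc j"] by simp
    have c: "vge v 0 c" using pCons.prems[of 0] by simp
    have IH: "vge v 1 (poly f ?a - poly f ?b)" "vge v 0 (poly f ?b)" using pCons.IH cf by auto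
    have "vge v 1 ((poly f ?a - poly f ?b) * ?a)" "vge v 1 ((?a - ?b) * poly f ?b)" "vge v 0 (?b * poly f ?b)"
      using vge_mult0[OF v] IH ab Suc by blast+
    moreover have "poly (pCons c f) ?a - poly (pCons c f) ?b =
        (poly f ?a - poly f ?b) * ?a + (?a - ?b) * poly f ?b" by (simp add: algebra_simps)
    ultimately show ?case using c v by (simp add: vge_add)
  qed simp
  then show ?case using co by simp
qed (use x in simp)

end

lemma sum_UN_le:
  fixes f :: "'b \<Rightarrow> real"
  assumes "finite I" "\<And>i. i \<in> I \<Longrightarrow> finite (A i)" "\<And>i x. i \<in> I \<Longrightarrow> x \<in> A i \<Longrightarrow> 0 \<le> f x"
  shows "sum f (\<Union>i\<in>I. A i) \<le> (\<Sum>i\<in>I. sum f (A i))"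
  using assms
proof (induction I rule: finite_induct)
  case (insert i I)
  have "sum f (A i \<union> (\<Union>i\<in>I. A i)) \<le> sum f (A i) + sum f (\<Union>i\<in>I. A i)"
    using insert by (subst sum_Un) (auto intro!: sum_nonneg)
  moreover have "sum f (\<Union>i\<in>I. A i) \<le> (\<Sum>i\<in>I. sum f (A i))"
    by (rule insert.IH) (use insert.prems in auto)
  ultimately show ?case using insert.hyps by simp
qed simp

context function_field
begin

text \<open>
  The orbit has poles in a finite set only, so the Weil height, whatever the local degrees are, is at
  most a constant times \<open>height\<close>.
\<close>

lemma height_orb_ge:
  fixes S :: "'k poly set"
  assumes S: "finite S" "\<And>f. f \<in> S \<Longrightarrow> Polynomial.degree f \<ge> 2" and \<gamma>: "\<gamma> \<in> sequences S"
    and pos: "canonical_height \<gamma> (Aff (to_ac x)) > 0"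
  shows "\<exists>c>0. \<exists>n0. \<forall>n\<ge>n0. c * real (seq_degree \<gamma> n) \<le> height (orb \<gamma> x n)"
proof -
  have \<gamma>S: "\<gamma> n \<in> S" for n using \<gamma> by (simp add: sequences_def)
  obtain T c where T: "finite T" "T \<subseteq> places" "\<And>v. v \<in> places \<Longrightarrow> v \<notin> T \<Longrightarrow> c v = 0" "\<And>v. 0 \<le> c v"
    "\<And>f v x. f \<in> S \<Longrightarrow> v \<in> places \<Longrightarrow>
      pole_order v (poly f x) \<le> int (Polynomial.degree f) * pole_order v x + c v"
    using poly_pole_order_bound[OF S(1)] by metis
  define y where "y = orb \<gamma> x"
  define D where "D n = real (seq_degree \<gamma> n)" for n
  have D2: "2 ^ n \<le> D n" for n
    using seq_degree_ge[of \<gamma> n] S(2)[OF \<gamma>S] by (simp add: D_def)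
  have D0: "D n > 0" for n using less_le_trans[OF zero_less_power[of 2 n] D2[of n]] by simp
  define U where "U = T \<union> {v \<in> places. pole_order v x \<noteq> 0}"
  have U: "finite U" using T finite_poles by (simp add: U_def)
  have yU: "pole_order v (y n) = 0" if "v \<in> places" "v \<notin> U" for v n
  proof (induction n)
    case 0 then show ?case using that by (simp add: y_def U_def)
  next
    case (Suc n)
    have "pole_order v (y (Suc n)) \<le> 0"
      using T(5)[OF \<gamma>S[of n] that(1), of "y n"] Suc T(3)[OF that(1)] that(2) by (simp add: y_def U_def)
    then show ?case using pole_order_nonneg[of v "y (Suc n)"] by linarith
  qed
  define W where "W = {w \<in> valuations (range (to_ac :: 'k \<Rightarrow> _)). (\<lambda>x. w (to_ac x)) \<in> U}"
  define N where "N w = real (local_degree (range (to_ac :: 'k \<Rightarrow> _)) w) /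
    real (ring.dim (ring_of_type_algebra :: 'k alg_closure ring) (range to_ac) (range (to_ac :: 'k \<Rightarrow> _)))" for w
  define h where "h a = (\<Sum>w\<in>W. N w * of_int (pole_order (\<lambda>x. w (to_ac x)) a))" for a :: 'k
  have finW: "finite W" unfolding W_def by (rule weil_height_eq(1)[OF U yU[of _ 0]])
  have wh: "weil_height (Aff (to_ac (y n))) = h (y n)" for n
    using weil_height_eq(2)[OF U yU[of _ n]] unfolding h_def W_def N_def .
  have N0: "N w \<ge> 0" for w by (simp add: N_def)
  have Wp: "(\<lambda>x. w (to_ac x)) \<in> places" if "w \<in> W" for w
    using that place_of_range_to_ac by (auto simp: W_def)
  have h0: "h a \<ge> 0" for a
    unfolding h_def by (intro sum_nonneg mult_nonneg_nonneg N0) (simp add: pole_order_nonneg)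
  define C where "C = (\<Sum>w\<in>W. N w * of_int (c (\<lambda>x. w (to_ac x))))"
  have C0: "C \<ge> 0" unfolding C_def by (intro sum_nonneg mult_nonneg_nonneg N0) (simp add: T(4))
  have hstep: "h (y (Suc n)) \<le> real (Polynomial.degree (\<gamma> n)) * h (y n) + C" for n
  proof -
    have "h (y (Suc n)) \<le> (\<Sum>w\<in>W. N w * (real (Polynomial.degree (\<gamma> n)) * of_int (pole_order (\<lambda>x. w (to_ac x)) (y n))
        + of_int (c (\<lambda>x. w (to_ac x)))))"
      unfolding h_def
    proof (intro sum_mono mult_left_mono N0)
      fix w assume "w \<in> W"
      then have "real_of_int (pole_order (\<lambda>x. w (to_ac x)) (y (Suc n))) \<le>
        of_int (int (Polynomial.degree (\<gamma> n)) * pole_order (\<lambda>x. w (to_ac x)) (y n) + c (\<lambda>x. w (to_ac x)))"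
        unfolding of_int_le_iff y_def orb.simps by (intro T(5) \<gamma>S Wp)
      then show "real_of_int (pole_order (\<lambda>x. w (to_ac x)) (y (Suc n))) \<le>
        real (Polynomial.degree (\<gamma> n)) * of_int (pole_order (\<lambda>x. w (to_ac x)) (y n)) + of_int (c (\<lambda>x. w (to_ac x)))"
        by simp
    qed
    also have "\<dots> = real (Polynomial.degree (\<gamma> n)) * h (y n) + C"
      by (simp add: h_def C_def algebra_simps sum.distrib sum_distrib_left)
    finally show ?thesis .
  qed
  \<comment> \<open>This normalised sequence is decreasing and nonnegative, so it converges. Hence
    the \<open>lim\<close> in \<open>canonical_height\<close> is a genuine limit.\<close>
  define s where "s n = (h (y n) + C) / D n" for n
  have "s (Suc n) \<le> s n" for n
  proof -
    let ?d = "real (Polynomial.degree (\<gamma> n))"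
    have d: "?d \<ge> 2" using S(2)[OF \<gamma>S[of n]] by simp
    have DS: "D (Suc n) = D n * ?d" by (simp add: D_def seq_degree_Suc)
    have "2 * C \<le> ?d * C" using d C0 by (intro mult_right_mono) auto
    then have "h (y (Suc n)) + C \<le> ?d * (h (y n) + C)" using hstep[of n] by (simp add: algebra_simps)
    then have "s (Suc n) \<le> (?d * (h (y n) + C)) / (D n * ?d)"
      unfolding s_def DS using D0[of n] d by (intro divide_right_mono) auto
    also have "\<dots> = s n" using d by (simp add: s_def)
    finally show ?thesis .
  qed
  then have "decseq s" by (simp add: decseq_Suc_iff)
  moreover have "\<And>n. 0 \<le> s n" using h0 C0 D0 by (simp add: s_def less_imp_le)
  ultimately obtain L where L: "s \<longlonglongrightarrow> L" using decseq_convergent[of s 0] by blast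
  have CD: "(\<lambda>n. C / D n) \<longlonglongrightarrow> 0"
  proof (rule tendsto_sandwich)
    show "\<forall>\<^sub>F n in sequentially. 0 \<le> C / D n" using C0 D0 by (simp add: less_imp_le)
    have "C / D n \<le> C * (1 / 2) ^ n" for n
    proof -
      have "C / D n \<le> C / 2 ^ n" using C0 D2[of n] by (intro divide_left_mono mult_pos_pos D0) auto
      then show ?thesis by (simp add: power_divide)
    qed
    then show "\<forall>\<^sub>F n in sequentially. C / D n \<le> C * (1 / 2) ^ n" by simp
    show "(\<lambda>n. C * (1 / 2) ^ n) \<longlonglongrightarrow> 0" by (intro tendsto_mult_right_zero LIMSEQ_realpow_zero) auto
  qed simp
  have "(\<lambda>n. h (y n) / D n) \<longlonglongrightarrow> L - 0"
    using tendsto_diff[OF L CD] by (simp add: s_def add_divide_distrib)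
  then have hL: "(\<lambda>n. h (y n) / D n) \<longlonglongrightarrow> L" by simp
  have "canonical_height \<gamma> (Aff (to_ac x)) = lim (\<lambda>n. h (y n) / D n)"
    unfolding canonical_height_def seq_act_Aff orb_to_ac D_def by (simp add: wh flip: y_def)
  also have "\<dots> = L" using hL by (rule limI)
  finally have Lpos: "L > 0" using pos by simp
  then have "\<forall>\<^sub>F n in sequentially. L / 2 < h (y n) / D n" using hL by (intro order_tendstoD(1)) auto
  then obtain n0 where n0: "\<And>n. n \<ge> n0 \<Longrightarrow> L / 2 < h (y n) / D n" by (auto simp: eventually_sequentially)
  \<comment> \<open>A single pole order is at most \<open>height a / ln 2\<close>, because every
    place has degree at least \<open>ln 2\<close>. Adding 1 keeps the constant positive.\<close>
  define K where "K = (\<Sum>w\<in>W. N w) / ln 2 + 1"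
  have ln2: "ln (2 :: real) > 0" by simp
  have SN: "(\<Sum>w\<in>W. N w) \<ge> 0" by (intro sum_nonneg N0)
  have K: "K > 0" using divide_nonneg_pos[OF SN ln2] by (simp add: K_def)
  have hle: "h a \<le> K * height a" for a
  proof -
    have "h a \<le> (\<Sum>w\<in>W. N w * (height a / ln 2))"
      unfolding h_def
    proof (intro sum_mono mult_left_mono N0)
      fix w assume "w \<in> W"
      define v where "v = (\<lambda>x. w (to_ac x))"
      have v: "v \<in> places" using Wp[OF \<open>w \<in> W\<close>] by (simp add: v_def)
      let ?P = "{v \<in> places. pole_order v a \<noteq> 0}"
      have "ln 2 * of_int (pole_order v a) \<le> place_degree v * of_int (pole_order v a)"
        using place_degree_ge[OF v] by (intro mult_right_mono) (auto simp: pole_order_nonneg)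
      also have "\<dots> \<le> (\<Sum>v\<in>insert v ?P. place_degree v * of_int (pole_order v a))"
        using finite_poles[of a] v
        by (intro member_le_sum) (auto simp: pole_order_nonneg place_degree_pos less_imp_le)
      also have "\<dots> = height a" using finite_poles[of a] v by (intro height_eq[symmetric]) auto
      finally show "real_of_int (pole_order (\<lambda>x. w (to_ac x)) a) \<le> height a / ln 2"
        using ln2 by (simp add: field_simps v_def)
    qed
    also have "\<dots> = ((\<Sum>w\<in>W. N w) / ln 2) * height a" by (simp add: sum_distrib_right sum_divide_distrib)
    also have "\<dots> \<le> K * height a" using height_nonneg[of a] by (intro mult_right_mono) (auto simp: K_def)
    finally show ?thesis .
  qed
  have "(L / (2 * K)) * D n \<le> height (y n)" if "n \<ge> n0" for n
  proof -
    have "L / 2 * D n \<le> h (y n)" using n0[OF that] D0[of n] by (simp add: field_simps)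
    also have "\<dots> \<le> K * height (y n)" by (rule hle)
    finally show ?thesis using K by (simp add: field_simps)
  qed
  then show ?thesis
    using Lpos K by (intro exI[of _ "L / (2 * K)"]) (auto simp: D_def y_def)
qed

section \<open>Support of orbit points without primitive divisors\<close>

text \<open>If a block of the sequence maps 0 to 0, its periodic repetition \<psi> again belongs to
  \<open>sequences S\<close> and gives 0 a finite orbit, hence canonical height 0.\<close>

lemma orb_zero_nonzero:
  fixes S :: "'k poly set"
  assumes deg: "\<And>f. f \<in> S \<Longrightarrow> Polynomial.degree f \<ge> 2" and \<gamma>: "\<gamma> \<in> sequences S"
    and pre: "Aff 0 \<notin> PrePer S" and k: "k \<ge> 1"
  shows "orb (\<lambda>i. \<gamma> (i + m)) 0 k \<noteq> 0"
proof
  assume zero: "orb (\<lambda>i. \<gamma> (i + m)) 0 k = 0"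
  define \<psi> where "\<psi> i = \<gamma> (i mod k + m)" for i
  have \<psi>: "\<psi> \<in> sequences S" using \<gamma> by (simp add: sequences_def \<psi>_def)
  have first: "orb \<psi> 0 j = orb (\<lambda>i. \<gamma> (i + m)) 0 j" if "j \<le> k" for j
    using that by (induction j) (auto simp: \<psi>_def)
  have shift: "(\<lambda>i. \<psi> (i + k)) = \<psi>" by (simp add: \<psi>_def fun_eq_iff)
  have per: "orb \<psi> 0 (k + j) = orb \<psi> 0 j" for j
    unfolding orb_add shift using first[of k] zero by simp
  have "orb \<psi> 0 n \<in> orb \<psi> 0 ` {..<k}" for n
  proof (induction n rule: less_induct)
    case (less n)
    show ?case
    proof (cases "n < k")
      case False
      then have "orb \<psi> 0 n = orb \<psi> 0 (n - k)" using per[of "n - k"] by simp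
      then show ?thesis using less[of "n - k"] False k by simp
    qed auto
  qed
  then have fin: "range (orb \<psi> 0) \<subseteq> orb \<psi> 0 ` {..<k}" by auto
  define g where "g a = \<bar>weil_height (Aff (to_ac a))\<bar>" for a :: 'k
  have "bdd_above (g ` range (orb \<psi> 0))"
    using finite_subset[OF fin] by (intro bdd_above_finite) auto
  then obtain B where B: "\<And>n. g (orb \<psi> 0 n) \<le> B" by (auto simp: bdd_above_def)
  have \<psi>S: "\<psi> n \<in> S" for n using \<psi> by (simp add: sequences_def)
  have D2: "2 ^ n \<le> real (seq_degree \<psi> n)" for n
    using seq_degree_ge[of \<psi> n] deg[OF \<psi>S] by simp
  define q where "q n = weil_height (Aff (to_ac (orb \<psi> 0 n))) / real (seq_degree \<psi> n)" for n
  have "q \<longlonglongrightarrow> 0"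
  proof (rule tendsto_0_le[where K = 1])
    show "(\<lambda>n. B * (1 / 2) ^ n) \<longlonglongrightarrow> 0" by (intro tendsto_mult_right_zero LIMSEQ_realpow_zero) auto
    have "norm (q n) \<le> B * (1 / 2) ^ n" for n
    proof -
      have B0: "B \<ge> 0" using B[of n] by (simp add: g_def)
      have "norm (q n) = g (orb \<psi> 0 n) / real (seq_degree \<psi> n)" by (simp add: q_def g_def)
      also have "\<dots> \<le> B / 2 ^ n" using B[of n] D2[of n] B0 by (intro frac_le) auto
      finally show ?thesis by (simp add: power_divide)
    qed
    then have "norm (q n) \<le> norm (B * (1 / 2) ^ n) * 1" for n
      by (metis abs_ge_self mult.right_neutral order_trans real_norm_def)
    then show "\<forall>\<^sub>F n in sequentially. norm (q n) \<le> norm (B * (1 / 2) ^ n) * 1" by (intro always_eventually allI)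
  qed
  moreover have "canonical_height \<psi> (Aff 0) = lim q"
    unfolding canonical_height_def q_def
    using orb_to_ac[of \<psi> 0] by (simp add: seq_act_Aff)
  ultimately have "canonical_height \<psi> (Aff 0) = 0" by (simp add: limI)
  then show False using pre \<psi> by (auto simp: PrePer_def)
qed

lemma zero_places_le_height:
  assumes y: "(y :: 'k) \<noteq> 0" shows "(\<Sum>v\<in>{v \<in> places. v y > 0}. place_degree v) \<le> height y"
proof -
  have "(\<Sum>v\<in>{v \<in> places. v y > 0}. place_degree v) \<le> (\<Sum>v\<in>{v \<in> places. v y > 0}. place_degree v * of_int (v y))"
  proof (rule sum_mono)
    fix v assume v: "v \<in> {v \<in> places. v y > 0}"
    have "place_degree v * 1 \<le> place_degree v * of_int (v y)"
      using v place_degree_pos[of v] by (intro mult_left_mono) auto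
    then show "place_degree v \<le> place_degree v * of_int (v y)" by simp
  qed
  also have "\<dots> \<le> height y" using finite_zeros[OF y] y by (intro zeros_le_height) auto
  finally show ?thesis .
qed

text \<open>Outside the finite set \<open>U\<close> of bad places the orbit is integral, so only
  zeros count, and each is a zero of an earlier point. Fewer than \<open>n\<close> elements
  \<open>a m\<close>, each of small height, account for all of them.\<close>

lemma non_primitive_support:
  fixes S :: "'k poly set"
  assumes S: "finite S" "\<And>f. f \<in> S \<Longrightarrow> Polynomial.degree f \<ge> 2" and \<gamma>: "\<gamma> \<in> sequences S"
    and pre: "Aff 0 \<notin> PrePer S" and nz: "\<And>n. n \<ge> 1 \<Longrightarrow> orb \<gamma> x n \<noteq> 0"
  shows "\<exists>K\<ge>0. \<forall>n. (\<forall>v\<in>places. v (orb \<gamma> x n) > 0 \<longrightarrow> (\<exists>m. 1 \<le> m \<and> m < n \<and> v (orb \<gamma> x m) > 0)) \<longrightarrow>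
    support_degree (orb \<gamma> x n) \<le> K + K * real n * (real (seq_degree \<gamma> n) / 2 ^ (n div 2))"
proof -
  have \<gamma>S: "\<gamma> n \<in> S" for n using \<gamma> by (simp add: sequences_def)
  have d2: "Polynomial.degree (\<gamma> n) \<ge> 2" for n using S(2) \<gamma>S by blast
  define y where "y = orb \<gamma> x"
  define D where "D n = real (seq_degree \<gamma> n)" for n
  obtain C where C: "C \<ge> 0" "\<And>f x. f \<in> S \<Longrightarrow> height (poly f x) \<le> real (Polynomial.degree f) * height x + C"
    using height_poly_bound[OF S(1)] by blast
  obtain T c where T: "finite T" "T \<subseteq> places" "\<And>v. v \<in> places \<Longrightarrow> v \<notin> T \<Longrightarrow> c v = 0"
    "\<And>f v j. f \<in> S \<Longrightarrow> v \<in> places \<Longrightarrow> vge v (- c v) (Polynomial.coeff f j)"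
    using poly_pole_order_bound[OF S(1)] by metis
  define U where "U = T \<union> {v \<in> places. pole_order v x \<noteq> 0}"
  have U: "finite U" "U \<subseteq> places" using T finite_poles by (auto simp: U_def)
  define w where "w m n = orb (\<lambda>i. \<gamma> (i + m)) 0 (n - m)" for m n
  have wnz: "w m n \<noteq> 0" if "m < n" for m n
    unfolding w_def using that by (intro orb_zero_nonzero[OF S(2) \<gamma> pre]) auto
  define K0 where "K0 = height x + height (0 :: 'k) + C"
  have K0: "K0 \<ge> 0" using height_nonneg[of x] height_nonneg[of "0 :: 'k"] C by (simp add: K0_def)
  define R where "R = (\<Sum>v\<in>U. place_degree v)"
  have pd0: "0 \<le> place_degree v" if "v \<in> places" for v :: "'k \<Rightarrow> int"
    using place_degree_pos[OF that] by simp
  have R0: "R \<ge> 0" unfolding R_def using U pd0 by (intro sum_nonneg) auto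
  have DD: "D n = D m * real (seq_degree (\<lambda>i. \<gamma> (i + m)) (n - m))" if "m \<le> n" for m n
    using seq_degree_add[of \<gamma> m "n - m"] that by (simp add: D_def)
  have sd: "2 ^ k \<le> real (seq_degree (\<lambda>i. \<gamma> (i + m)) k)" for m k
    using seq_degree_ge[of "\<lambda>i. \<gamma> (i + m)" k] d2 by simp
  have hy: "height (y m) \<le> K0 * D m" for m
  proof -
    have "height (y m) + C \<le> D m * (height x + C)"
      unfolding y_def D_def using C \<gamma>S d2 by (intro orb_height_bound) auto
    also have "\<dots> \<le> D m * K0" using height_nonneg[of "0 :: 'k"] by (intro mult_left_mono) (auto simp: K0_def D_def)
    finally show ?thesis using C by (simp add: mult.commute)
  qed
  have hw: "height (w m n) \<le> K0 * real (seq_degree (\<lambda>i. \<gamma> (i + m)) (n - m))" for m n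
  proof -
    have "height (w m n) + C \<le> real (seq_degree (\<lambda>i. \<gamma> (i + m)) (n - m)) * (height (0 :: 'k) + C)"
      unfolding w_def using C \<gamma>S d2 by (intro orb_height_bound) auto
    also have "\<dots> \<le> real (seq_degree (\<lambda>i. \<gamma> (i + m)) (n - m)) * K0"
      using height_nonneg[of x] by (intro mult_left_mono) (auto simp: K0_def)
    finally show ?thesis using C by (simp add: mult.commute)
  qed
  have int: "vge v 0 (Polynomial.coeff (\<gamma> n) j)" "vge v 0 x" if "v \<in> places" "v \<notin> U" for v n j
    using T(4)[OF \<gamma>S[of n] that(1), of j] T(3)[OF that(1)] vge_pole_order[of v x] that by (auto simp: U_def)
  have inty: "vge v 0 (y n)" if "v \<in> places" "v \<notin> U" for v n
    unfolding y_def using that int by (intro integral_orb)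
  have "support_degree (y n) \<le> (R + K0) + (R + K0) * real n * (D n / 2 ^ (n div 2))"
    if Z: "\<And>v. v \<in> places \<Longrightarrow> v (y n) > 0 \<Longrightarrow> \<exists>m. 1 \<le> m \<and> m < n \<and> v (y m) > 0" for n
  proof -
    \<comment> \<open>Either choice omits at least \<open>n div 2\<close> of the \<open>n\<close>
      degree factors, each of which is at least 2. This is where the denominator
      \<open>2 ^ (n div 2)\<close> comes from.\<close>
    define a where "a m = (if m \<le> n div 2 then y m else w m n)" for m
    define A where "A m = {v \<in> places. v (a m) > 0}" for m
    have anz: "a m \<noteq> 0" if "m \<in> {1..<n}" for m
      using that nz[of m] wnz[of m n] by (auto simp: a_def y_def)
    have sub: "{v \<in> places. v (y n) \<noteq> 0} \<subseteq> U \<union> (\<Union>m\<in>{1..<n}. A m)"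
    proof
      fix v assume "v \<in> {v \<in> places. v (y n) \<noteq> 0}"
      then have v: "v \<in> places" "v (y n) \<noteq> 0" by auto
      show "v \<in> U \<union> (\<Union>m\<in>{1..<n}. A m)"
      proof (cases "v \<in> U")
        case False
        have yn0: "y n \<noteq> 0" using v val_zero[OF v(1)] by auto
        then have "v (y n) > 0" using inty[OF v(1) False, of n] v(2) by (simp add: vge_def)
        then obtain m where m: "1 \<le> m" "m < n" "v (y m) > 0" using Z v(1) by blast
        have "v (a m) > 0"
        proof (cases "m \<le> n div 2")
          case True then show ?thesis using m by (simp add: a_def)
        next
          case big: False
          have "vge v 1 (orb (\<lambda>i. \<gamma> (i + m)) (y m) (n - m) - w m n)"
            unfolding w_def
          proof (rule congruent_orb[OF v(1)])
            show "vge v 0 (Polynomial.coeff (\<gamma> (k + m)) j)" for k j using int[OF v(1) False] by blast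
            show "vge v 0 (y m)" "vge v 0 0" "vge v 1 (y m - 0)"
              using inty[OF v(1) False] m by (auto simp: vge_def)
          qed
          moreover have "orb (\<lambda>i. \<gamma> (i + m)) (y m) (n - m) = y n"
            using orb_add[of \<gamma> x m "n - m"] m by (simp add: y_def)
          ultimately have "vge v 1 (y n - w m n)" by simp
          moreover have "vge v 1 (y n)" using \<open>v (y n) > 0\<close> by (simp add: vge_def)
          ultimately have "vge v 1 (w m n)"
            using vge_diff[OF v(1), of 1 "y n" "y n - w m n"] by simp
          then show ?thesis using wnz[OF m(2)] big by (simp add: a_def vge_def)
        qed
        then show ?thesis using m v by (auto simp: A_def)
      qed simp
    qed
    have finA: "finite (A m)" if "m \<in> {1..<n}" for m unfolding A_def using finite_zeros[OF anz[OF that]] .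
    have Ap: "A m \<subseteq> places" for m by (auto simp: A_def)
    have half: "2 ^ (n div 2) * z \<le> D n" if "z * 2 ^ k \<le> D n" "n div 2 \<le> k" "z \<ge> 0" for z :: real and k
    proof -
      have "(2 :: real) ^ (n div 2) \<le> 2 ^ k" using that by (intro power_increasing) auto
      then have "2 ^ (n div 2) * z \<le> 2 ^ k * z" using that by (intro mult_right_mono)
      then show ?thesis using that by (simp add: mult.commute)
    qed
    have ha: "height (a m) \<le> K0 * (D n / 2 ^ (n div 2))" if m: "m \<in> {1..<n}" for m
    proof -
      let ?e = "real (seq_degree (\<lambda>i. \<gamma> (i + m)) (n - m))"
      have Dn: "D n = D m * ?e" using DD[of m n] m by simp
      have D0: "D m \<ge> 0" by (simp add: D_def)
      have "2 ^ (n div 2) * (if m \<le> n div 2 then D m else ?e) \<le> D n"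
      proof (cases "m \<le> n div 2")
        case True
        have "D m * 2 ^ (n - m) \<le> D n" unfolding Dn by (intro mult_left_mono sd D0)
        then show ?thesis using half[of "D m" "n - m"] True D0 by simp
      next
        case False
        have "D m \<ge> 2 ^ m" using sd[of m 0] by (simp add: D_def)
        then have "?e * 2 ^ m \<le> D n" unfolding Dn by (subst mult.commute) (intro mult_right_mono, auto)
        then show ?thesis using half[of ?e m] False by simp
      qed
      then have "(if m \<le> n div 2 then D m else ?e) \<le> D n / 2 ^ (n div 2)" by (simp add: field_simps)
      then have "K0 * (if m \<le> n div 2 then D m else ?e) \<le> K0 * (D n / 2 ^ (n div 2))"
        by (intro mult_left_mono K0)
      then show ?thesis using hy[of m] hw[of m n] by (auto simp: a_def split: if_splits)
    qed
    have finW: "finite (U \<union> (\<Union>m\<in>{1..<n}. A m))" using U finA by blast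
    have pW: "0 \<le> place_degree v" if "v \<in> U \<union> (\<Union>m\<in>{1..<n}. A m)" for v
      using that U(2) Ap pd0 by blast
    have "support_degree (y n) \<le> (\<Sum>v\<in>U \<union> (\<Union>m\<in>{1..<n}. A m). place_degree v)"
      unfolding support_degree_def using sub finW pW by (intro sum_mono2) blast+
    also have "\<dots> \<le> R + (\<Sum>v\<in>(\<Union>m\<in>{1..<n}. A m). place_degree v)"
    proof -
      have "0 \<le> (\<Sum>v\<in>U \<inter> (\<Union>m\<in>{1..<n}. A m). place_degree v)"
        using pW by (intro sum_nonneg) blast
      then show ?thesis unfolding R_def using finW by (subst sum_Un) auto
    qed
    also have "(\<Sum>v\<in>(\<Union>m\<in>{1..<n}. A m). place_degree v) \<le> (\<Sum>m\<in>{1..<n}. \<Sum>v\<in>A m. place_degree v)"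
      using finA pW by (intro sum_UN_le) blast+
    also have "\<dots> \<le> (\<Sum>m\<in>{1..<n}. K0 * (D n / 2 ^ (n div 2)))"
    proof (rule sum_mono)
      fix m assume m: "m \<in> {1..<n}"
      show "(\<Sum>v\<in>A m. place_degree v) \<le> K0 * (D n / 2 ^ (n div 2))"
        using zero_places_le_height[OF anz[OF m]] ha[OF m] unfolding A_def by linarith
    qed
    also have "\<dots> = real (n - 1) * (K0 * (D n / 2 ^ (n div 2)))" by simp
    also have "\<dots> \<le> real n * ((R + K0) * (D n / 2 ^ (n div 2)))"
      using R0 K0 by (intro mult_mono mult_right_mono) (auto simp: D_def)
    finally show ?thesis using K0 by (simp add: mult_ac)
  qed
  then show ?thesis using R0 K0 by (intro exI[of _ "R + K0"]) (auto simp: y_def D_def)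
qed

end

section \<open>From an infinite Zsigmondy set to a dynamical system\<close>

lemma div_two_power_tendsto: "(\<lambda>n. real n / 2 ^ (n div 2)) \<longlonglongrightarrow> 0"
proof -
  define u :: "nat \<Rightarrow> real" where "u k = 2 * (real k * (1 / 2) ^ k) + (1 / 2) ^ k" for k
  have "u \<longlonglongrightarrow> 2 * 0 + 0"
    unfolding u_def by (intro tendsto_add tendsto_mult tendsto_const powser_times_n_limit_0 LIMSEQ_realpow_zero) auto
  moreover have "filterlim (\<lambda>n :: nat. n div 2) sequentially sequentially"
    unfolding filterlim_at_top
  proof
    fix m :: nat
    show "\<forall>\<^sub>F n in sequentially. m \<le> n div 2"
      by (rule eventually_sequentiallyI[of "2 * m"]) simp
  qed
  ultimately have lim: "(\<lambda>n. u (n div 2)) \<longlonglongrightarrow> 0" using filterlim_compose by fastforce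
  have "real n / 2 ^ (n div 2) \<le> u (n div 2)" for n
  proof -
    have "real n \<le> 2 * real (n div 2) + 1" by linarith
    then have "real n / 2 ^ (n div 2) \<le> (2 * real (n div 2) + 1) / 2 ^ (n div 2)"
      by (intro divide_right_mono) auto
    then show ?thesis by (simp add: u_def power_divide add_divide_distrib)
  qed
  then show ?thesis
    by (intro tendsto_sandwich[OF _ _ tendsto_const lim] always_eventually allI) auto
qed

context function_field
begin

lemma finite_zsigmondy_set:
  fixes S :: "'k poly set"
  assumes odd: "odd p" and S: "finite S" "\<And>f. f \<in> S \<Longrightarrow> Polynomial.degree f \<ge> 3"
    "\<And>f. f \<in> S \<Longrightarrow> (of_nat (Polynomial.degree f) :: 'k) \<noteq> 0" "\<And>f. f \<in> S \<Longrightarrow> delta_poly f \<noteq> 0"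
    and pre: "Aff 0 \<notin> PrePer S" and good: "(\<gamma>, P) \<in> good_pairs S"
  shows "finite (zsigmondy_set \<gamma> P)"
proof (rule ccontr)
  assume inf: "infinite (zsigmondy_set \<gamma> P)"
  have \<gamma>: "\<gamma> \<in> sequences S" and pos: "canonical_height \<gamma> (map_proj_line to_ac P) > 0"
    and orbit: "Aff 0 \<notin> seq_orbit \<gamma> P" "Infty \<notin> seq_orbit \<gamma> P"
    using good by (auto simp: good_pairs_def)
  have \<gamma>S: "\<gamma> n \<in> S" for n using \<gamma> by (simp add: sequences_def)
  obtain x where P: "P = Aff x"
  proof (cases P)
    case Infty
    then have "Infty \<in> seq_orbit \<gamma> P"
      unfolding seq_orbit_def by (intro CollectI exI[of _ 1]) (simp add: seq_act_Infty)
    then show ?thesis using orbit by blast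
  qed (use that in blast)
  define y where "y = orb \<gamma> x"
  have yS: "y (Suc n) = poly (\<gamma> n) (y n)" for n by (simp add: y_def)
  have nz: "y n \<noteq> 0" if "n \<ge> 1" for n
  proof
    assume "y n = 0"
    then have "Aff 0 \<in> seq_orbit \<gamma> P"
      unfolding seq_orbit_def using that by (intro CollectI exI[of _ n]) (simp add: P seq_act_Aff y_def)
    then show False using orbit by blast
  qed
  have S2: "Polynomial.degree f \<ge> 2" if "f \<in> S" for f using S(2)[OF that] by simp
  obtain c n0 where c: "c > 0" "\<And>n. n \<ge> n0 \<Longrightarrow> c * real (seq_degree \<gamma> n) \<le> height (y n)"
    using height_orb_ge[OF S(1) S2 \<gamma>, of x] pos by (auto simp: P y_def)
  obtain K where K: "K \<ge> 0" "\<And>n. (\<forall>v\<in>places. v (y n) > 0 \<longrightarrow> (\<exists>m. 1 \<le> m \<and> m < n \<and> v (y m) > 0)) \<Longrightarrow>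
      support_degree (y n) \<le> K + K * real n * (real (seq_degree \<gamma> n) / 2 ^ (n div 2))"
    using non_primitive_support[OF S(1) S2 \<gamma> pre, of x] nz unfolding y_def by blast
  define Z where "Z = zsigmondy_set \<gamma> P"
  have Z1: "n \<ge> 1" if "n \<in> Z" for n using that by (simp add: Z_def zsigmondy_set_def)
  have Z: "support_degree (y n) \<le> K + K * real n * (real (seq_degree \<gamma> n) / 2 ^ (n div 2))" if n: "n \<in> Z" for n
  proof (rule K(2), intro ballI impI)
    fix v :: "'k \<Rightarrow> int" assume v: "v \<in> places" "v (y n) > 0"
    have vp: "val_pt v (seq_act \<gamma> m P) > 0 \<longleftrightarrow> v (y m) > 0" if "m \<ge> 1" for m
      using nz[OF that] by (simp add: val_pt_def P seq_act_Aff y_def)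
    have "\<not> primitive_prime_divisor \<gamma> P n v" using n by (simp add: Z_def zsigmondy_set_def)
    then obtain m where "1 \<le> m" "m \<le> n - 1" "\<not> val_pt v (seq_act \<gamma> m P) \<le> 0"
      using v vp[OF Z1[OF n]] unfolding primitive_prime_divisor_def by blast
    then show "\<exists>m. 1 \<le> m \<and> m < n \<and> v (y m) > 0"
      using vp[of m] by (intro exI[of _ m]) auto
  qed
  define D where "D n = real (seq_degree \<gamma> n)" for n
  have D2: "2 ^ n \<le> D n" for n using seq_degree_ge[of \<gamma> n] S2[OF \<gamma>S] by (simp add: D_def)
  have D0: "D n > 0" for n using less_le_trans[OF zero_less_power[of 2 n] D2[of n]] by simp
  have Dn: "real n < D n" for n
    using D2[of n] less_exp[of n] by (metis less_le_trans of_nat_less_iff of_nat_numeral of_nat_power)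
  have rf: "range \<gamma> \<subseteq> S" using \<gamma>S by auto
  then have finr: "finite (range \<gamma>)" using S(1) finite_subset by blast
  obtain d where d: "\<And>n. real (Polynomial.degree (\<gamma> n)) \<le> d"
    using finite_range_bound[OF finr, of "\<lambda>f. real (Polynomial.degree f)"] by blast
  have d0: "d > 0" using d[of 0] S2[OF \<gamma>S[of 0]] by simp
  obtain H0 where H0: "\<And>n. height (centre_shift (\<gamma> n)) \<le> H0"
    using finite_range_bound[OF finr, of "\<lambda>f. height (centre_shift f)"] by blast
  have H00: "H0 \<ge> 0" using H0[of 0] height_nonneg order_trans by blast
  define z where "z n = y n - centre_shift (\<gamma> n)" for n
  define f where "f n = centre (\<gamma> n) (\<gamma> (Suc n))" for n
  have zS: "z (Suc n) = poly (f n) (z n)" for n by (simp add: z_def f_def poly_centre yS)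
  have hz: "height (y n) - H0 \<le> height (z n)" for n
    using height_add_le[of "z n" "centre_shift (\<gamma> n)"] H0[of n] by (simp add: z_def)
  have zinf: "\<exists>n. \<forall>k\<ge>n. C < height (z k)" for C
  proof -
    obtain N :: nat where N: "(C + H0) / c < real N" using reals_Archimedean2 by blast
    have "C < height (z k)" if k: "k \<ge> max N n0" for k
    proof -
      have "(C + H0) / c < D k" using N Dn[of k] k by linarith
      then have "C + H0 < c * D k" using c(1) by (simp add: field_simps)
      also have "\<dots> \<le> height (y k)" using c(2)[of k] k by (simp add: D_def)
      finally show ?thesis using hz[of k] by linarith
    qed
    then show ?thesis by blast
  qed
  have small: "\<exists>N. \<forall>n\<in>Z. n \<ge> N \<longrightarrow> C * (1 + support_degree (y n)) < height (z (n - 1))" for C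
  proof -
    define C' where "C' = max C 0"
    have C': "C' \<ge> 0" "C' \<ge> C" by (auto simp: C'_def)
    \<comment> \<open>The available height at time \<open>n - 1\<close> is at least
      \<open>c / d * D n\<close>. One half pays for the term with \<open>n / 2 ^ (n div 2)\<close>,
      the other for the constants; the summand 1 guards against a vanishing
      \<open>C' * K\<close>.\<close>
    have "0 < c / (2 * d * (C' * K + 1))" using c d0 C' K by (intro divide_pos_pos mult_pos_pos add_nonneg_pos) auto
    from order_tendstoD(2)[OF div_two_power_tendsto this]
    obtain N1 where N1: "\<And>n. n \<ge> N1 \<Longrightarrow> real n / 2 ^ (n div 2) < c / (2 * d * (C' * K + 1))"
      by (auto simp: eventually_sequentially)
    obtain N2 :: nat where N2: "(C' * (1 + K) + H0) * (2 * d) / c < real N2" using reals_Archimedean2 by blast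
    have "C * (1 + support_degree (y n)) < height (z (n - 1))" if n: "n \<in> Z" "n \<ge> max (max N1 N2) (Suc n0)" for n
    proof -
      define e where "e = real n / 2 ^ (n div 2)"
      have e0: "e \<ge> 0" by (simp add: e_def)
      have CK: "C' * K + 1 > 0" using mult_nonneg_nonneg[OF C'(1) K(1)] by linarith
      have pos: "0 < 2 * d * (C' * K + 1)" "0 < 2 * d" using CK d0 by simp_all
      have "e < c / (2 * d * (C' * K + 1))" using N1[of n] n by (simp add: e_def)
      then have "e * (2 * d * (C' * K + 1)) < c" unfolding pos_less_divide_eq[OF pos(1)] .
      then have "(C' * K + 1) * e < c / (2 * d)" unfolding pos_less_divide_eq[OF pos(2)] by (simp only: mult_ac)
      then have "C' * K * e < c / (2 * d)" using e0 by (simp add: algebra_simps)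
      then have 1: "C' * K * e * D n \<le> c / (2 * d) * D n" using D0[of n] by (intro mult_right_mono) auto
      have "(C' * (1 + K) + H0) * (2 * d) / c < D n" using N2 Dn[of n] n by linarith
      then have 2: "C' * (1 + K) + H0 < c / (2 * d) * D n" using c d0 by (simp add: field_simps)
      have "C * (1 + support_degree (y n)) \<le> C' * (1 + support_degree (y n))"
        using C' support_degree_nonneg[of "y n"] by (intro mult_right_mono) auto
      also have "\<dots> \<le> C' * (1 + (K + K * real n * (D n / 2 ^ (n div 2))))"
        using Z[OF n(1)] C' unfolding D_def by (intro mult_left_mono add_left_mono) auto
      also have "\<dots> = C' * (1 + K) + C' * K * e * D n" by (simp add: e_def algebra_simps)
      also have "\<dots> < c / d * D n - H0"
      proof -
        have "a + b < w - h" if "w = q + q" "b \<le> q" "a + h < q" for a b w h q :: real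
          using that by linarith
        moreover have "c / d * D n = c / (2 * d) * D n + c / (2 * d) * D n" using d0 by (simp add: field_simps)
        ultimately show ?thesis using 1 2 by blast
      qed
      finally have 3: "C * (1 + support_degree (y n)) < c / d * D n - H0" .
      have "c / d * D n \<le> c * D (n - 1)"
      proof -
        have "n = Suc (n - 1)" using n by simp
        then have "D n = D (n - 1) * real (Polynomial.degree (\<gamma> (n - 1)))"
          unfolding D_def by (metis of_nat_mult seq_degree_Suc)
        also have "\<dots> \<le> D (n - 1) * d" using d D0[of "n - 1"] by (intro mult_left_mono) auto
        finally show ?thesis using c d0 by (simp add: field_simps)
      qed
      also have "\<dots> \<le> height (y (n - 1))" unfolding D_def by (rule c(2)) (use n in auto)
      finally show ?thesis using 3 hz[of "n - 1"] by linarith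
    qed
    then show ?thesis by blast
  qed
  define pair where "pair n = (\<gamma> n, \<gamma> (Suc n))" for n
  have finp: "finite (range pair)"
    by (rule finite_subset[of _ "range \<gamma> \<times> range \<gamma>"]) (use finr in \<open>auto simp: pair_def\<close>)
  have fr: "f n = (case pair n of (g, h) \<Rightarrow> centre g h)" for n by (simp add: f_def pair_def)
  have finf: "finite (range f)"
  proof -
    have "range f \<subseteq> (\<lambda>(g, h). centre g h) ` range pair" using fr by auto
    then show ?thesis by (rule finite_subset) (use finp in auto)
  qed
  have cen: "centred_poly (f n)" "mid_ratio (f n) = mid_ratio (pcompose (\<gamma> n) [:centre_shift (\<gamma> n), 1:])" for n
    using centre_coeffs[OF odd S(2,3,4)[OF \<gamma>S[of n]]] by (simp_all add: f_def)
  \<comment> \<open>The pair at \<open>n - 1\<close> consists of the polynomial leading to time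
    \<open>n\<close> and the one fixing the shift of the coordinate there. A recurring pair yields
    one translation \<open>centre_shift s\<close> with
    \<open>y n = z n + centre_shift s\<close>.\<close>
  have "\<exists>n\<in>Z. \<not> finite {m \<in> Z. pair (m - 1) = pair (n - 1)}"
  proof (rule pigeonhole_infinite)
    show "infinite Z" using inf by (simp add: Z_def)
    show "finite ((\<lambda>m. pair (m - 1)) ` Z)" by (rule finite_subset[OF _ finp]) auto
  qed
  then obtain m where m: "infinite {n \<in> Z. pair (n - 1) = pair (m - 1)}" by blast
  define r where "r = fst (pair (m - 1))"
  define s where "s = snd (pair (m - 1))"
  have rs: "\<exists>n\<in>Z. n \<ge> N \<and> \<gamma> (n - 1) = r \<and> \<gamma> n = s" for N
  proof -
    have "\<exists>n\<ge>N. n \<in> {n \<in> Z. pair (n - 1) = pair (m - 1)}"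
      using m unfolding infinite_nat_iff_unbounded_le by blast
    then obtain n where n: "n \<ge> N" "n \<in> Z" "pair (n - 1) = pair (m - 1)" by blast
    then show ?thesis using Z1[OF n(2)] by (intro bexI[of _ n]) (auto simp: r_def s_def pair_def)
  qed
  \<comment> \<open>Times whose pair occurs only finitely often. There are finitely many of them,
    and the system starts after the last one.\<close>
  define Q where "Q = {k. finite {l. pair l = pair k}}"
  have "finite Q"
  proof -
    have "Q \<subseteq> (\<Union>q\<in>{q \<in> range pair. finite {l. pair l = q}}. {l. pair l = q})" by (auto simp: Q_def)
    then show ?thesis by (rule finite_subset) (use finp in auto)
  qed
  then obtain M1 where M1: "\<And>k. k \<in> Q \<Longrightarrow> k < M1" using finite_nat_set_iff_bounded by metis
  have recur: "\<exists>l\<ge>N. \<gamma> l = \<gamma> k \<and> \<gamma> (Suc l) = \<gamma> (Suc k)" if "k \<ge> M1" for k N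
  proof -
    have "infinite {l. pair l = pair k}" using M1[of k] that by (auto simp: Q_def)
    then show ?thesis unfolding infinite_nat_iff_unbounded_le by (auto simp: pair_def)
  qed
  \<comment> \<open>Critical points of the finitely many \<open>f n\<close> have bounded height, so
    the orbit avoids them once its height is large.\<close>
  define roots where "roots = (\<Union>g\<in>range f. {u. poly (pderiv g) u = 0})"
  have "pderiv (f n) \<noteq> 0" for n
  proof
    assume 0: "pderiv (f n) = 0"
    let ?e = "Polynomial.degree (f n)"
    have e: "?e = Suc (?e - 1)" "(of_nat ?e :: 'k) \<noteq> 0" using cen(1)[of n] by (auto simp: centred_poly_def)
    have "Polynomial.coeff (pderiv (f n)) (?e - 1) = of_nat ?e * Polynomial.lead_coeff (f n)"
      unfolding coeff_pderiv using e(1) by metis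
    then show False using 0 e(2) cen(1)[of n] by (auto simp: centred_poly_def)
  qed
  then have "finite roots"
    unfolding roots_def by (intro finite_UN_I finf poly_roots_finite) auto
  then have "bdd_above (height ` roots)" by (intro bdd_above_finite) auto
  then obtain H1 where H1: "\<And>u. u \<in> roots \<Longrightarrow> height u \<le> H1" by (auto simp: bdd_above_def)
  obtain H2 where H2: "\<And>n. height (mid_ratio (f n)) \<le> H2"
    using finite_range_bound[OF finf, of "\<lambda>g. height (mid_ratio g)"] by blast
  obtain M2 where M2: "\<And>k. k \<ge> M2 \<Longrightarrow> max H1 H2 < height (z k)" using zinf by blast
  define M where "M = max M1 M2"
  have MM: "M1 \<le> M" "M2 \<le> M" by (simp_all add: M_def)
  have sys: "dyn_system (\<lambda>k. \<gamma> (k + M)) (\<lambda>k. f (k + M)) (\<lambda>k. z (k + M)) (centre_shift s) r s"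
    unfolding dyn_system_def
  proof (intro conjI allI impI)
    show "z (Suc k + M) = poly (f (k + M)) (z (k + M))" for k by (simp add: zS)
    show "centred_poly (f (k + M))" for k by (rule cen)
    show "finite (range (\<lambda>k. f (k + M)))" by (rule finite_subset[OF _ finf]) auto
    show "f (k + M) = f (l + M)" if "\<gamma> (k + M) = \<gamma> (l + M) \<and> \<gamma> (Suc k + M) = \<gamma> (Suc l + M)" for k l
      using that by (simp add: f_def)
    show "mid_ratio (f (k + M)) = mid_ratio (f (l + M))" if "\<gamma> (k + M) = \<gamma> (l + M)" for k l
      unfolding cen(2) using that by simp
    show "\<exists>l\<ge>n. \<gamma> (l + M) = \<gamma> (k + M) \<and> \<gamma> (Suc l + M) = \<gamma> (Suc k + M)" for k n
    proof -
      obtain l where l: "l \<ge> n + M" "\<gamma> l = \<gamma> (k + M)" "\<gamma> (Suc l) = \<gamma> (Suc (k + M))"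
        using recur[of "k + M" "n + M"] MM by auto
      then show ?thesis by (intro exI[of _ "l - M"]) (auto simp: Suc_diff_le)
    qed
    show "poly (pderiv (f (k + M))) (z (k + M)) \<noteq> 0" for k
    proof
      assume "poly (pderiv (f (k + M))) (z (k + M)) = 0"
      then have "height (z (k + M)) \<le> H1" by (intro H1) (auto simp: roots_def)
      then show False using M2[of "k + M"] MM by simp
    qed
    show "\<exists>n. \<forall>k\<ge>n. C < height (z (k + M))" for C
    proof -
      obtain n where "\<And>k. k \<ge> n \<Longrightarrow> C < height (z k)" using zinf by blast
      then show ?thesis by (intro exI[of _ n]) auto
    qed
    fix C :: real
    obtain N where N: "\<And>n. n \<in> Z \<Longrightarrow> n \<ge> N \<Longrightarrow> C * (1 + support_degree (y n)) < height (z (n - 1))"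
      using small by blast
    obtain n where n: "n \<in> Z" "n \<ge> max N (Suc M)" "\<gamma> (n - 1) = r" "\<gamma> n = s" using rs by blast
    define k where "k = n - 1 - M"
    have k: "k + M = n - 1" "Suc k + M = n" using n(2) by (auto simp: k_def)
    have "z (Suc k + M) + centre_shift s = y n" unfolding k(2) z_def n(4) by simp
    then show "\<exists>n. \<gamma> (n + M) = r \<and> \<gamma> (Suc n + M) = s \<and> z (Suc n + M) + centre_shift s \<noteq> 0 \<and>
        C * (1 + support_degree (z (Suc n + M) + centre_shift s)) < height (z (n + M))"
      using N[OF n(1)] nz[OF Z1[OF n(1)]] n k by (intro exI[of _ k]) simp
  qed
  \<comment> \<open>Without such a place every pole of \<open>z M\<close> would be dominated by one
    of its \<open>mid_ratio\<close>, whose height is bounded by \<open>H2\<close>; but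
    \<open>M\<close> lies beyond \<open>M2\<close>.\<close>
  have "\<exists>v\<in>places. v (z (0 + M) ^ 2 / mid_ratio (f (0 + M))) < 0"
  proof (rule ccontr)
    assume no: "\<not> ?thesis"
    let ?b = "mid_ratio (f M)"
    have b0: "?b \<noteq> 0" using mid_ratio_nonzero[OF cen(1)] .
    have "height (z M) \<le> height ?b + height (0 :: 'k)"
    proof (rule height_mono_add)
      fix v :: "'k \<Rightarrow> int" assume v: "v \<in> places"
      show "pole_order v (z M) \<le> pole_order v ?b + pole_order v 0"
      proof (cases "z M = 0")
        case True
        then show ?thesis by (simp add: pole_order_nonneg)
      next
        case False
        then have "v (z M ^ 2 / ?b) = 2 * v (z M) - v ?b"
          using b0 val_divide[OF v, of "z M ^ 2" ?b] by (simp add: val_power[OF v])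
        moreover have "v (z M ^ 2 / ?b) \<ge> 0" using no v by auto
        ultimately show ?thesis by (simp add: pole_order_def val_zero[OF v])
      qed
    qed
    moreover have "height (0 :: 'k) = 0"
      unfolding height_def divisor_degree_def by (intro sum.neutral) (auto simp: pole_order_def val_zero)
    ultimately show False using H2[of M] M2[of M] MM by simp
  qed
  then obtain v where "v \<in> places" "v (z (0 + M) ^ 2 / mid_ratio (f (0 + M))) < 0" by blast
  then show False using no_dyn_system[OF odd _ sys] by blast
qed

end

theorem theorem1p9:
  fixes \<iota> :: "'p::prime_card mod_ring poly fract \<Rightarrow> 'k::field"
    and S :: "'k poly set"
  assumes "odd CARD('p)"
    and "finite_separable_extension \<iota>"
    and "finite S"
    and "\<forall>\<phi>\<in>S. Polynomial.degree \<phi> \<ge> 3"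
    and "\<forall>\<phi>\<in>S. \<forall>\<psi>\<in>S.
           of_nat (Polynomial.degree \<phi>) * of_nat (Polynomial.degree \<psi>)
           * delta_poly \<phi> * delta_poly \<psi>
           * (b_poly (deriv_ext \<iota>) \<phi> - f_poly (deriv_ext \<iota>) \<psi>) \<noteq> 0"
    and "Aff 0 \<notin> PrePer S"
  shows "\<forall>(\<gamma>, P) \<in> good_pairs S. finite (zsigmondy_set \<gamma> P)"
proof -
  interpret function_field "CARD('p)" "TYPE('k)" by (rule function_field_of_extension[OF assms(2)])
  have "(of_nat (Polynomial.degree \<phi>) :: 'k) \<noteq> 0" "delta_poly \<phi> \<noteq> 0" if "\<phi> \<in> S" for \<phi>
    using assms(5) that by auto
  then show ?thesis using finite_zsigmondy_set assms by blast
qed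

end
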